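(* Let $(R,\mathfrak m,k)$ be a commutative Noetherian local ring with $\mathfrak m\neq 0$ and let $M$ be a finitely generated $R$-module. Then: (a) If $i>0$ and $F$ is a minimal free resolution of $M$, then $\operatorname{H}_i(\operatorname{lin}^R(F))=0$ if and only if $\nu^n_{i+1}(M)=0=\nu^n_i(M)$ for all $n>0$. (b) For an integer $d\ge 0$, $\operatorname{ld}_R(M)\le d$ if and only if $\nu^n_i(M)=0$ for all $i>d$ and all $n\ge 0$. (c) $\operatorname{ld}_R(M)=0$ if and only if $\nu_i^n(M)=0$ for all $i>0$ and all $n\ge 0$.
   Context: For a finitely generated $R$-module $M$ and integers $n,i\ge 0$, $\nu^n_i(M)\colon \operatorname{Tor}_i^R(M,R/\mathfrak m^{n+1})\to\operatorname{Tor}_i^R(M,R/\mathfrak m^n)$ denotes the map induced by the canonical surjection $R/\mathfrak m^{n+1}\to R/\mathfrak m^n$ (with $\mathfrak m^0=R$). Linearity defect. Let $F$ be a minimal free resolution of $M$ with differential $\partial$ (so $\partial F\subseteq \mathfrak mF$). For a finitely generated module $N$ write $N^{\mathsf g}=\bigoplus_{n\ge 0}\mathfrak m^nN/\mathfrak m^{n+1}N$, a graded module over $R^{\mathsf g}=\bigoplus_{n\ge0}\mathfrak m^n/\mathfrak m^{n+1}$. The complex $\operatorname{lin}^R(F)$ of graded $R^{\mathsf g}$-modules has $F_i^{\mathsf g}(-i)$ in homological degree $i$, with differential induced by $\partial$: the class of $x\in\mathfrak m^nF_i$ modulo $\mathfrak m^{n+1}F_i$ is sent to the class of $\partial x\in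 \mathfrak m^{n+1}F_{i-1}$ modulo $\mathfrak m^{n+2}F_{i-1}$. The linearity defect of $M$ is $\operatorname{ld}_R(M)=\sup\{i\in\mathbb Z\mid \operatorname{H}_i(\operatorname{lin}^R(F))\neq 0\}$, with the convention $\operatorname{ld}_R(0)=0$. *)

theory Defs
  imports "HOL-Algebra.Module" "HOL-Algebra.Ideal_Product" "HOL-Algebra.Ring_Divisibility" "HOL-Library.Extended_Real"
begin

text \<open>Modules are the records of \<^theory>\<open>HOL-Algebra.Module\<close>. Such a record extends a ring record;
  its fields for multiplication and one play no role for modules and are left undefined.\<close>

section \<open>Local rings and ideals\<close>

definition local_ring :: "('a, 'r) ring_scheme \<Rightarrow> 'a set \<Rightarrow> bool" where
  "local_ring R m \<longleftrightarrow> cring R \<and> maximalideal m R \<and> (\<forall>J. maximalideal J R \<longrightarrow> J = m)"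

primrec ideal_pow :: "('a, 'r) ring_scheme \<Rightarrow> 'a set \<Rightarrow> nat \<Rightarrow> 'a set" where
  "ideal_pow R I 0 = carrier R"
| "ideal_pow R I (Suc n) = ideal_prod R I (ideal_pow R I n)"

section \<open>Modules\<close>

definition module_span :: "('a, 'r) ring_scheme \<Rightarrow> ('a, 'b, 's) module_scheme \<Rightarrow> 'b set \<Rightarrow> 'b set" where
  "module_span R M A = \<Inter> {H. submodule H R M \<and> A \<subseteq> H}"

definition fin_gen_module :: "('a, 'r) ring_scheme \<Rightarrow> ('a, 'b, 's) module_scheme \<Rightarrow> bool" where
  "fin_gen_module R M \<longleftrightarrow>
     module R M \<and> (\<exists>A. finite A \<and> A \<subseteq> carrier M \<and> module_span R M A = carrier M)"

definition zero_module :: "('a, 'b, 's) module_scheme \<Rightarrow> bool" where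
  "zero_module M \<longleftrightarrow> carrier M = {\<zero>\<^bsub>M\<^esub>}"

definition module_homs ::
  "('a, 'r) ring_scheme \<Rightarrow> ('a, 'b, 's) module_scheme \<Rightarrow> ('a, 'c, 't) module_scheme \<Rightarrow> ('b \<Rightarrow> 'c) set" where
  "module_homs R M N = {f \<in> carrier M \<rightarrow> carrier N.
     (\<forall>x\<in>carrier M. \<forall>y\<in>carrier M. f (x \<oplus>\<^bsub>M\<^esub> y) = f x \<oplus>\<^bsub>N\<^esub> f y) \<and>
     (\<forall>r\<in>carrier R. \<forall>x\<in>carrier M. f (r \<odot>\<^bsub>M\<^esub> x) = r \<odot>\<^bsub>N\<^esub> f x)}"

text \<open>The submodule \<open>I M\<close>, for an ideal \<open>I\<close>.\<close>

definition ideal_smult :: "('a, 'r) ring_scheme \<Rightarrow> 'a set \<Rightarrow> ('a, 'b, 's) module_scheme \<Rightarrow> 'b set" where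
  "ideal_smult R I M = module_span R M {a \<odot>\<^bsub>M\<^esub> x | a x. a \<in> I \<and> x \<in> carrier M}"

definition self_module :: "('a, 'r) ring_scheme \<Rightarrow> ('a, 'a) module" where
  "self_module R = \<lparr>carrier = carrier R, monoid.mult = undefined, one = undefined,
     ring.zero = \<zero>\<^bsub>R\<^esub>, ring.add = ring.add R, smult = monoid.mult R\<rparr>"

text \<open>The quotient of \<open>M\<close> by a submodule \<open>K\<close>. The union in the scalar multiplication, and likewise
  in \<open>quot_map\<close> below, is a union of equal cosets: it picks out the coset of the image of
  any representative.\<close>

definition quot_module :: "('a, 'b, 's) module_scheme \<Rightarrow> 'b set \<Rightarrow> ('a, 'b set) module" where
  "quot_module M K = \<lparr>carrier = a_rcosets\<^bsub>M\<^esub> K, monoid.mult = undefined, one = undefined,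
     ring.zero = K, ring.add = set_add M, smult = (\<lambda>r X. \<Union>x\<in>X. K +>\<^bsub>M\<^esub> (r \<odot>\<^bsub>M\<^esub> x))\<rparr>"

text \<open>For \<open>f\<close> mapping \<open>K\<close> into \<open>L\<close>, the map from a quotient by \<open>K\<close> to \<open>N / L\<close> induced by \<open>f\<close>.\<close>

definition quot_map :: "('a, 'c, 't) module_scheme \<Rightarrow> 'c set \<Rightarrow> ('b \<Rightarrow> 'c) \<Rightarrow> 'b set \<Rightarrow> 'c set" where
  "quot_map N L f X = (\<Union>x\<in>X. L +>\<^bsub>N\<^esub> f x)"

section \<open>Free modules\<close>

definition free_module :: "('a, 'r) ring_scheme \<Rightarrow> 'x set \<Rightarrow> ('a, 'x \<Rightarrow> 'a) module" where
  "free_module R B = \<lparr>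
     carrier = {c. (\<forall>b. c b \<in> carrier R) \<and> (\<forall>b. b \<notin> B \<longrightarrow> c b = \<zero>\<^bsub>R\<^esub>) \<and> finite {b. c b \<noteq> \<zero>\<^bsub>R\<^esub>}},
     monoid.mult = undefined, one = undefined, ring.zero = (\<lambda>_. \<zero>\<^bsub>R\<^esub>),
     ring.add = (\<lambda>c c' b. c b \<oplus>\<^bsub>R\<^esub> c' b), smult = (\<lambda>r c b. r \<otimes>\<^bsub>R\<^esub> c b)\<rparr>"

definition free_gen :: "('a, 'r) ring_scheme \<Rightarrow> 'x \<Rightarrow> 'x \<Rightarrow> 'a" where
  "free_gen R w = (\<lambda>b. if b = w then \<one>\<^bsub>R\<^esub> else \<zero>\<^bsub>R\<^esub>)"

text \<open>The linear extension of a map \<open>g\<close> from a basis to \<open>M\<close>.\<close>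

definition lin_ext ::
  "('a, 'r) ring_scheme \<Rightarrow> ('a, 'b, 's) module_scheme \<Rightarrow> ('x \<Rightarrow> 'b) \<Rightarrow> ('x \<Rightarrow> 'a) \<Rightarrow> 'b" where
  "lin_ext R M g c = (\<Oplus>\<^bsub>M\<^esub>b\<in>{b. c b \<noteq> \<zero>\<^bsub>R\<^esub>}. c b \<odot>\<^bsub>M\<^esub> g b)"

definition is_free_module :: "('a, 'r) ring_scheme \<Rightarrow> ('a, 'b, 's) module_scheme \<Rightarrow> bool" where
  "is_free_module R M \<longleftrightarrow> module R M \<and> (\<exists>B \<subseteq> carrier M.
     bij_betw (lin_ext R M (\<lambda>b. b)) (carrier (free_module R B)) (carrier M))"

section \<open>Tensor products\<close>

definition tensor_relations :: "('a, 'r) ring_scheme \<Rightarrow> ('a, 'b, 's) module_scheme \<Rightarrow>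
    ('a, 'c, 't) module_scheme \<Rightarrow> ('b \<times> 'c \<Rightarrow> 'a) set" where
  "tensor_relations R M N = (let L = free_module R (carrier M \<times> carrier N); g = free_gen R in
     module_span R L (
       {g (x \<oplus>\<^bsub>M\<^esub> x', y) \<ominus>\<^bsub>L\<^esub> (g (x, y) \<oplus>\<^bsub>L\<^esub> g (x', y)) | x x' y.
          x \<in> carrier M \<and> x' \<in> carrier M \<and> y \<in> carrier N}
     \<union> {g (x, y \<oplus>\<^bsub>N\<^esub> y') \<ominus>\<^bsub>L\<^esub> (g (x, y) \<oplus>\<^bsub>L\<^esub> g (x, y')) | x y y'.
          x \<in> carrier M \<and> y \<in> carrier N \<and> y' \<in> carrier N}
     \<union> {g (r \<odot>\<^bsub>M\<^esub> x, y) \<ominus>\<^bsub>L\<^esub> r \<odot>\<^bsub>L\<^esub> g (x, y) | r x y.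
          r \<in> carrier R \<and> x \<in> carrier M \<and> y \<in> carrier N}
     \<union> {g (x, r \<odot>\<^bsub>N\<^esub> y) \<ominus>\<^bsub>L\<^esub> r \<odot>\<^bsub>L\<^esub> g (x, y) | r x y.
          r \<in> carrier R \<and> x \<in> carrier M \<and> y \<in> carrier N}))"

definition tensor :: "('a, 'r) ring_scheme \<Rightarrow> ('a, 'b, 's) module_scheme \<Rightarrow>
    ('a, 'c, 't) module_scheme \<Rightarrow> ('a, ('b \<times> 'c \<Rightarrow> 'a) set) module" where
  "tensor R M N =
     quot_module (free_module R (carrier M \<times> carrier N)) (tensor_relations R M N)"

text \<open>The map \<open>f \<otimes> g\<close> into the tensor product of \<open>M'\<close> and \<open>N'\<close>.\<close>

definition tensor_map :: "('a, 'r) ring_scheme \<Rightarrow> ('a, 'b, 's) module_scheme \<Rightarrow>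
    ('a, 'c, 't) module_scheme \<Rightarrow> ('d \<Rightarrow> 'b) \<Rightarrow> ('e \<Rightarrow> 'c) \<Rightarrow>
    ('d \<times> 'e \<Rightarrow> 'a) set \<Rightarrow> ('b \<times> 'c \<Rightarrow> 'a) set" where
  "tensor_map R M' N' f g = (let L = free_module R (carrier M' \<times> carrier N') in
     quot_map L (tensor_relations R M' N') (lin_ext R L (\<lambda>(x, y). free_gen R (f x, g y))))"

section \<open>Complexes and resolutions\<close>

text \<open>Complexes are concentrated in nonnegative homological degrees; \<open>cdiff C i\<close> maps
  \<open>cmod C i\<close> to \<open>cmod C (i - 1)\<close> for \<open>i > 0\<close>, and \<open>cdiff C 0\<close> is never used.\<close>

record ('a, 'f) chain_complex =
  cmod :: "nat \<Rightarrow> ('a, 'f) module"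
  cdiff :: "nat \<Rightarrow> 'f \<Rightarrow> 'f"

definition cycles :: "('a, 'f) chain_complex \<Rightarrow> nat \<Rightarrow> 'f set" where
  "cycles C i = (if i = 0 then carrier (cmod C 0)
     else {x \<in> carrier (cmod C i). cdiff C i x = \<zero>\<^bsub>cmod C (i - 1)\<^esub>})"

definition boundaries :: "('a, 'f) chain_complex \<Rightarrow> nat \<Rightarrow> 'f set" where
  "boundaries C i = cdiff C (i + 1) ` carrier (cmod C (i + 1))"

definition homology :: "('a, 'f) chain_complex \<Rightarrow> nat \<Rightarrow> ('a, 'f set) module" where
  "homology C i = quot_module ((cmod C i)\<lparr>carrier := cycles C i\<rparr>) (boundaries C i)"

definition free_resolution ::
  "('a, 'r) ring_scheme \<Rightarrow> ('a, 'b, 's) module_scheme \<Rightarrow> ('a, 'f) chain_complex \<Rightarrow> bool" where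
  "free_resolution R M F \<longleftrightarrow>
     (\<forall>i. is_free_module R (cmod F i)) \<and>
     (\<forall>i>0. cdiff F i \<in> module_homs R (cmod F i) (cmod F (i - 1))) \<and>
     (\<forall>i>0. cycles F i = boundaries F i) \<and>
     (\<exists>e \<in> module_homs R (cmod F 0) M. e ` carrier (cmod F 0) = carrier M \<and>
        {x \<in> carrier (cmod F 0). e x = \<zero>\<^bsub>M\<^esub>} = boundaries F 0)"

definition minimal_free_resolution :: "('a, 'r) ring_scheme \<Rightarrow> 'a set \<Rightarrow>
    ('a, 'b, 's) module_scheme \<Rightarrow> ('a, 'f) chain_complex \<Rightarrow> bool" where
  "minimal_free_resolution R m M F \<longleftrightarrow> free_resolution R M F \<and>
     (\<forall>i. fin_gen_module R (cmod F i)) \<and>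
     (\<forall>i>0. cdiff F i ` carrier (cmod F i) \<subseteq> ideal_smult R m (cmod F (i - 1)))"

section \<open>Tor\<close>

text \<open>Tor is computed from a chosen free resolution of the first argument; up to natural
  isomorphism it does not depend on the choice. The elements of the chosen resolution live in the
  type \<open>nat \<Rightarrow> 'a\<close>, which hosts the free modules of finite rank. Hence a resolution exists
  whenever the ring is Noetherian and the module is finitely generated, and Tor is meaningful for
  such modules only.\<close>

definition some_free_resolution ::
  "('a, 'r) ring_scheme \<Rightarrow> ('a, 'b, 's) module_scheme \<Rightarrow> ('a, nat \<Rightarrow> 'a) chain_complex" where
  "some_free_resolution R M = (SOME F. free_resolution R M F)"

definition tensor_complex :: "('a, 'r) ring_scheme \<Rightarrow> ('a, 'f) chain_complex \<Rightarrow>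
    ('a, 'c, 't) module_scheme \<Rightarrow> ('a, ('f \<times> 'c \<Rightarrow> 'a) set) chain_complex" where
  "tensor_complex R C N = \<lparr>cmod = (\<lambda>i. tensor R (cmod C i) N),
     cdiff = (\<lambda>i. tensor_map R (cmod C (i - 1)) N (cdiff C i) (\<lambda>y. y))\<rparr>"

definition Tor :: "('a, 'r) ring_scheme \<Rightarrow> nat \<Rightarrow> ('a, 'b, 's) module_scheme \<Rightarrow>
    ('a, 'c, 't) module_scheme \<Rightarrow> ('a, ((nat \<Rightarrow> 'a) \<times> 'c \<Rightarrow> 'a) set set) module" where
  "Tor R i M N = homology (tensor_complex R (some_free_resolution R M) N) i"

text \<open>The map into \<open>Tor R i M N'\<close> induced by a homomorphism \<open>g\<close> into \<open>N'\<close>.\<close>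

definition Tor_map :: "('a, 'r) ring_scheme \<Rightarrow> nat \<Rightarrow> ('a, 'b, 's) module_scheme \<Rightarrow>
    ('a, 'c, 't) module_scheme \<Rightarrow> ('d \<Rightarrow> 'c) \<Rightarrow>
    ((nat \<Rightarrow> 'a) \<times> 'd \<Rightarrow> 'a) set set \<Rightarrow> ((nat \<Rightarrow> 'a) \<times> 'c \<Rightarrow> 'a) set set" where
  "Tor_map R i M N' g = (let F = some_free_resolution R M; C' = tensor_complex R F N' in
     quot_map (cmod C' i) (boundaries C' i) (tensor_map R (cmod F i) N' (\<lambda>x. x) g))"

definition power_quotient :: "('a, 'r) ring_scheme \<Rightarrow> 'a set \<Rightarrow> nat \<Rightarrow> ('a, 'a set) module" where
  "power_quotient R m n = quot_module (self_module R) (ideal_pow R m n)"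

text \<open>The canonical surjection onto \<open>R / m\<^sup>n\<close> from \<open>R / m\<^sup>n\<^sup>+\<^sup>1\<close>.\<close>

definition power_quotient_map :: "('a, 'r) ring_scheme \<Rightarrow> 'a set \<Rightarrow> nat \<Rightarrow> 'a set \<Rightarrow> 'a set" where
  "power_quotient_map R m n = quot_map (self_module R) (ideal_pow R m n) (\<lambda>x. x)"

definition nu :: "('a, 'r) ring_scheme \<Rightarrow> 'a set \<Rightarrow> nat \<Rightarrow> nat \<Rightarrow> ('a, 'b, 's) module_scheme \<Rightarrow>
    ((nat \<Rightarrow> 'a) \<times> 'a set \<Rightarrow> 'a) set set \<Rightarrow> ((nat \<Rightarrow> 'a) \<times> 'a set \<Rightarrow> 'a) set set" where
  "nu R m n i M = Tor_map R i M (power_quotient R m n) (power_quotient_map R m n)"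

definition nu_vanishes ::
  "('a, 'r) ring_scheme \<Rightarrow> 'a set \<Rightarrow> nat \<Rightarrow> nat \<Rightarrow> ('a, 'b, 's) module_scheme \<Rightarrow> bool" where
  "nu_vanishes R m n i M \<longleftrightarrow> (\<forall>t \<in> carrier (Tor R i M (power_quotient R m (n + 1))).
     nu R m n i M t = \<zero>\<^bsub>Tor R i M (power_quotient R m n)\<^esub>)"

section \<open>The linear part and the linearity defect\<close>

text \<open>\<open>gr_piece R m N s j\<close> is the component in internal degree \<open>j\<close> of the shifted associated graded
  module \<open>N\<^sup>g(-s)\<close>, that is \<open>m\<^sup>j\<^sup>-\<^sup>s N / m\<^sup>j\<^sup>-\<^sup>s\<^sup>+\<^sup>1 N\<close> if \<open>j \<ge> s\<close>. If \<open>j < s\<close>, both truncated differences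
  in the definition vanish and it yields the zero module \<open>N / N\<close>, as it should.\<close>

definition gr_piece :: "('a, 'r) ring_scheme \<Rightarrow> 'a set \<Rightarrow> ('a, 'f, 's) module_scheme \<Rightarrow> nat \<Rightarrow> nat \<Rightarrow>
    ('a, 'f set) module" where
  "gr_piece R m N s j =
     quot_module (N\<lparr>carrier := ideal_smult R (ideal_pow R m (j - s)) N\<rparr>)
       (ideal_smult R (ideal_pow R m (j + 1 - s)) N)"

text \<open>The graded module \<open>N\<^sup>g(-s)\<close>, the direct sum of these components. Its scalars are the elements
  of \<open>R\<^sup>g\<close>: finitely supported families of classes \<open>A p\<close> in \<open>m\<^sup>p / m\<^sup>p\<^sup>+\<^sup>1\<close>.\<close>

definition gr_module :: "('a, 'r) ring_scheme \<Rightarrow> 'a set \<Rightarrow> ('a, 'f, 's) module_scheme \<Rightarrow> nat \<Rightarrow>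
    (nat \<Rightarrow> 'a set, nat \<Rightarrow> 'f set) module" where
  "gr_module R m N s = \<lparr>
     carrier = {X. (\<forall>j. X j \<in> carrier (gr_piece R m N s j)) \<and>
                   finite {j. X j \<noteq> \<zero>\<^bsub>gr_piece R m N s j\<^esub>}},
     monoid.mult = undefined, one = undefined,
     ring.zero = (\<lambda>j. \<zero>\<^bsub>gr_piece R m N s j\<^esub>),
     ring.add = (\<lambda>X Y j. X j \<oplus>\<^bsub>gr_piece R m N s j\<^esub> Y j),
     smult = (\<lambda>A X j. \<Oplus>\<^bsub>gr_piece R m N s j\<^esub>p\<in>{..j}.
       (\<Union>a\<in>A p. \<Union>x\<in>X (j - p).
          ideal_smult R (ideal_pow R m (j + 1 - s)) N +>\<^bsub>N\<^esub> (a \<odot>\<^bsub>N\<^esub> x)))\<rparr>"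

text \<open>Because of the shifts the differential of the linear part preserves internal degrees: with
  \<open>j = n + i\<close> it sends the class of \<open>x\<close> in \<open>m\<^sup>n F\<^sub>i / m\<^sup>n\<^sup>+\<^sup>1 F\<^sub>i\<close> to the class of its image under the
  differential of \<open>F\<close> modulo the \<open>(n + 2)\<close>-nd power of \<open>m\<close>, and \<open>j + 1 - (i - 1) = n + 2\<close>.\<close>

definition lin_complex :: "('a, 'r) ring_scheme \<Rightarrow> 'a set \<Rightarrow> ('a, 'f) chain_complex \<Rightarrow>
    (nat \<Rightarrow> 'a set, nat \<Rightarrow> 'f set) chain_complex" where
  "lin_complex R m F = \<lparr>cmod = (\<lambda>i. gr_module R m (cmod F i) i),
     cdiff = (\<lambda>i X j.
       quot_map (cmod F (i - 1))
         (ideal_smult R (ideal_pow R m (j + 1 - (i - 1))) (cmod F (i - 1)))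
         (cdiff F i) (X j))\<rparr>"

text \<open>As for Tor, the minimal free resolution is a chosen one; it is unique up to isomorphism.
  The supremum is taken in the extended reals, so that it would be \<open>-\<infinity>\<close> for the empty set.\<close>

definition some_minimal_free_resolution :: "('a, 'r) ring_scheme \<Rightarrow> 'a set \<Rightarrow>
    ('a, 'b, 's) module_scheme \<Rightarrow> ('a, nat \<Rightarrow> 'a) chain_complex" where
  "some_minimal_free_resolution R m M = (SOME F. minimal_free_resolution R m M F)"

definition linearity_defect ::
  "('a, 'r) ring_scheme \<Rightarrow> 'a set \<Rightarrow> ('a, 'b, 's) module_scheme \<Rightarrow> ereal" where
  "linearity_defect R m M = (if zero_module M then 0 else
     Sup {ereal (real i) | i.
       \<not> zero_module (homology (lin_complex R m (some_minimal_free_resolution R m M)) i)})"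

end

theory Submission
  imports Defs
begin

text \<open>
Let \<open>F\<close> be a free resolution of \<open>M\<close> with differential \<open>d\<close>. Since \<open>Tor\<^sub>i(M, R/m\<^sup>n)\<close> is the homology of
\<open>F/m\<^sup>nF\<close>, the map \<open>\<nu>\<^sup>n\<^sub>i\<close> vanishes iff every \<open>x \<in> F\<^sub>i\<close> with \<open>d x \<in> m\<^sup>n\<^sup>+\<^sup>1F\<close> lies in \<open>d F + m\<^sup>nF\<close>
(\<open>nu_criterion\<close>). Homomorphisms preserve the filtration by powers of \<open>m\<close>, so chain maps lifting the identity of
\<open>M\<close> and a homotopy carry this criterion from one free resolution to another, in particular to a minimal one.

For minimal \<open>F\<close>, \<open>H\<^sub>i(lin F) = 0\<close> says that each \<open>x \<in> m\<^sup>nF\<^sub>i\<close> with \<open>d x \<in> m\<^sup>n\<^sup>+\<^sup>2F\<close> is congruent modulo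
\<open>m\<^sup>n\<^sup>+\<^sup>1F\<^sub>i\<close> to some \<open>d y\<close> with \<open>y \<in> m\<^sup>n\<^sup>-\<^sup>1F\<close> (\<open>lin_exact\<close>). Finitely many such corrections give the criterion
in degree \<open>i\<close>. In degree \<open>i + 1\<close> infinitely many are needed: a boundary in \<open>m\<^sup>n\<^sup>+\<^sup>1F\<^sub>i\<close> is congruent
to an element of \<open>d(m\<^sup>nF)\<close> modulo every power of \<open>m\<close>, and Krull's intersection theorem concludes. Conversely, the
criterion in degree \<open>i\<close> yields \<open>y\<close>, and the one in degree \<open>i + 1\<close> allows to choose it in \<open>m\<^sup>n\<^sup>-\<^sup>1F\<close>.
\<close>

section \<open>Submodules and homomorphisms\<close>

text \<open>Nothing is known about the resolution behind \<open>Tor\<close> except that it is free: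
  it was chosen without regard to minimality. So vanishing of \<open>\<nu>\<close> is turned into a
  condition on elements that makes sense over every free resolution and can be moved along chain
  maps; an isomorphism between Tor modules of two resolutions is never built. The exponents fit
  because minimality makes the differential raise the m-adic filtration by one, so that it acts on
  associated graded pieces. Krull's theorem is needed relative to a submodule, namely
  d(\<open>m\<^sup>nF\<close>), and not just for the zero submodule. Two points lie outside the main
  equivalence. Part (c) also needs that the defect is never below 0, that is, H_0(lin F) \<noteq> 0
  for M \<noteq> 0; this is Nakayama's lemma. For M = 0 the defect is fixed by convention, and the
  vanishing of \<open>\<nu>\<close> then comes from a contracting homotopy.\<close>

lemma (in cring) ideal_pow_ideal:
  assumes "ideal I R"
  shows "ideal (ideal_pow R I n) R"
  by (induction n) (use assms in \<open>auto simp: oneideal ideal_prod_is_ideal\<close>)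

lemma (in cring) ideal_pow_antimono:
  assumes "ideal I R" "k \<le> n"
  shows "ideal_pow R I n \<subseteq> ideal_pow R I k"
  using assms(2)
proof (induction rule: dec_induct)
  case (step n)
  have "ideal_pow R I (Suc n) \<subseteq> ideal_pow R I n"
    using ideal_prod_inter[OF assms(1) ideal_pow_ideal[OF assms(1), of n]] by auto
  then show ?case using step.IH by blast
qed simp

context module
begin

text \<open>Closure under negatives, which \<open>submoduleI\<close> also demands, follows from
  multiplication by \<open>\<ominus> \<one>\<close>.\<close>

lemma submoduleI':
  assumes "H \<subseteq> carrier M" "\<zero>\<^bsub>M\<^esub> \<in> H"
    and "\<And>a b. \<lbrakk>a \<in> H; b \<in> H\<rbrakk> \<Longrightarrow> a \<oplus>\<^bsub>M\<^esub> b \<in> H"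
    and "\<And>a x. \<lbrakk>a \<in> carrier R; x \<in> H\<rbrakk> \<Longrightarrow> a \<odot>\<^bsub>M\<^esub> x \<in> H"
  shows "submodule H R M"
proof (rule submoduleI)
  fix a assume "a \<in> H"
  then show "\<ominus>\<^bsub>M\<^esub> a \<in> H"
    using assms(4)[of "\<ominus> \<one>" a] smult_l_minus[of \<one> a] assms(1) by auto
qed (use assms in auto)

lemma submodule_carrierD: "submodule H R M \<Longrightarrow> x \<in> H \<Longrightarrow> x \<in> carrier M"
  using submoduleE(1) by blast

lemma submodule_zero: "submodule H R M \<Longrightarrow> \<zero>\<^bsub>M\<^esub> \<in> H"
  using submodule.axioms(1) subgroup.one_closed by fastforce

lemma submodule_minus:
  "submodule H R M \<Longrightarrow> x \<in> H \<Longrightarrow> y \<in> H \<Longrightarrow> x \<ominus>\<^bsub>M\<^esub> y \<in> H"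
  by (simp add: a_minus_def submoduleE)

lemma submodule_Inter:
  assumes "\<And>H. H \<in> X \<Longrightarrow> submodule H R M" "X \<noteq> {}"
  shows "submodule (\<Inter>X) R M"
proof (rule submoduleI')
  show "\<Inter>X \<subseteq> carrier M" using assms submoduleE(1) by blast
qed (use assms in \<open>auto intro: submodule_zero submoduleE(4,5)\<close>)

lemma submodule_span: "A \<subseteq> carrier M \<Longrightarrow> submodule (module_span R M A) R M"
  unfolding module_span_def
  by (rule submodule_Inter) (use carrier_is_submodule in auto)

lemma span_least: "submodule H R M \<Longrightarrow> A \<subseteq> H \<Longrightarrow> module_span R M A \<subseteq> H"
  unfolding module_span_def by blast

lemma span_superset: "A \<subseteq> module_span R M A"
  unfolding module_span_def by blast

lemma span_mono: "A \<subseteq> B \<Longrightarrow> module_span R M A \<subseteq> module_span R M B"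
  unfolding module_span_def by blast

lemma submodule_finsum:
  assumes "submodule H R M" "f \<in> A \<rightarrow> H"
  shows "finsum M f A \<in> H"
proof (cases "finite A")
  case True
  then show ?thesis using assms(2)
  proof (induction A)
    case (insert x A)
    then have "f \<in> A \<rightarrow> carrier M" "f x \<in> carrier M"
      using assms(1) submodule_carrierD by (auto simp: Pi_iff)
    then show ?case using insert assms(1) by (simp add: submoduleE(5) Pi_iff)
  qed (use assms submodule_zero in auto)
qed (use assms submodule_zero in \<open>auto simp: finsum_infinite\<close>)

lemma mem_set_add: "x \<in> H <+>\<^bsub>M\<^esub> K \<longleftrightarrow> (\<exists>h\<in>H. \<exists>k\<in>K. x = h \<oplus>\<^bsub>M\<^esub> k)"
  by (auto simp: set_add_def')

lemma submodule_set_add: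
  assumes H: "submodule H R M" and K: "submodule K R M"
  shows "submodule (H <+>\<^bsub>M\<^esub> K) R M"
proof (rule submoduleI')
  note c = submodule_carrierD[OF H] submodule_carrierD[OF K]
  show "H <+>\<^bsub>M\<^esub> K \<subseteq> carrier M" by (auto simp: mem_set_add c)
  show "\<zero>\<^bsub>M\<^esub> \<in> H <+>\<^bsub>M\<^esub> K"
    unfolding mem_set_add using submodule_zero[OF H] submodule_zero[OF K] by (metis M.l_zero M.zero_closed)
  fix a b assume "a \<in> H <+>\<^bsub>M\<^esub> K" "b \<in> H <+>\<^bsub>M\<^esub> K"
  then obtain h k h' k' where *: "h \<in> H" "k \<in> K" "h' \<in> H" "k' \<in> K" "a = h \<oplus>\<^bsub>M\<^esub> k" "b = h' \<oplus>\<^bsub>M\<^esub> k'"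
    unfolding mem_set_add by blast
  have "a \<oplus>\<^bsub>M\<^esub> b = (h \<oplus>\<^bsub>M\<^esub> h') \<oplus>\<^bsub>M\<^esub> (k \<oplus>\<^bsub>M\<^esub> k')" using * by (simp add: M.a_ac c)
  then show "a \<oplus>\<^bsub>M\<^esub> b \<in> H <+>\<^bsub>M\<^esub> K" unfolding mem_set_add using * H K submoduleE(5) by blast
next
  note c = submodule_carrierD[OF H] submodule_carrierD[OF K]
  fix a x assume a: "a \<in> carrier R" and "x \<in> H <+>\<^bsub>M\<^esub> K"
  then obtain h k where *: "h \<in> H" "k \<in> K" "x = h \<oplus>\<^bsub>M\<^esub> k" unfolding mem_set_add by blast
  then have "a \<odot>\<^bsub>M\<^esub> x = a \<odot>\<^bsub>M\<^esub> h \<oplus>\<^bsub>M\<^esub> a \<odot>\<^bsub>M\<^esub> k" using a by (simp add: smult_r_distr c)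
  then show "a \<odot>\<^bsub>M\<^esub> x \<in> H <+>\<^bsub>M\<^esub> K" unfolding mem_set_add using * a H K submoduleE(4) by blast
qed

lemma set_add_superset:
  assumes H: "submodule H R M" and K: "submodule K R M"
  shows "H \<subseteq> H <+>\<^bsub>M\<^esub> K" "K \<subseteq> H <+>\<^bsub>M\<^esub> K"
  using submodule_carrierD[OF H] submodule_carrierD[OF K] submodule_zero[OF H] submodule_zero[OF K]
  by (auto simp: mem_set_add) (metis M.r_zero, metis M.l_zero)

lemma set_add_least:
  assumes "submodule L R M" "H \<subseteq> L" "K \<subseteq> L"
  shows "H <+>\<^bsub>M\<^esub> K \<subseteq> L"
  using submoduleE(5)[OF assms(1)] assms(2,3) by (fastforce simp: mem_set_add)

lemma submodule_multiples:
  assumes x: "x \<in> carrier M"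
  shows "submodule {a \<odot>\<^bsub>M\<^esub> x | a. a \<in> carrier R} R M"
proof (rule submoduleI')
  show "\<zero>\<^bsub>M\<^esub> \<in> {a \<odot>\<^bsub>M\<^esub> x | a. a \<in> carrier R}"
    using x by (auto intro!: exI[of _ \<zero>])
  fix b y assume b: "b \<in> carrier R" and "y \<in> {a \<odot>\<^bsub>M\<^esub> x | a. a \<in> carrier R}"
  then show "b \<odot>\<^bsub>M\<^esub> y \<in> {a \<odot>\<^bsub>M\<^esub> x | a. a \<in> carrier R}"
    using x by clarsimp (metis R.m_closed smult_assoc1)
next
  fix y z assume "y \<in> {a \<odot>\<^bsub>M\<^esub> x | a. a \<in> carrier R}" "z \<in> {a \<odot>\<^bsub>M\<^esub> x | a. a \<in> carrier R}"
  then show "y \<oplus>\<^bsub>M\<^esub> z \<in> {a \<odot>\<^bsub>M\<^esub> x | a. a \<in> carrier R}"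
    using x by clarsimp (metis R.a_closed smult_l_distr)
qed (use x in auto)

lemma submodule_ideal_smult:
  assumes "I \<subseteq> carrier R"
  shows "submodule (ideal_smult R I M) R M"
  unfolding ideal_smult_def by (rule submodule_span) (use assms in auto)

lemma ideal_smultI: "a \<in> I \<Longrightarrow> x \<in> carrier M \<Longrightarrow> a \<odot>\<^bsub>M\<^esub> x \<in> ideal_smult R I M"
  unfolding ideal_smult_def using span_superset by fastforce

lemma ideal_smult_least:
  assumes "submodule H R M" "\<And>a x. a \<in> I \<Longrightarrow> x \<in> carrier M \<Longrightarrow> a \<odot>\<^bsub>M\<^esub> x \<in> H"
  shows "ideal_smult R I M \<subseteq> H"
  unfolding ideal_smult_def by (rule span_least) (use assms in auto)

lemma ideal_smult_mono: "I \<subseteq> J \<Longrightarrow> ideal_smult R I M \<subseteq> ideal_smult R J M"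
  unfolding ideal_smult_def by (rule span_mono) blast

lemma ideal_smult_carrier: "ideal_smult R (carrier R) M = carrier M"
proof
  show "carrier M \<subseteq> ideal_smult R (carrier R) M"
    using ideal_smultI[of \<one> "carrier R"] by force
qed (use submoduleE(1)[OF submodule_ideal_smult] in blast)

end

section \<open>Homomorphisms and their effect on the m-adic filtration\<close>

locale mod_hom = M: module R M + N: module R N
  for R (structure) and M (structure) and N (structure) +
  fixes f
  assumes hom: "f \<in> module_homs R M N"
begin

lemma hom_closed [simp]: "x \<in> carrier M \<Longrightarrow> f x \<in> carrier N"
  and hom_add [simp]: "x \<in> carrier M \<Longrightarrow> y \<in> carrier M \<Longrightarrow> f (x \<oplus>\<^bsub>M\<^esub> y) = f x \<oplus>\<^bsub>N\<^esub> f y"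
  and hom_smult [simp]: "r \<in> carrier R \<Longrightarrow> x \<in> carrier M \<Longrightarrow> f (r \<odot>\<^bsub>M\<^esub> x) = r \<odot>\<^bsub>N\<^esub> f x"
  using hom by (auto simp: module_homs_def)

lemma hom_zero [simp]: "f \<zero>\<^bsub>M\<^esub> = \<zero>\<^bsub>N\<^esub>"
  using hom_smult[of "\<zero>\<^bsub>R\<^esub>" "\<zero>\<^bsub>M\<^esub>"] by simp

lemma hom_uminus [simp]: "x \<in> carrier M \<Longrightarrow> f (\<ominus>\<^bsub>M\<^esub> x) = \<ominus>\<^bsub>N\<^esub> f x"
  using hom_smult[of "\<ominus>\<^bsub>R\<^esub> \<one>\<^bsub>R\<^esub>" x] by (simp add: M.smult_l_minus N.smult_l_minus)

lemma hom_minus [simp]: "x \<in> carrier M \<Longrightarrow> y \<in> carrier M \<Longrightarrow> f (x \<ominus>\<^bsub>M\<^esub> y) = f x \<ominus>\<^bsub>N\<^esub> f y"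
  by (simp add: a_minus_def)

lemma submodule_preimage:
  assumes "submodule H R N"
  shows "submodule {x \<in> carrier M. f x \<in> H} R M"
  by (rule M.submoduleI') (use assms in \<open>auto simp: N.submodule_zero N.submoduleE\<close>)

lemma submodule_image:
  assumes H: "submodule H R M"
  shows "submodule (f ` H) R N"
proof (rule N.submoduleI')
  note c = M.submodule_carrierD[OF H]
  show "f ` H \<subseteq> carrier N" using c by auto
  show "\<zero>\<^bsub>N\<^esub> \<in> f ` H" using M.submodule_zero[OF H] hom_zero by (metis imageI)
  fix a b assume "a \<in> f ` H" "b \<in> f ` H"
  then show "a \<oplus>\<^bsub>N\<^esub> b \<in> f ` H"
    using M.submoduleE(5)[OF H] c by (auto simp flip: hom_add)
next
  note c = M.submodule_carrierD[OF H]
  fix a x assume "a \<in> carrier R" "x \<in> f ` H"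
  then show "a \<odot>\<^bsub>N\<^esub> x \<in> f ` H"
    using M.submoduleE(4)[OF H] c by (auto simp flip: hom_smult)
qed

lemma submodule_kernel: "submodule {x \<in> carrier M. f x = \<zero>\<^bsub>N\<^esub>} R M"
  by (rule M.submoduleI') auto

lemma hom_ideal_smult:
  assumes "I \<subseteq> carrier R" "x \<in> ideal_smult R I M"
  shows "f x \<in> ideal_smult R I N"
proof -
  have "ideal_smult R I M \<subseteq> {x \<in> carrier M. f x \<in> ideal_smult R I N}"
    by (rule M.ideal_smult_least[OF submodule_preimage[OF N.submodule_ideal_smult[OF assms(1)]]])
      (use assms(1) in \<open>auto simp: subsetD intro: N.ideal_smultI\<close>)
  then show ?thesis using assms(2) by blast
qed

end

lemma mod_hom_compose:
  assumes "mod_hom R M N f" "mod_hom R N P g"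
  shows "mod_hom R M P (\<lambda>x. g (f x))"
proof -
  interpret f: mod_hom R M N f by fact
  interpret g: mod_hom R N P g by fact
  show ?thesis by unfold_locales (auto simp: module_homs_def)
qed

lemma mod_hom_diff:
  assumes "mod_hom R M N f" "mod_hom R M N g"
  shows "mod_hom R M N (\<lambda>x. f x \<ominus>\<^bsub>N\<^esub> g x)"
proof -
  interpret f: mod_hom R M N f by fact
  interpret g: mod_hom R M N g by fact
  show ?thesis
  proof (unfold_locales, unfold module_homs_def, intro CollectI conjI ballI)
    fix x y assume "x \<in> carrier M" "y \<in> carrier M"
    then show "f (x \<oplus>\<^bsub>M\<^esub> y) \<ominus>\<^bsub>N\<^esub> g (x \<oplus>\<^bsub>M\<^esub> y) = f x \<ominus>\<^bsub>N\<^esub> g x \<oplus>\<^bsub>N\<^esub> (f y \<ominus>\<^bsub>N\<^esub> g y)"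
      by (simp add: a_minus_def f.N.M.minus_add f.N.M.a_ac)
  qed (auto simp: a_minus_def f.N.smult_r_distr f.N.smult_r_minus)
qed

lemma mod_hom_id: "module R M \<Longrightarrow> mod_hom R M M (\<lambda>x. x)"
  by (simp add: mod_hom_def mod_hom_axioms_def module_homs_def)

text \<open>For fixed a, the x with a x in \<open>I\<^sup>n\<^sup>+\<^sup>1M\<close> form a
  submodule, so only generators b y of I M need testing, and there a (b y) = (b a) y.\<close>

lemma (in module) ideal_pow_smult:
  assumes I: "ideal I R" and x: "x \<in> ideal_smult R I M" and a: "a \<in> ideal_pow R I n"
  shows "a \<odot>\<^bsub>M\<^esub> x \<in> ideal_smult R (ideal_pow R I (Suc n)) M"
proof -
  let ?J = "ideal_pow R I (Suc n)"
  have sub: "I \<subseteq> carrier R" "ideal_pow R I n \<subseteq> carrier R" "?J \<subseteq> carrier R"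
    using I ideal.Icarr[OF ideal_pow_ideal[OF I]] by (auto dest: ideal.Icarr simp del: ideal_pow.simps)
  have a': "a \<in> carrier R" using a sub by blast
  interpret s: mod_hom R M M "\<lambda>x. a \<odot>\<^bsub>M\<^esub> x"
    by unfold_locales (use a' in \<open>auto simp: module_homs_def smult_r_distr smult_assoc1[symmetric] R.m_comm\<close>)
  have "ideal_smult R I M \<subseteq> {x \<in> carrier M. a \<odot>\<^bsub>M\<^esub> x \<in> ideal_smult R ?J M}"
  proof (rule ideal_smult_least[OF s.submodule_preimage[OF submodule_ideal_smult[OF sub(3)]]])
    fix b y assume b: "b \<in> I" and y: "y \<in> carrier M"
    have "b \<otimes> a \<in> ?J" using a b by (auto intro: ideal_prod.prod)
    then have "(b \<otimes> a) \<odot>\<^bsub>M\<^esub> y \<in> ideal_smult R ?J M" using y by (rule ideal_smultI)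
    moreover have "(b \<otimes> a) \<odot>\<^bsub>M\<^esub> y = a \<odot>\<^bsub>M\<^esub> (b \<odot>\<^bsub>M\<^esub> y)"
      using a' b sub y by (simp add: R.m_comm[of b a] smult_assoc1 subsetD)
    ultimately show "b \<odot>\<^bsub>M\<^esub> y \<in> {x \<in> carrier M. a \<odot>\<^bsub>M\<^esub> x \<in> ideal_smult R ?J M}"
      using b y sub by auto
  qed
  then show ?thesis using x by blast
qed

text \<open>This is how minimality enters: a differential with image in I N raises the filtration
  degree by one. As preimages of submodules are submodules, it is enough to look at the products a y
  that generate \<open>I\<^sup>nM\<close>.\<close>

lemma (in mod_hom) hom_ideal_pow:
  assumes I: "ideal I R" and f: "f ` carrier M \<subseteq> ideal_smult R I N"
    and x: "x \<in> ideal_smult R (ideal_pow R I n) M"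
  shows "f x \<in> ideal_smult R (ideal_pow R I (Suc n)) N"
proof -
  have sub: "ideal_pow R I k \<subseteq> carrier R" for k
    using M.ideal_pow_ideal[OF I] by (auto dest: ideal.Icarr)
  have "ideal_smult R (ideal_pow R I n) M \<subseteq>
        {x \<in> carrier M. f x \<in> ideal_smult R (ideal_pow R I (Suc n)) N}"
    by (rule M.ideal_smult_least[OF submodule_preimage[OF N.submodule_ideal_smult[OF sub]]])
      (use sub[of n] f in \<open>auto simp: subsetD simp del: ideal_pow.simps intro!: N.ideal_pow_smult[OF I]\<close>)
  then show ?thesis using x by blast
qed

section \<open>Free modules\<close>

lemma (in abelian_group) minus_eq_zero_iff:
  assumes "x \<in> carrier G" "y \<in> carrier G"
  shows "x \<ominus> y = \<zero> \<longleftrightarrow> x = y"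
  using assms minus_equality[of x "\<ominus> y"] by (auto simp: a_minus_def r_neg)

lemma free_module_simps [simp]:
  "carrier (free_module R B) =
     {c. (\<forall>b. c b \<in> carrier R) \<and> (\<forall>b. b \<notin> B \<longrightarrow> c b = \<zero>\<^bsub>R\<^esub>) \<and> finite {b. c b \<noteq> \<zero>\<^bsub>R\<^esub>}}"
  "\<zero>\<^bsub>free_module R B\<^esub> = (\<lambda>_. \<zero>\<^bsub>R\<^esub>)"
  "c \<oplus>\<^bsub>free_module R B\<^esub> c' = (\<lambda>b. c b \<oplus>\<^bsub>R\<^esub> c' b)"
  "r \<odot>\<^bsub>free_module R B\<^esub> c = (\<lambda>b. r \<otimes>\<^bsub>R\<^esub> c b)"
  by (simp_all add: free_module_def)

lemma self_module_simps [simp]: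
  "carrier (self_module R) = carrier R" "\<zero>\<^bsub>self_module R\<^esub> = \<zero>\<^bsub>R\<^esub>"
  "x \<oplus>\<^bsub>self_module R\<^esub> y = x \<oplus>\<^bsub>R\<^esub> y" "x \<odot>\<^bsub>self_module R\<^esub> y = x \<otimes>\<^bsub>R\<^esub> y"
  by (simp_all add: self_module_def)

lemma free_gen_apply: "free_gen R w b = (if b = w then \<one>\<^bsub>R\<^esub> else \<zero>\<^bsub>R\<^esub>)"
  by (simp add: free_gen_def)

context cring
begin

lemma module_self: "module R (self_module R)"
proof (rule moduleI)
  show "abelian_group (self_module R)"
    by (rule abelian_groupI) (auto intro: a_assoc a_comm exI[of _ "\<ominus> _"] simp: l_neg bexI[of _ "\<ominus> _"])
qed (auto simp: l_distr r_distr m_assoc cring_axioms)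

lemma module_free: "module R (free_module R B)"
proof (rule moduleI)
  have fin: "finite {b. c b \<oplus> c' b \<noteq> \<zero>}"
    if "finite {b. c b \<noteq> \<zero>}" "finite {b. c' b \<noteq> \<zero>}" for c c' :: "'c \<Rightarrow> 'a"
    by (rule finite_subset[OF _ finite_UnI[OF that]]) auto
  show "abelian_group (free_module R B)"
  proof (rule abelian_groupI)
    fix c assume c: "c \<in> carrier (free_module R B)"
    have "{b. \<ominus> c b \<noteq> \<zero>} \<subseteq> {b. c b \<noteq> \<zero>}" by auto
    with c show "\<exists>y\<in>carrier (free_module R B). y \<oplus>\<^bsub>free_module R B\<^esub> c = \<zero>\<^bsub>free_module R B\<^esub>"
      by (intro bexI[of _ "\<lambda>b. \<ominus> c b"]) (auto simp: l_neg dest: finite_subset)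
  qed (auto simp: fin a_ac)
  have "finite {b. r \<otimes> c b \<noteq> \<zero>}" if "r \<in> carrier R" "finite {b. c b \<noteq> \<zero>}" for r and c :: "'c \<Rightarrow> 'a"
    by (rule finite_subset[OF _ that(2)]) (use that(1) in auto)
  then show "a \<odot>\<^bsub>free_module R B\<^esub> x \<in> carrier (free_module R B)"
    if "a \<in> carrier R" "x \<in> carrier (free_module R B)" for a x
    using that by auto
qed (auto simp: l_distr r_distr m_assoc cring_axioms)

lemma free_gen_closed: "b \<in> B \<Longrightarrow> free_gen R b \<in> carrier (free_module R B)"
  by (auto simp: free_gen_def intro: finite_subset[of _ "{b}"])

text \<open>Induction over a finite set containing the support: setting the coordinate
  \<open>s\<close> to zero changes \<open>c\<close> by a multiple of the generator at
  \<open>s\<close>. Later statements about free modules are proved by exhibiting a submodule that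
  contains the generators, without computing with \<open>lin_ext\<close>.\<close>

lemma free_module_generated:
  assumes H: "submodule H R (free_module R B)" and gen: "\<And>b. b \<in> B \<Longrightarrow> free_gen R b \<in> H"
    and c: "c \<in> carrier (free_module R B)"
  shows "c \<in> H"
proof -
  interpret L: module R "free_module R B" by (rule module_free)
  have "c \<in> carrier (free_module R B) \<Longrightarrow> {b. c b \<noteq> \<zero>} \<subseteq> S \<Longrightarrow> c \<in> H" if "finite S" "S \<subseteq> B" for S c
    using that
  proof (induction S arbitrary: c)
    case empty
    then have "c = \<zero>\<^bsub>free_module R B\<^esub>" by auto
    then show ?case using L.submodule_zero[OF H] by simp
  next
    case (insert s S)
    define c' where "c' = c(s := \<zero>)"
    have "finite {b. c' b \<noteq> \<zero>}" by (rule finite_subset[OF _ insert.hyps(1)]) (use insert.prems in \<open>auto simp: c'_def\<close>)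
    then have c': "c' \<in> H" using insert.prems by (intro insert.IH) (auto simp: c'_def)
    have cs: "c s \<in> carrier R" using insert.prems by auto
    have "c = c' \<oplus>\<^bsub>free_module R B\<^esub> c s \<odot>\<^bsub>free_module R B\<^esub> free_gen R s"
      using insert.prems by (auto simp: c'_def free_gen_def)
    moreover have "c s \<odot>\<^bsub>free_module R B\<^esub> free_gen R s \<in> H"
      using insert.prems by (intro L.submoduleE(4)[OF H] cs gen) auto
    ultimately show ?case using L.submoduleE(5)[OF H c'] by metis
  qed
  from this[of "{b. c b \<noteq> \<zero>}" c] show ?thesis using c by auto
qed

text \<open>The kernel of the difference of the two maps is a submodule containing all
  generators.\<close>

lemma free_module_hom_eqI:
  assumes f: "mod_hom R (free_module R B) N f" and g: "mod_hom R (free_module R B) N g"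
    and eq: "\<And>b. b \<in> B \<Longrightarrow> f (free_gen R b) = g (free_gen R b)"
    and c: "c \<in> carrier (free_module R B)"
  shows "f c = g c"
proof -
  interpret d: mod_hom R "free_module R B" N "\<lambda>x. f x \<ominus>\<^bsub>N\<^esub> g x"
    by (rule mod_hom_diff[OF f g])
  interpret f: mod_hom R "free_module R B" N f by fact
  interpret g: mod_hom R "free_module R B" N g by fact
  have "c \<in> {x \<in> carrier (free_module R B). f x \<ominus>\<^bsub>N\<^esub> g x = \<zero>\<^bsub>N\<^esub>}"
  proof (rule free_module_generated[OF d.submodule_kernel _ c])
    fix b assume b: "b \<in> B"
    note b' = free_gen_closed[OF b]
    show "free_gen R b \<in> {x \<in> carrier (free_module R B). f x \<ominus>\<^bsub>N\<^esub> g x = \<zero>\<^bsub>N\<^esub>}"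
      using b' g.hom_closed[OF b'] by (simp add: eq[OF b] a_minus_def d.N.M.r_neg)
  qed
  then show ?thesis
    using f.hom_closed[OF c] g.hom_closed[OF c] by (simp add: d.N.M.minus_eq_zero_iff)
qed

end

context module
begin

lemma lin_ext_finsum:
  assumes S: "finite S" "S \<subseteq> B" "{b. c b \<noteq> \<zero>} \<subseteq> S" and g: "g \<in> B \<rightarrow> carrier M"
    and c: "c \<in> carrier (free_module R B)"
  shows "lin_ext R M g c = (\<Oplus>\<^bsub>M\<^esub>b\<in>S. c b \<odot>\<^bsub>M\<^esub> g b)"
  unfolding lin_ext_def
proof (rule M.add.finprod_mono_neutral_cong_left)
  show "(\<lambda>b. c b \<odot>\<^bsub>M\<^esub> g b) \<in> S \<rightarrow> carrier M"
    using S(2) g c by (auto simp: Pi_iff subset_iff)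
  show "c b \<odot>\<^bsub>M\<^esub> g b = \<zero>\<^bsub>M\<^esub>" if "b \<in> S - {b. c b \<noteq> \<zero>}" for b
    using that S g by (auto simp: Pi_iff subset_iff)
qed (use S in auto)

lemma lin_ext_mem:
  assumes H: "submodule H R M" and g: "g \<in> B \<rightarrow> H" and c: "c \<in> carrier (free_module R B)"
  shows "lin_ext R M g c \<in> H"
  unfolding lin_ext_def
  by (rule submodule_finsum[OF H]) (use g c in \<open>auto intro!: submoduleE(4)[OF H]\<close>)

lemma lin_ext_hom:
  assumes g: "g \<in> B \<rightarrow> carrier M"
  shows "mod_hom R (free_module R B) M (lin_ext R M g)"
proof -
  interpret L: module R "free_module R B" by (rule module_free)
  show ?thesis
  proof (unfold_locales, unfold module_homs_def, intro CollectI conjI ballI)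
    show "lin_ext R M g \<in> carrier (free_module R B) \<rightarrow> carrier M"
      using lin_ext_mem[OF carrier_is_submodule g] by blast
    fix c d assume c: "c \<in> carrier (free_module R B)" and d: "d \<in> carrier (free_module R B)"
    let ?S = "{b. c b \<noteq> \<zero>} \<union> {b. d b \<noteq> \<zero>}"
    have S: "finite ?S" "?S \<subseteq> B" using c d by auto
    have e: "c \<oplus>\<^bsub>free_module R B\<^esub> d \<in> carrier (free_module R B)" using c d by (rule L.M.a_closed)
    have "lin_ext R M g (c \<oplus>\<^bsub>free_module R B\<^esub> d) = (\<Oplus>\<^bsub>M\<^esub>b\<in>?S. (c \<oplus>\<^bsub>free_module R B\<^esub> d) b \<odot>\<^bsub>M\<^esub> g b)"
      by (rule lin_ext_finsum[OF S _ g e]) auto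
    also have "\<dots> = (\<Oplus>\<^bsub>M\<^esub>b\<in>?S. c b \<odot>\<^bsub>M\<^esub> g b \<oplus>\<^bsub>M\<^esub> d b \<odot>\<^bsub>M\<^esub> g b)"
      by (rule M.finsum_cong') (use c d g S in \<open>auto simp: smult_l_distr Pi_iff subset_iff\<close>)
    also have "\<dots> = (\<Oplus>\<^bsub>M\<^esub>b\<in>?S. c b \<odot>\<^bsub>M\<^esub> g b) \<oplus>\<^bsub>M\<^esub> (\<Oplus>\<^bsub>M\<^esub>b\<in>?S. d b \<odot>\<^bsub>M\<^esub> g b)"
      by (rule M.finsum_addf) (use c d g S in \<open>auto simp: Pi_iff subset_iff\<close>)
    also have "\<dots> = lin_ext R M g c \<oplus>\<^bsub>M\<^esub> lin_ext R M g d"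
      using lin_ext_finsum[OF S _ g c] lin_ext_finsum[OF S _ g d] by simp
    finally show "lin_ext R M g (c \<oplus>\<^bsub>free_module R B\<^esub> d) = lin_ext R M g c \<oplus>\<^bsub>M\<^esub> lin_ext R M g d" .
  next
    fix r c assume r: "r \<in> carrier R" and c: "c \<in> carrier (free_module R B)"
    let ?S = "{b. c b \<noteq> \<zero>}"
    have S: "finite ?S" "?S \<subseteq> B" using c by auto
    have e: "r \<odot>\<^bsub>free_module R B\<^esub> c \<in> carrier (free_module R B)" using r c by (rule L.smult_closed)
    have "lin_ext R M g (r \<odot>\<^bsub>free_module R B\<^esub> c) = (\<Oplus>\<^bsub>M\<^esub>b\<in>?S. (r \<odot>\<^bsub>free_module R B\<^esub> c) b \<odot>\<^bsub>M\<^esub> g b)"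
      by (rule lin_ext_finsum[OF S _ g e]) (use r in auto)
    also have "\<dots> = (\<Oplus>\<^bsub>M\<^esub>b\<in>?S. r \<odot>\<^bsub>M\<^esub> (c b \<odot>\<^bsub>M\<^esub> g b))"
      by (rule M.finsum_cong') (use r c g S in \<open>auto simp: smult_assoc1 Pi_iff subset_iff\<close>)
    also have "\<dots> = r \<odot>\<^bsub>M\<^esub> (\<Oplus>\<^bsub>M\<^esub>b\<in>?S. c b \<odot>\<^bsub>M\<^esub> g b)"
      by (rule finsum_smult_ldistr[symmetric]) (use r c g S in \<open>auto simp: Pi_iff subset_iff\<close>)
    finally show "lin_ext R M g (r \<odot>\<^bsub>free_module R B\<^esub> c) = r \<odot>\<^bsub>M\<^esub> lin_ext R M g c"
      by (simp add: lin_ext_def)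
  qed
qed

lemma lin_ext_gen:
  assumes g: "g \<in> B \<rightarrow> carrier M" and b: "b \<in> B"
  shows "lin_ext R M g (free_gen R b) = g b"
proof -
  have "lin_ext R M g (free_gen R b) = (\<Oplus>\<^bsub>M\<^esub>w\<in>{b}. free_gen R b w \<odot>\<^bsub>M\<^esub> g w)"
    by (rule lin_ext_finsum[OF _ _ _ g free_gen_closed[OF b]]) (use b in \<open>auto simp: free_gen_def\<close>)
  also have "\<dots> = g b"
    using M.finsum_insert[of "{}" b "\<lambda>w. free_gen R b w \<odot>\<^bsub>M\<^esub> g w"] g b
    by (auto simp: free_gen_apply Pi_iff)
  finally show ?thesis .
qed

end

lemma (in mod_hom) inv_hom:
  assumes "bij_betw f (carrier M) (carrier N)"
  shows "mod_hom R N M (inv_into (carrier M) f)"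
proof -
  have inj: "inj_on f (carrier M)" and im: "f ` carrier M = carrier N"
    using assms by (auto simp: bij_betw_def)
  let ?h = "inv_into (carrier M) f"
  have c: "?h x \<in> carrier M" "f (?h x) = x" if "x \<in> carrier N" for x
    using that inv_into_into[of x f "carrier M"] f_inv_into_f[of x f "carrier M"] unfolding im by auto
  have e: "?h y = x" if "x \<in> carrier M" "f x = y" for x y
    using that inv_into_f_f[OF inj] by auto
  show ?thesis
    by unfold_locales (auto simp: module_homs_def c intro!: e)
qed

lemma (in mod_hom) injI:
  assumes "\<And>x. x \<in> carrier M \<Longrightarrow> f x = \<zero>\<^bsub>N\<^esub> \<Longrightarrow> x = \<zero>\<^bsub>M\<^esub>"
  shows "inj_on f (carrier M)"
proof (rule inj_onI)
  fix x y assume *: "x \<in> carrier M" "y \<in> carrier M" "f x = f y"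
  then have "f (x \<ominus>\<^bsub>M\<^esub> y) = \<zero>\<^bsub>N\<^esub>" by (simp add: a_minus_def N.M.r_neg)
  then have "x \<ominus>\<^bsub>M\<^esub> y = \<zero>\<^bsub>M\<^esub>" using * assms by blast
  then show "x = y" using * by (simp add: M.M.minus_eq_zero_iff)
qed

text \<open>\<open>is_free_module\<close> wants a basis inside the carrier, so the index set is
  replaced by the coordinate vectors \<open>free_gen R b\<close>;
  \<open>\<one> \<noteq> \<zero>\<close> keeps vectors of different indices apart.\<close>

lemma (in cring) is_free_free_module:
  assumes "\<one> \<noteq> \<zero>"
  shows "is_free_module R (free_module R (B :: 'x set))"
  unfolding is_free_module_def
proof (intro conjI exI)
  let ?L = "free_module R B" and ?B = "free_gen R ` B"
  interpret L: module R ?L by (rule module_free)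
  show "module R ?L" by (rule module_free)
  show sub: "?B \<subseteq> carrier ?L" by (rule image_subsetI) (rule free_gen_closed)
  let ?f = "lin_ext R ?L (\<lambda>b. b)"
  have inj: "free_gen R v = (free_gen R w :: 'x \<Rightarrow> 'a) \<longleftrightarrow> v = w" for v w
    using assms free_gen_apply[of R v v] free_gen_apply[of R w v] by metis
  interpret f: mod_hom R "free_module R ?B" ?L ?f
    by (rule L.lin_ext_hom) (use sub in auto)
  have gen: "?f (free_gen R w) = w" if "w \<in> ?B" for w
    by (rule L.lin_ext_gen[OF _ that]) (use sub in auto)
  \<comment> \<open>Evaluation at an index is linear, so both sides are homomorphisms in
    \<open>c\<close> and need comparing on generators only. Injectivity of \<open>?f\<close> can
    then be read off coordinatewise.\<close>
  have ev: "?f c b = c (free_gen R b)" if c: "c \<in> carrier (free_module R ?B)" for c b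
  proof -
    interpret S: module R "self_module R" by (rule module_self)
    interpret ev: mod_hom R ?L "self_module R" "\<lambda>x. x b"
      by unfold_locales (auto simp: module_homs_def)
    interpret ev': mod_hom R "free_module R ?B" "self_module R" "\<lambda>x. x (free_gen R b)"
      by unfold_locales (auto simp: module_homs_def)
    have "mod_hom R (free_module R ?B) (self_module R) (\<lambda>x. ?f x b)"
      by (rule mod_hom_compose[OF f.mod_hom_axioms ev.mod_hom_axioms])
    then show ?thesis
    proof (rule free_module_hom_eqI[OF _ ev'.mod_hom_axioms _ c])
      fix w assume w: "w \<in> ?B"
      then obtain v where v: "v \<in> B" "w = free_gen R v" by blast
      show "?f (free_gen R w) b = free_gen R w (free_gen R b)"
        unfolding gen[OF w] unfolding v(2) free_gen_apply inj by simp
    qed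
  qed
  show "bij_betw ?f (carrier (free_module R ?B)) (carrier ?L)"
    unfolding bij_betw_def
  proof
    show "inj_on ?f (carrier (free_module R ?B))"
    proof (rule f.injI)
      fix c assume c: "c \<in> carrier (free_module R ?B)" and 0: "?f c = \<zero>\<^bsub>?L\<^esub>"
      have "c w = \<zero>" for w
      proof (cases "w \<in> ?B")
        case True
        then obtain b where "w = free_gen R b" by blast
        then show ?thesis using ev[OF c, of b] 0 by simp
      qed (use c in auto)
      then show "c = \<zero>\<^bsub>free_module R ?B\<^esub>" by auto
    qed
    show "?f ` carrier (free_module R ?B) = carrier ?L"
    proof
      show "carrier ?L \<subseteq> ?f ` carrier (free_module R ?B)"
      proof
        fix x assume "x \<in> carrier ?L"
        then show "x \<in> ?f ` carrier (free_module R ?B)"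
        proof (rule free_module_generated[OF f.submodule_image[OF f.M.carrier_is_submodule], rotated])
          fix b assume "b \<in> B"
          then have "free_gen R b \<in> ?B" by blast
          then show "free_gen R b \<in> ?f ` carrier (free_module R ?B)"
            using gen[of "free_gen R b"] free_gen_closed[of "free_gen R b" ?B] by (metis imageI)
        qed
      qed
    qed (use f.hom_closed in blast)
  qed
qed

text \<open>Free modules are projective: preimages under \<open>g\<close> are chosen for the basis
  and extended linearly from the coordinate module, and the inverse of the coordinate bijection
  carries the result to \<open>P\<close>. Chain maps and homotopies are all obtained from this
  lemma.\<close>

lemma free_module_lift:
  assumes P: "is_free_module R P" and f: "mod_hom R P N f" and g: "mod_hom R Q N g"
    and fg: "f ` carrier P \<subseteq> g ` carrier Q"
  shows "\<exists>h. mod_hom R P Q h \<and> (\<forall>x\<in>carrier P. g (h x) = f x)"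
proof -
  interpret f: mod_hom R P N f by fact
  interpret g: mod_hom R Q N g by fact
  obtain B where B: "B \<subseteq> carrier P"
      "bij_betw (lin_ext R P (\<lambda>b. b)) (carrier (free_module R B)) (carrier P)"
    using P unfolding is_free_module_def by blast
  let ?L = "free_module R B" and ?\<phi> = "lin_ext R P (\<lambda>b. b)"
  have "\<forall>b\<in>B. \<exists>y\<in>carrier Q. g y = f b" using B fg by (metis (no_types, lifting) image_iff subset_iff)
  then obtain q where q: "\<And>b. b \<in> B \<Longrightarrow> q b \<in> carrier Q \<and> g (q b) = f b" by metis
  interpret \<phi>: mod_hom R ?L P ?\<phi> by (rule f.M.lin_ext_hom) (use B in auto)
  interpret \<psi>: mod_hom R ?L Q "lin_ext R Q q" by (rule g.M.lin_ext_hom) (use q in auto)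
  let ?i = "inv_into (carrier ?L) ?\<phi>"
  interpret i: mod_hom R P ?L ?i by (rule \<phi>.inv_hom[OF B(2)])
  have "g (lin_ext R Q q c) = f (?\<phi> c)" if "c \<in> carrier ?L" for c
  proof (rule f.M.free_module_hom_eqI[OF _ _ _ that])
    show "mod_hom R ?L N (\<lambda>c. g (lin_ext R Q q c))" "mod_hom R ?L N (\<lambda>c. f (?\<phi> c))"
      using mod_hom_compose \<phi>.mod_hom_axioms \<psi>.mod_hom_axioms f g by blast+
    show "g (lin_ext R Q q (free_gen R b)) = f (?\<phi> (free_gen R b))" if b: "b \<in> B" for b
    proof -
      have "lin_ext R P (\<lambda>b. b) (free_gen R b) = b" by (rule f.M.lin_ext_gen[OF _ b]) (use B in auto)
      moreover have "lin_ext R Q q (free_gen R b) = q b" by (rule g.M.lin_ext_gen[OF _ b]) (use q in auto)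
      ultimately show ?thesis using q[OF b] by simp
    qed
  qed
  then have "g (lin_ext R Q q (?i x)) = f x" if "x \<in> carrier P" for x
    using i.hom_closed[OF that] f_inv_into_f[of x ?\<phi> "carrier ?L"] B(2) that
    by (simp add: bij_betw_def)
  then show ?thesis
    using mod_hom_compose[OF i.mod_hom_axioms \<psi>.mod_hom_axioms] by blast
qed

section \<open>Noetherian modules over a local ring\<close>

context cring
begin

text \<open>Serves to read results on submodules as results on ideals and back. The two records
  share carrier, addition and zero, hence also negation, since \<open>m_inv\<close> is computed from
  these fields alone.\<close>

lemma submodule_self_iff_ideal: "submodule I R (self_module R) \<longleftrightarrow> ideal I R"
proof -
  have "m_inv (add_monoid (self_module R)) = m_inv (add_monoid R)"
    by (simp add: m_inv_def fun_eq_iff)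
  then have *: "subgroup I (add_monoid (self_module R)) \<longleftrightarrow> subgroup I (add_monoid R)"
    by (simp add: subgroup_def)
  show ?thesis
  proof
    assume I: "submodule I R (self_module R)"
    interpret S: module R "self_module R" by (rule module_self)
    show "ideal I R"
    proof (rule idealI[OF ring_axioms])
      show "subgroup I (add_monoid R)" using submodule.axioms(1)[OF I] * by blast
      fix a x assume "a \<in> I" "x \<in> carrier R"
      then show "x \<otimes> a \<in> I" "a \<otimes> x \<in> I"
        using S.submoduleE(4)[OF I, of x a] S.submodule_carrierD[OF I, of a] by (auto simp: m_comm)
    qed
  next
    assume I: "ideal I R"
    show "submodule I R (self_module R)"
      using * ideal.axioms(1)[OF I] ideal.I_l_closed[OF I]
      by (auto simp: submodule_def submodule_axioms_def additive_subgroup_def)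
  qed
qed

lemma fin_gen_self: "fin_gen_module R (self_module R)"
proof -
  interpret S: module R "self_module R" by (rule module_self)
  have "module_span R (self_module R) {\<one>} = carrier R"
  proof
    have sub: "submodule (module_span R (self_module R) {\<one>}) R (self_module R)"
      by (rule S.submodule_span) simp
    show "module_span R (self_module R) {\<one>} \<subseteq> carrier R" using S.submoduleE(1)[OF sub] by simp
    have "\<one> \<in> module_span R (self_module R) {\<one>}" using S.span_superset by blast
    then show "carrier R \<subseteq> module_span R (self_module R) {\<one>}"
      using S.submoduleE(4)[OF sub, of _ \<one>] by auto
  qed
  then show ?thesis unfolding fin_gen_module_def using module_self by (auto intro!: exI[of _ "{\<one>}"])
qed

end

context module
begin

lemma mult_hom: "x \<in> carrier M \<Longrightarrow> mod_hom R (self_module R) M (\<lambda>r. r \<odot>\<^bsub>M\<^esub> x)"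
  by (intro mod_hom.intro module_self module_axioms mod_hom_axioms.intro)
    (auto simp: module_homs_def smult_l_distr smult_assoc1)

lemma smult_hom: "r \<in> carrier R \<Longrightarrow> mod_hom R M M (\<lambda>x. r \<odot>\<^bsub>M\<^esub> x)"
  by (intro mod_hom.intro module_axioms mod_hom_axioms.intro)
    (auto simp: module_homs_def smult_r_distr smult_assoc1[symmetric] R.m_comm)

lemma ideal_colon:
  assumes W: "submodule W R M" and x: "x \<in> carrier M"
  shows "ideal {r \<in> carrier R. r \<odot>\<^bsub>M\<^esub> x \<in> W} R"
proof -
  interpret h: mod_hom R "self_module R" M "\<lambda>r. r \<odot>\<^bsub>M\<^esub> x" by (rule mult_hom[OF x])
  show ?thesis using h.submodule_preimage[OF W] by (simp add: submodule_self_iff_ideal)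
qed

lemma submodule_inter: "submodule H R M \<Longrightarrow> submodule K R M \<Longrightarrow> submodule (H \<inter> K) R M"
  using submodule_Inter[of "{H, K}"] by auto

lemma submodule_zero_module: "submodule {\<zero>\<^bsub>M\<^esub>} R M"
  by (rule submoduleI') auto

text \<open>Induction on the generators. The coefficients with which the new generator
  \<open>a\<close> occurs in elements of \<open>H\<close>, modulo the span of the others, form an
  ideal. Elements of \<open>H\<close> realising finitely many generators of that ideal, together
  with generators of \<open>H\<close> intersected with the old span, generate
  \<open>H\<close>.\<close>

lemma submodule_of_span_fin_gen:
  assumes R: "noetherian_ring R" and A: "finite A" "A \<subseteq> carrier M"
    and H: "submodule H R M" "H \<subseteq> module_span R M A"
  shows "\<exists>C. finite C \<and> C \<subseteq> H \<and> module_span R M C = H"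
  using A H
proof (induction A arbitrary: H)
  case empty
  have "module_span R M {} \<subseteq> {\<zero>\<^bsub>M\<^esub>}" by (rule span_least[OF submodule_zero_module]) simp
  then have "module_span R M {} = H"
    using empty.prems submodule_zero[OF empty.prems(2)] submodule_zero[OF submodule_span[of "{}"]] by blast
  then show ?case by blast
next
  case (insert a A)
  let ?S = "module_span R M A"
  have a: "a \<in> carrier M" and S: "submodule ?S R M"
    using insert.prems(1) submodule_span[of A] by auto
  note H = insert.prems(2)
  note cS = submodule_carrierD[OF S] and cH = submodule_carrierD[OF H]
  let ?J = "\<lambda>W. {r \<in> carrier R. r \<odot>\<^bsub>M\<^esub> a \<in> ?S <+>\<^bsub>M\<^esub> W}"
  have J: "ideal (?J W) R" if "submodule W R M" for W
    using ideal_colon[OF submodule_set_add[OF S that] a] .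
  obtain E where E: "E \<subseteq> carrier R" "finite E" "?J H = Idl E"
    using noetherian_ring.finetely_gen[OF R J[OF H]] by blast
  have "E \<subseteq> ?J H" using genideal_self[OF E(1)] E(3) by simp
  then have "\<forall>e\<in>E. \<exists>h\<in>H. \<exists>s\<in>?S. e \<odot>\<^bsub>M\<^esub> a = s \<oplus>\<^bsub>M\<^esub> h"
    unfolding mem_set_add by blast
  then obtain h where h: "\<And>e. e \<in> E \<Longrightarrow> h e \<in> H \<and> (\<exists>s\<in>?S. e \<odot>\<^bsub>M\<^esub> a = s \<oplus>\<^bsub>M\<^esub> h e)" by metis
  have "\<exists>C. finite C \<and> C \<subseteq> H \<inter> ?S \<and> module_span R M C = H \<inter> ?S"
    by (rule insert.IH[OF _ submodule_inter[OF H S]]) (use insert.prems(1) in auto)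
  then obtain C where C: "finite C" "C \<subseteq> H \<inter> ?S" "module_span R M C = H \<inter> ?S" by blast
  let ?G = "h ` E \<union> C"
  have GH: "?G \<subseteq> H" using h C by auto
  then have G: "submodule (module_span R M ?G) R M" using cH by (intro submodule_span) blast
  have "?J H \<subseteq> ?J (module_span R M ?G)"
    unfolding E(3)
  proof (rule genideal_minimal[OF J[OF G]], rule subsetI)
    fix e assume e: "e \<in> E"
    then have "h e \<in> module_span R M ?G" using span_superset[of ?G] by blast
    then show "e \<in> ?J (module_span R M ?G)" using h[OF e] e E(1) by (auto simp: mem_set_add)
  qed
  moreover have "H \<subseteq> module_span R M ?G" if J': "?J H \<subseteq> ?J (module_span R M ?G)"
  proof
    fix x assume x: "x \<in> H"
    have "module_span R M (insert a A) \<subseteq> {r \<odot>\<^bsub>M\<^esub> a | r. r \<in> carrier R} <+>\<^bsub>M\<^esub> ?S"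
    proof (rule span_least)
      note sub = submodule_multiples[OF a] S
      show "submodule ({r \<odot>\<^bsub>M\<^esub> a | r. r \<in> carrier R} <+>\<^bsub>M\<^esub> ?S) R M"
        by (rule submodule_set_add[OF sub])
      have "a \<in> {r \<odot>\<^bsub>M\<^esub> a | r. r \<in> carrier R}" using a by (auto intro!: exI[of _ \<one>])
      then show "insert a A \<subseteq> {r \<odot>\<^bsub>M\<^esub> a | r. r \<in> carrier R} <+>\<^bsub>M\<^esub> ?S"
        using set_add_superset[OF sub] span_superset[of A] by blast
    qed
    then obtain r s where rs: "r \<in> carrier R" "s \<in> ?S" "x = r \<odot>\<^bsub>M\<^esub> a \<oplus>\<^bsub>M\<^esub> s"
      using x insert.prems(3) unfolding subset_iff mem_set_add by blast
    have "r \<odot>\<^bsub>M\<^esub> a = (\<ominus>\<^bsub>M\<^esub> s) \<oplus>\<^bsub>M\<^esub> x"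
      using rs a cS by (simp add: M.a_ac M.r_neg1 M.r_neg2)
    then have "r \<in> ?J H" using rs x submoduleE(3)[OF S] by (auto simp: mem_set_add)
    then have "r \<odot>\<^bsub>M\<^esub> a \<in> ?S <+>\<^bsub>M\<^esub> module_span R M ?G" using J' by blast
    then obtain s' k where k: "s' \<in> ?S" "k \<in> module_span R M ?G" "r \<odot>\<^bsub>M\<^esub> a = s' \<oplus>\<^bsub>M\<^esub> k"
      unfolding mem_set_add by blast
    \<comment> \<open>Subtracting \<open>k\<close> from \<open>x\<close> removes the multiple of
      \<open>a\<close>; the rest lies both in \<open>H\<close> and in \<open>?S\<close>, where
      \<open>C\<close> generates.\<close>
    have kH: "k \<in> H" using k(2) span_least[OF H GH] by blast
    have x': "x = k \<oplus>\<^bsub>M\<^esub> (s' \<oplus>\<^bsub>M\<^esub> s)" unfolding rs(3) k(3) using k(1) kH cS cH rs by (simp add: M.a_ac)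
    have s: "s' \<oplus>\<^bsub>M\<^esub> s \<in> ?S" using k rs submoduleE(5)[OF S] by blast
    have "s' \<oplus>\<^bsub>M\<^esub> s = x \<ominus>\<^bsub>M\<^esub> k"
      unfolding x' using cH[OF kH] cS[OF s] by (simp add: a_minus_def M.a_ac M.r_neg1 M.r_neg2)
    then have "s' \<oplus>\<^bsub>M\<^esub> s \<in> H" using submodule_minus[OF H x kH] by simp
    then have "s' \<oplus>\<^bsub>M\<^esub> s \<in> module_span R M C" using C(3) s by blast
    then have "s' \<oplus>\<^bsub>M\<^esub> s \<in> module_span R M ?G" using span_mono[of C ?G] by blast
    then show "x \<in> module_span R M ?G" using x' k(2) submoduleE(5)[OF G] by blast
  qed
  ultimately show ?case
    using span_least[OF H GH] GH C(1) E(2)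
    by (intro exI[of _ ?G]) blast
qed

lemma submodule_fin_gen:
  assumes "noetherian_ring R" "fin_gen_module R M" "submodule H R M"
  shows "\<exists>C. finite C \<and> C \<subseteq> H \<and> module_span R M C = H"
proof -
  obtain A where "finite A" "A \<subseteq> carrier M" "module_span R M A = carrier M"
    using assms(2) unfolding fin_gen_module_def by blast
  then show ?thesis using submodule_of_span_fin_gen[OF assms(1) _ _ assms(3), of A] submoduleE(1)[OF assms(3)] by blast
qed

text \<open>Zorn's lemma applies because chains stabilise: the union of a chain is a submodule, so
  it is finitely generated, and one member of the chain already contains the finitely many
  generators.\<close>

lemma maximal_submodule_exists:
  assumes R: "noetherian_ring R" and M: "fin_gen_module R M"
    and X: "X \<noteq> {}" "\<And>H. H \<in> X \<Longrightarrow> submodule H R M"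
  shows "\<exists>H\<in>X. \<forall>K\<in>X. H \<subseteq> K \<longrightarrow> K = H"
proof (rule subset_Zorn_nonempty[OF X(1)])
  fix C assume ne: "C \<noteq> {}" and ch: "subset.chain X C"
  then have CX: "C \<subseteq> X" and lin: "\<And>H K. H \<in> C \<Longrightarrow> K \<in> C \<Longrightarrow> H \<subseteq> K \<or> K \<subseteq> H"
    by (auto simp: subset_chain_def)
  have U: "submodule (\<Union>C) R M"
  proof (rule submoduleI')
    fix a b assume "a \<in> \<Union>C" "b \<in> \<Union>C"
    then obtain H K where *: "H \<in> C" "K \<in> C" "a \<in> H" "b \<in> K" by blast
    then obtain L where "L \<in> C" "a \<in> L" "b \<in> L" using lin[of H K] by blast
    then show "a \<oplus>\<^bsub>M\<^esub> b \<in> \<Union>C" using submoduleE(5)[OF X(2), of L a b] CX by blast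
  next
    obtain H where "H \<in> C" using ne by blast
    then show "\<zero>\<^bsub>M\<^esub> \<in> \<Union>C" using submodule_zero[OF X(2), of H] CX by blast
  next
    show "\<Union>C \<subseteq> carrier M" using submodule_carrierD[OF X(2)] CX by auto
    fix a x assume a: "a \<in> carrier R" and "x \<in> \<Union>C"
    then obtain H where H: "H \<in> C" "x \<in> H" by blast
    then show "a \<odot>\<^bsub>M\<^esub> x \<in> \<Union>C" using submoduleE(4)[OF X(2) a H(2)] CX by blast
  qed
  obtain A where A: "finite A" "A \<subseteq> \<Union>C" "module_span R M A = \<Union>C"
    using submodule_fin_gen[OF R M U] by blast
  obtain H where H: "H \<in> C" "A \<subseteq> H"
    using finite_subset_Union_chain[OF A(1,2) ne ch] by blast
  then have "\<Union>C \<subseteq> H" using span_least[of H A] X(2) CX A(3) by blast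
  then have "\<Union>C = H" using H by blast
  then show "\<Union>C \<in> X" using H CX by blast
qed

lemma ascending_chain_stable:
  assumes R: "noetherian_ring R" and M: "fin_gen_module R M"
    and U: "\<And>n::nat. submodule (U n) R M" "\<And>n. U n \<subseteq> U (Suc n)"
  shows "\<exists>n. U (Suc n) = U n"
proof -
  obtain n where "\<forall>K\<in>range U. U n \<subseteq> K \<longrightarrow> K = U n"
    using maximal_submodule_exists[OF R M, of "range U"] U(1) by auto
  then show ?thesis using U(2)[of n] by blast
qed

end

section \<open>Local rings: units, Nakayama's lemma, Krull's intersection theorem\<close>

locale noetherian_local = cring R for R (structure) +
  fixes m
  assumes local: "local_ring R m" and noetherian: "noetherian_ring R"
begin

lemma maximal: "maximalideal m R"
  using local by (simp add: local_ring_def)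

lemma ideal_m: "ideal m R"
  by (rule maximalideal.axioms(1)[OF maximal])

lemma m_subset: "m \<subseteq> carrier R"
  using ideal.Icarr[OF ideal_m] by blast

lemma one_notin_m: "\<one> \<notin> m"
  using maximalideal.I_notcarr[OF maximal] ideal.one_imp_carrier[OF ideal_m] by blast

lemma one_not_zero: "\<one> \<noteq> \<zero>"
  using one_notin_m additive_subgroup.zero_closed[OF ideal.axioms(1)[OF ideal_m]] by auto

lemma pow_subset: "ideal_pow R m n \<subseteq> carrier R"
  using ideal.Icarr[OF ideal_pow_ideal[OF ideal_m]] by blast

text \<open>For a nonunit \<open>a\<close>, an ideal that is maximal among those containing
  \<open>a\<close> and avoiding \<open>\<one>\<close> is a maximal ideal, hence equals
  \<open>m\<close>, which would put \<open>a\<close> into \<open>m\<close>. Such an ideal exists by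
  the Noetherian property of R as a module over itself.\<close>

lemma unitI:
  assumes a: "a \<in> carrier R" "a \<notin> m"
  shows "a \<in> Units R"
proof (rule ccontr)
  assume nu: "a \<notin> Units R"
  interpret S: module R "self_module R" by (rule module_self)
  define X where "X = {J. ideal J R \<and> a \<in> J \<and> \<one> \<notin> J}"
  have "\<one> \<notin> PIdl a"
  proof
    assume "\<one> \<in> PIdl a"
    then obtain x where "x \<in> carrier R" "\<one> = x \<otimes> a" unfolding cgenideal_def by auto
    then have "a \<in> Units R" using a m_comm[of x a] by (auto simp: Units_def)
    then show False using nu by blast
  qed
  then have "PIdl a \<in> X" using cgenideal_ideal[OF a(1)] cgenideal_self[OF a(1)] by (simp add: X_def)
  then obtain J where J: "J \<in> X" "\<And>K. K \<in> X \<Longrightarrow> J \<subseteq> K \<Longrightarrow> K = J"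
    using S.maximal_submodule_exists[OF noetherian fin_gen_self, of X]
    by (auto simp: submodule_self_iff_ideal X_def)
  have "maximalideal J R"
  proof (rule maximalidealI)
    show "ideal J R" "carrier R \<noteq> J" using J(1) by (auto simp: X_def)
    fix K assume K: "ideal K R" "J \<subseteq> K" "K \<subseteq> carrier R"
    show "K = J \<or> K = carrier R"
    proof (cases "\<one> \<in> K")
      case True
      then show ?thesis using ideal.one_imp_carrier[OF K(1)] by blast
    next
      case False
      then show ?thesis using J K by (auto simp: X_def)
    qed
  qed
  then have "J = m" using local by (simp add: local_ring_def)
  then show False using J(1) a by (simp add: X_def)
qed

lemma one_minus_unit:
  assumes a: "a \<in> m"
  shows "\<one> \<ominus> a \<in> Units R"
proof (rule unitI)
  have a': "a \<in> carrier R" using a m_subset by blast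
  show "\<one> \<ominus> a \<in> carrier R" using a' by simp
  interpret m: ideal m R by (rule ideal_m)
  show "\<one> \<ominus> a \<notin> m"
  proof
    assume "\<one> \<ominus> a \<in> m"
    then have "\<one> \<ominus> a \<oplus> a \<in> m" using a by (rule m.a_closed)
    then show False using a' one_notin_m by (simp add: a_minus_def a_assoc l_neg)
  qed
qed

text \<open>Take L' maximal among the submodules with L \<subseteq> L' \<subset> D. Every x in D
  outside L' generates D together with L'. If a x with a in m were outside L' too, then x = l + b a
  x with l in L', and since 1 - b a is a unit, x would lie in L'. So m maps D into L'. In this form
  no quotient D/L is needed.\<close>

lemma nakayama:
  assumes M: "module R M" "fin_gen_module R M"
    and L: "submodule L R M" and D: "submodule D R M" and LD: "L \<subset> D"
  shows "\<exists>L'. submodule L' R M \<and> L \<subseteq> L' \<and> L' \<subset> D \<and> (\<forall>a\<in>m. \<forall>x\<in>D. a \<odot>\<^bsub>M\<^esub> x \<in> L')"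
proof -
  interpret M: module R M by fact
  define X where "X = {K. submodule K R M \<and> L \<subseteq> K \<and> K \<subset> D}"
  have "L \<in> X" using L LD by (simp add: X_def)
  have "\<exists>H\<in>X. \<forall>K\<in>X. H \<subseteq> K \<longrightarrow> K = H"
    by (rule M.maximal_submodule_exists[OF noetherian M(2)]) (use \<open>L \<in> X\<close> in \<open>auto simp: X_def\<close>)
  then obtain L' where L': "L' \<in> X" and max: "\<And>K. K \<in> X \<Longrightarrow> L' \<subseteq> K \<Longrightarrow> K = L'" by blast
  have sL': "submodule L' R M" and LL: "L \<subseteq> L'" "L' \<subset> D" using L' by (auto simp: X_def)
  note cL' = M.submodule_carrierD[OF sL'] and cD = M.submodule_carrierD[OF D]
  have gen: "D = L' <+>\<^bsub>M\<^esub> {r \<odot>\<^bsub>M\<^esub> x | r. r \<in> carrier R}" if x: "x \<in> D" "x \<notin> L'" for x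
  proof (rule ccontr)
    let ?K = "L' <+>\<^bsub>M\<^esub> {r \<odot>\<^bsub>M\<^esub> x | r. r \<in> carrier R}"
    assume ne: "D \<noteq> ?K"
    note sub = sL' M.submodule_multiples[OF cD[OF x(1)]]
    have K: "submodule ?K R M" by (rule M.submodule_set_add[OF sub])
    have "?K \<subseteq> D"
      by (rule M.set_add_least[OF D]) (use LL x(1) M.submoduleE(4)[OF D] in auto)
    moreover have "L' \<subseteq> ?K" using M.set_add_superset[OF sub] by blast
    ultimately have "?K = L'" using K LL ne by (intro max) (auto simp: X_def)
    moreover have "x \<in> {r \<odot>\<^bsub>M\<^esub> x | r. r \<in> carrier R}" using cD[OF x(1)] by (auto intro!: exI[of _ \<one>])
    ultimately show False using M.set_add_superset[OF sub] x(2) by blast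
  qed
  obtain x where x: "x \<in> D" "x \<notin> L'" using LL(2) by blast
  have xc: "x \<in> carrier M" using cD x by blast
  have ax: "a \<odot>\<^bsub>M\<^esub> x \<in> L'" if a: "a \<in> m" for a
  proof (rule ccontr)
    assume n: "a \<odot>\<^bsub>M\<^esub> x \<notin> L'"
    have a': "a \<in> carrier R" using a m_subset by blast
    have "x \<in> L' <+>\<^bsub>M\<^esub> {r \<odot>\<^bsub>M\<^esub> (a \<odot>\<^bsub>M\<^esub> x) | r. r \<in> carrier R}"
      using gen[OF M.submoduleE(4)[OF D a' x(1)] n] x(1) by simp
    then obtain l b where lb: "l \<in> L'" "b \<in> carrier R" "x = l \<oplus>\<^bsub>M\<^esub> b \<odot>\<^bsub>M\<^esub> (a \<odot>\<^bsub>M\<^esub> x)"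
      unfolding M.mem_set_add by auto
    have u: "\<one> \<ominus> b \<otimes> a \<in> Units R"
      by (rule one_minus_unit) (use ideal.I_l_closed[OF ideal_m a lb(2)] in simp)
    have "(\<one> \<ominus> b \<otimes> a) \<odot>\<^bsub>M\<^esub> x = x \<ominus>\<^bsub>M\<^esub> (b \<otimes> a) \<odot>\<^bsub>M\<^esub> x"
      using lb a' xc by (simp add: a_minus_def M.smult_l_distr M.smult_l_minus)
    also have "\<dots> = x \<ominus>\<^bsub>M\<^esub> b \<odot>\<^bsub>M\<^esub> (a \<odot>\<^bsub>M\<^esub> x)" using lb a' xc by (simp add: M.smult_assoc1)
    also have "\<dots> = l"
    proof -
      have "l \<oplus>\<^bsub>M\<^esub> b \<odot>\<^bsub>M\<^esub> (a \<odot>\<^bsub>M\<^esub> x) \<ominus>\<^bsub>M\<^esub> b \<odot>\<^bsub>M\<^esub> (a \<odot>\<^bsub>M\<^esub> x) = l"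
        using lb(1,2) a' xc cL' by (simp add: a_minus_def M.M.a_assoc M.M.r_neg)
      then show ?thesis using lb(3) by simp
    qed
    finally have "(\<one> \<ominus> b \<otimes> a) \<odot>\<^bsub>M\<^esub> x \<in> L'" using lb by simp
    then have "inv (\<one> \<ominus> b \<otimes> a) \<odot>\<^bsub>M\<^esub> ((\<one> \<ominus> b \<otimes> a) \<odot>\<^bsub>M\<^esub> x) \<in> L'"
      by (rule M.submoduleE(4)[OF sL' Units_inv_closed[OF u]])
    moreover have "inv (\<one> \<ominus> b \<otimes> a) \<odot>\<^bsub>M\<^esub> ((\<one> \<ominus> b \<otimes> a) \<odot>\<^bsub>M\<^esub> x) = x"
      using M.smult_assoc1[OF Units_inv_closed[OF u] Units_closed[OF u] xc] Units_l_inv[OF u] xc by simp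
    ultimately have "x \<in> L'" by simp
    then show False using x by blast
  qed
  have "a \<odot>\<^bsub>M\<^esub> y \<in> L'" if a: "a \<in> m" and y: "y \<in> D" for a y
  proof -
    have a': "a \<in> carrier R" using a m_subset by blast
    obtain l r where lr: "l \<in> L'" "r \<in> carrier R" "y = l \<oplus>\<^bsub>M\<^esub> r \<odot>\<^bsub>M\<^esub> x"
      using y unfolding gen[OF x] M.mem_set_add by auto
    have "a \<odot>\<^bsub>M\<^esub> y = a \<odot>\<^bsub>M\<^esub> l \<oplus>\<^bsub>M\<^esub> r \<odot>\<^bsub>M\<^esub> (a \<odot>\<^bsub>M\<^esub> x)"
      unfolding lr(3) using lr a' xc cL' by (simp add: M.smult_r_distr M.smult_assoc1[symmetric] m_comm)
    then show ?thesis using lr ax[OF a] a' M.submoduleE(4,5)[OF sL'] by simp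
  qed
  then show ?thesis using sL' LL by blast
qed

text \<open>Noetherian induction: if \<open>H\<close> is a maximal counterexample with witness \<open>x\<close>, then \<open>x\<close> lies in every larger
  submodule. Hence \<open>m x \<subseteq> H\<close>, each \<open>a \<in> m\<close> acts nilpotently modulo \<open>H\<close>, and so does \<open>m\<close> itself.\<close>

lemma krull_intersection:
  assumes M: "module R M" "fin_gen_module R M" and L: "submodule L R M"
    and x: "\<And>k. x \<in> L <+>\<^bsub>M\<^esub> ideal_smult R (ideal_pow R m k) M"
  shows "x \<in> L"
proof (rule ccontr)
  assume xL: "x \<notin> L"
  interpret M: module R M by fact
  let ?P = "\<lambda>k. ideal_smult R (ideal_pow R m k) M"
  have sP: "submodule (?P k) R M" for k by (rule M.submodule_ideal_smult[OF pow_subset])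
  define X where "X = {L. submodule L R M \<and> (\<exists>x. x \<notin> L \<and> (\<forall>k. x \<in> L <+>\<^bsub>M\<^esub> ?P k))}"
  have "L \<in> X" using L x xL by (auto simp: X_def)
  have "\<exists>H\<in>X. \<forall>K\<in>X. H \<subseteq> K \<longrightarrow> K = H"
    by (rule M.maximal_submodule_exists[OF noetherian M(2)]) (use \<open>L \<in> X\<close> in \<open>auto simp: X_def\<close>)
  then obtain H where H: "H \<in> X" and max: "\<And>K. K \<in> X \<Longrightarrow> H \<subseteq> K \<Longrightarrow> K = H" by blast
  from H have sH: "submodule H R M" by (simp add: X_def)
  from H obtain x where xH: "x \<notin> H" and xP: "\<And>k. x \<in> H <+>\<^bsub>M\<^esub> ?P k" by (auto simp: X_def)
  note cH = M.submodule_carrierD[OF sH]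
  have xc: "x \<in> carrier M"
    using M.submodule_carrierD[OF M.submodule_set_add[OF sH sP] xP[of 0]] .
  have above: "x \<in> K" if K: "submodule K R M" "H \<subset> K" for K
  proof (rule ccontr)
    assume "x \<notin> K"
    moreover have "x \<in> K <+>\<^bsub>M\<^esub> ?P k" for k using xP[of k] K(2) unfolding M.mem_set_add by blast
    ultimately have "K \<in> X" using K by (auto simp: X_def)
    then show False using max[of K] K(2) by blast
  qed
  let ?D = "H <+>\<^bsub>M\<^esub> {r \<odot>\<^bsub>M\<^esub> x | r. r \<in> carrier R}"
  note sub = sH M.submodule_multiples[OF xc]
  have D: "submodule ?D R M" by (rule M.submodule_set_add[OF sub])
  have "x \<in> {r \<odot>\<^bsub>M\<^esub> x | r. r \<in> carrier R}" using xc by (auto intro!: exI[of _ \<one>])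
  then have xD: "x \<in> ?D" and HD: "H \<subset> ?D" using M.set_add_superset[OF sub] xH by blast+
  obtain L' where L': "submodule L' R M" "H \<subseteq> L'" "L' \<subset> ?D" "\<forall>a\<in>m. \<forall>x\<in>?D. a \<odot>\<^bsub>M\<^esub> x \<in> L'"
    using nakayama[OF M sH D HD] by blast
  \<comment> \<open>Otherwise L' is strictly above H, contains x by \<open>above\<close>, and is
    therefore all of \<open>?D\<close>, although it is a proper part. With L' = H the lemma says
    that m x lies in H.\<close>
  have "L' = H"
  proof (rule ccontr)
    assume "L' \<noteq> H"
    then have "x \<in> L'" using above[OF L'(1)] L'(2) by blast
    then have "?D \<subseteq> L'"
      by (intro M.set_add_least[OF L'(1,2)]) (auto intro: M.submoduleE(4)[OF L'(1)])
    then show False using L'(3) by blast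
  qed
  then have mx: "a \<odot>\<^bsub>M\<^esub> x \<in> H" if "a \<in> m" for a using L'(4) xD that by blast
  have nilp: "\<exists>t::nat. \<forall>y\<in>carrier M. a [^] t \<odot>\<^bsub>M\<^esub> y \<in> H" if a: "a \<in> m" for a
  proof -
    have a': "a \<in> carrier R" using a m_subset by blast
    then have at: "a [^] (t::nat) \<in> carrier R" for t by simp
    have suc: "a [^] Suc t \<odot>\<^bsub>M\<^esub> y = a \<odot>\<^bsub>M\<^esub> (a [^] t \<odot>\<^bsub>M\<^esub> y)" if "y \<in> carrier M" for t y
      using a' that by (simp add: M.smult_assoc1[symmetric] m_comm)
    let ?U = "\<lambda>t::nat. {y \<in> carrier M. a [^] t \<odot>\<^bsub>M\<^esub> y \<in> H}"
    have "submodule (?U t) R M" for t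
      by (rule mod_hom.submodule_preimage[OF M.smult_hom[OF at] sH])
    moreover have "?U t \<subseteq> ?U (Suc t)" for t
      using suc[of _ t] M.submoduleE(4)[OF sH a'] by auto
    ultimately obtain t where t: "?U (Suc t) = ?U t"
      using M.ascending_chain_stable[OF noetherian M(2), of ?U] by blast
    interpret h: mod_hom R M M "\<lambda>y. a [^] t \<odot>\<^bsub>M\<^esub> y" by (rule M.smult_hom[OF at])
    let ?I = "(\<lambda>y. a [^] t \<odot>\<^bsub>M\<^esub> y) ` carrier M"
    have sI: "submodule ?I R M" by (rule h.submodule_image[OF M.carrier_is_submodule])
    note sup = M.set_add_superset[OF sH sI]
    \<comment> \<open>If the submodule H + \<open>?I\<close> is larger than H, it contains x, say x
      = l + \<open>a\<^sup>t\<close> y. Multiplying by a sends x and l into H, hence also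
      \<open>a\<^sup>t\<^sup>+\<^sup>1\<close> y, and the stability of \<open>?U\<close> at t puts
      \<open>a\<^sup>t\<close> y, and so x, into H.\<close>
    have "?I \<subseteq> H"
    proof (rule ccontr)
      assume "\<not> ?I \<subseteq> H"
      then have "x \<in> H <+>\<^bsub>M\<^esub> ?I" using sup by (intro above M.submodule_set_add sH sI) blast
      then obtain l y where ly: "l \<in> H" "y \<in> carrier M" "x = l \<oplus>\<^bsub>M\<^esub> a [^] t \<odot>\<^bsub>M\<^esub> y"
        unfolding M.mem_set_add by blast
      have al: "a \<odot>\<^bsub>M\<^esub> l \<in> H" by (rule M.submoduleE(4)[OF sH a' ly(1)])
      have "a [^] Suc t \<odot>\<^bsub>M\<^esub> y = a \<odot>\<^bsub>M\<^esub> x \<ominus>\<^bsub>M\<^esub> a \<odot>\<^bsub>M\<^esub> l"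
        unfolding suc[OF ly(2)] ly(3) using ly a' at cH
        by (simp add: M.smult_r_distr a_minus_def M.M.a_ac M.M.r_neg1 M.M.r_neg2)
      then have "y \<in> ?U (Suc t)" using M.submodule_minus[OF sH mx[OF a] al] ly by simp
      then have "a [^] t \<odot>\<^bsub>M\<^esub> y \<in> H" using t by blast
      then show False using ly M.submoduleE(5)[OF sH] xH by blast
    qed
    then show ?thesis by blast
  qed
  \<comment> \<open>The elements that \<open>m\<^sup>k\<close> sends into H. This chain stabilises
    at some k. If \<open>?V k\<close> were not everything, there would be y outside it with m y
    inside it; then \<open>m\<^sup>k\<^sup>+\<^sup>1\<close> y is in H, so y is in
    \<open>?V (Suc k) = ?V k\<close>, a contradiction.\<close>
  let ?V = "\<lambda>k. {y \<in> carrier M. \<forall>r\<in>ideal_pow R m k. r \<odot>\<^bsub>M\<^esub> y \<in> H}"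
  have sV: "submodule (?V k) R M" for k
  proof (rule M.submoduleI')
    fix y z assume "y \<in> ?V k" "z \<in> ?V k"
    then show "y \<oplus>\<^bsub>M\<^esub> z \<in> ?V k"
      using pow_subset[of k] M.submoduleE(5)[OF sH] by (auto simp: M.smult_r_distr subsetD)
  next
    fix b y assume b: "b \<in> carrier R" and y: "y \<in> ?V k"
    have "r \<odot>\<^bsub>M\<^esub> (b \<odot>\<^bsub>M\<^esub> y) \<in> H" if r: "r \<in> ideal_pow R m k" for r
    proof -
      have "r \<odot>\<^bsub>M\<^esub> (b \<odot>\<^bsub>M\<^esub> y) = b \<odot>\<^bsub>M\<^esub> (r \<odot>\<^bsub>M\<^esub> y)"
        using b y r pow_subset[of k] by (auto simp: M.smult_assoc1[symmetric] m_comm subsetD)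
      then show ?thesis using r y M.submoduleE(4)[OF sH b] by simp
    qed
    then show "b \<odot>\<^bsub>M\<^esub> y \<in> ?V k" using b y by auto
  qed (use pow_subset[of k] M.submodule_zero[OF sH] in \<open>auto simp: subsetD\<close>)
  have "?V k \<subseteq> ?V (Suc k)" for k
    using ideal_pow_antimono[OF ideal_m, of k "Suc k"] by (auto simp del: ideal_pow.simps)
  with sV obtain k where k: "?V (Suc k) = ?V k"
    using M.ascending_chain_stable[OF noetherian M(2), of ?V] by blast
  have "?V k = carrier M"
  proof (rule ccontr)
    assume "?V k \<noteq> carrier M"
    then have ne: "\<exists>y\<in>carrier M. y \<notin> ?V k" by blast
    obtain S where S: "S \<subseteq> carrier R" "finite S" "m = Idl S"
      using noetherian_ring.finetely_gen[OF noetherian ideal_m] by blast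
    have "S \<subseteq> m" using genideal_self[OF S(1)] S(3) by simp
    \<comment> \<open>The required y is found by treating the generators of m one at a time. For a
      new generator a, multiply y by the last power of a that keeps it outside \<open>?V k\<close>;
      it exists because a acts nilpotently modulo H, and the earlier conditions survive since
      \<open>?V k\<close> is a submodule.\<close>
    with S(2) have "\<exists>y\<in>carrier M. y \<notin> ?V k \<and> (\<forall>a\<in>S. a \<odot>\<^bsub>M\<^esub> y \<in> ?V k)"
    proof (induction S)
      case empty
      then show ?case using ne by blast
    next
      case (insert a S)
      then obtain y where y: "y \<in> carrier M" "y \<notin> ?V k" "\<forall>a\<in>S. a \<odot>\<^bsub>M\<^esub> y \<in> ?V k" by auto
      have am: "a \<in> m" and a: "a \<in> carrier R" and Sc: "S \<subseteq> carrier R" using insert.prems m_subset by auto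
      have at: "a [^] (t::nat) \<in> carrier R" for t using a by simp
      obtain t0 :: nat where t0: "\<forall>y\<in>carrier M. a [^] t0 \<odot>\<^bsub>M\<^esub> y \<in> H" using nilp[OF am] by blast
      have "a [^] t0 \<odot>\<^bsub>M\<^esub> y \<in> ?V k"
      proof -
        have "r \<odot>\<^bsub>M\<^esub> (a [^] t0 \<odot>\<^bsub>M\<^esub> y) \<in> H" if "r \<in> ideal_pow R m k" for r
          using M.submoduleE(4)[OF sH, of r "a [^] t0 \<odot>\<^bsub>M\<^esub> y"] t0 y that pow_subset[of k] by blast
        then show ?thesis using y at by simp
      qed
      then have ex: "\<exists>t::nat. a [^] t \<odot>\<^bsub>M\<^esub> y \<in> ?V k" by blast
      define t where "t = (LEAST t::nat. a [^] t \<odot>\<^bsub>M\<^esub> y \<in> ?V k)"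
      have t: "a [^] t \<odot>\<^bsub>M\<^esub> y \<in> ?V k" unfolding t_def by (rule LeastI_ex[OF ex])
      have "t \<noteq> 0"
      proof
        assume "t = 0"
        then have "y \<in> ?V k" using t y(1) by simp
        then show False using y(2) by blast
      qed
      then obtain t' where t': "t = Suc t'" by (cases t) auto
      let ?y = "a [^] t' \<odot>\<^bsub>M\<^esub> y"
      have "?y \<notin> ?V k" using not_less_Least[of t' "\<lambda>t. a [^] t \<odot>\<^bsub>M\<^esub> y \<in> ?V k"] t' unfolding t_def by auto
      moreover have "?y \<in> carrier M" using y at by simp
      moreover have "b \<odot>\<^bsub>M\<^esub> ?y \<in> ?V k" if b: "b \<in> insert a S" for b
      proof (cases "b = a")
        case True
        have "a \<odot>\<^bsub>M\<^esub> ?y = a [^] t \<odot>\<^bsub>M\<^esub> y" using a y t' by (simp add: M.smult_assoc1[symmetric] m_comm)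
        then show ?thesis using t True by simp
      next
        case False
        then have "b \<in> S" using b by blast
        then have "b \<odot>\<^bsub>M\<^esub> ?y = a [^] t' \<odot>\<^bsub>M\<^esub> (b \<odot>\<^bsub>M\<^esub> y)" "b \<odot>\<^bsub>M\<^esub> y \<in> ?V k"
          using a y Sc by (auto simp: M.smult_assoc1[symmetric] m_comm subsetD)
        then show ?thesis using M.submoduleE(4)[OF sV at, of "b \<odot>\<^bsub>M\<^esub> y" k t'] by simp
      qed
      ultimately show ?case by blast
    qed
    then obtain y where y: "y \<in> carrier M" "y \<notin> ?V k" "\<forall>a\<in>S. a \<odot>\<^bsub>M\<^esub> y \<in> ?V k" by blast
    have "Idl S \<subseteq> {r \<in> carrier R. r \<odot>\<^bsub>M\<^esub> y \<in> ?V k}"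
      by (rule genideal_minimal[OF M.ideal_colon[OF sV y(1)]]) (use S(1) y(3) in blast)
    then have "m \<subseteq> {r \<in> carrier R. r \<odot>\<^bsub>M\<^esub> y \<in> ?V k}" using S(3) by blast
    then have my: "\<forall>j\<in>ideal_pow R m k. j \<odot>\<^bsub>M\<^esub> (i \<odot>\<^bsub>M\<^esub> y) \<in> H" if "i \<in> m" for i using that by blast
    have "r \<odot>\<^bsub>M\<^esub> y \<in> H" if "r \<in> ideal_pow R m (Suc k)" for r
      using that unfolding ideal_pow.simps
    proof (induction rule: ideal_prod.induct)
      case (prod i j)
      have "(i \<otimes> j) \<odot>\<^bsub>M\<^esub> y = j \<odot>\<^bsub>M\<^esub> (i \<odot>\<^bsub>M\<^esub> y)"
        using prod m_subset pow_subset[of k] y(1) by (simp add: M.smult_assoc1[symmetric] m_comm subsetD)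
      then show ?case using my[OF prod(1)] prod(2) by simp
    next
      case (sum s1 s2)
      have "s1 \<in> carrier R" "s2 \<in> carrier R" using sum.hyps pow_subset[of "Suc k"] by auto
      then show ?case using sum.IH y(1) M.submoduleE(5)[OF sH] by (simp add: M.smult_l_distr)
    qed
    then have "y \<in> ?V (Suc k)" using y(1) by blast
    then show False using k y(2) by blast
  qed
  then have "?P k \<subseteq> H" by (intro M.ideal_smult_least[OF sH]) blast
  then have "H <+>\<^bsub>M\<^esub> ?P k \<subseteq> H" by (rule M.set_add_least[OF sH order_refl])
  then show False using xP[of k] xH by blast
qed

end

section \<open>Minimal free resolutions\<close>

lemma (in module) mod_hom_extend:
  assumes H: "submodule H R M" and f: "mod_hom R N (M\<lparr>carrier := H\<rparr>) f"
  shows "mod_hom R N M f"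
proof -
  interpret f: mod_hom R N "M\<lparr>carrier := H\<rparr>" f by fact
  show ?thesis
    by (intro mod_hom.intro mod_hom_axioms.intro f.M.module_axioms module_axioms)
      (use f.hom submodule_carrierD[OF H] in \<open>auto simp: module_homs_def Pi_iff\<close>)
qed

text \<open>The span has to be formed anew in the record with the smaller carrier. A submodule of
  that record is also one of \<open>M\<close>, so both spans agree.\<close>

lemma (in module) fin_gen_restrict:
  assumes "noetherian_ring R" "fin_gen_module R M" and H: "submodule H R M"
  shows "fin_gen_module R (M\<lparr>carrier := H\<rparr>)"
proof -
  obtain C where C: "finite C" "C \<subseteq> H" "module_span R M C = H"
    using submodule_fin_gen[OF assms] by blast
  interpret H: module R "M\<lparr>carrier := H\<rparr>" by (rule submodule.submodule_is_module[OF H module_axioms])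
  have sub: "submodule (module_span R (M\<lparr>carrier := H\<rparr>) C) R (M\<lparr>carrier := H\<rparr>)"
    by (rule H.submodule_span) (use C in simp)
  have "submodule (module_span R (M\<lparr>carrier := H\<rparr>) C) R M"
    by (rule submoduleI')
      (use H.submodule_carrierD[OF sub] H.submodule_zero[OF sub] H.submoduleE(4,5)[OF sub]
        submodule_carrierD[OF H] in auto)
  then have "H \<subseteq> module_span R (M\<lparr>carrier := H\<rparr>) C"
    using span_least H.span_superset[of C] C(3) by blast
  then have "module_span R (M\<lparr>carrier := H\<rparr>) C = H"
    using H.submodule_carrierD[OF sub] by auto
  then show ?thesis
    unfolding fin_gen_module_def using C H.module_axioms by auto
qed

context cring
begin

lemma lin_ext_free_gen:
  assumes c: "c \<in> carrier (free_module R B)"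
  shows "lin_ext R (free_module R B) (free_gen R) c = c"
proof -
  interpret L: module R "free_module R B" by (rule module_free)
  have g: "free_gen R \<in> B \<rightarrow> carrier (free_module R B)" by (rule Pi_I) (rule free_gen_closed)
  show ?thesis
    by (rule free_module_hom_eqI[OF L.lin_ext_hom[OF g] mod_hom_id[OF module_free] L.lin_ext_gen[OF g] c])
qed

lemma fin_gen_free:
  assumes "finite B"
  shows "fin_gen_module R (free_module R B)"
proof -
  interpret L: module R "free_module R B" by (rule module_free)
  let ?S = "module_span R (free_module R B) (free_gen R ` B)"
  have g: "free_gen R ` B \<subseteq> carrier (free_module R B)" by (rule image_subsetI) (rule free_gen_closed)
  have sub: "submodule ?S R (free_module R B)" by (rule L.submodule_span[OF g])
  have "carrier (free_module R B) \<subseteq> ?S"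
  proof
    fix c assume "c \<in> carrier (free_module R B)"
    then show "c \<in> ?S"
      by (rule free_module_generated[OF sub, rotated]) (use L.span_superset[of "free_gen R ` B"] in blast)
  qed
  then have "?S = carrier (free_module R B)" using L.submoduleE(1)[OF sub] by blast
  then show ?thesis 
    unfolding fin_gen_module_def using g assms L.module_axioms
    by (intro conjI exI[of _ "free_gen R ` B"]) simp_all
qed

lemma mem_ideal_smult_free:
  assumes c: "c \<in> carrier (free_module R B)" and I: "I \<subseteq> carrier R" "\<And>b. b \<in> B \<Longrightarrow> c b \<in> I"
  shows "c \<in> ideal_smult R I (free_module R B)"
proof -
  interpret L: module R "free_module R B" by (rule module_free)
  have "c b \<odot>\<^bsub>free_module R B\<^esub> free_gen R b \<in> ideal_smult R I (free_module R B)" if "c b \<noteq> \<zero>" for b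
  proof -
    have "b \<in> B" using c that by auto
    then show ?thesis using I(2) free_gen_closed by (intro L.ideal_smultI)
  qed
  then have "lin_ext R (free_module R B) (free_gen R) c \<in> ideal_smult R I (free_module R B)"
    unfolding lin_ext_def by (intro L.submodule_finsum[OF L.submodule_ideal_smult[OF I(1)]] Pi_I) blast
  then show ?thesis using lin_ext_free_gen[OF c] by simp
qed

end

context noetherian_local
begin

text \<open>Take a generating set of least size. A relation with a coordinate outside m has a unit
  there, so that generator could be expressed by the others and dropped. Indexing the basis by
  \<open>{..<n}\<close> keeps all modules in the type \<open>nat \<Rightarrow> 'a\<close> on which
  \<open>Tor\<close> is built.\<close>

lemma minimal_cover_exists:
  assumes N: "fin_gen_module R N"
  shows "\<exists>n e. mod_hom R (free_module R {..<n::nat}) N e \<and>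
    e ` carrier (free_module R {..<n}) = carrier N \<and>
    {x \<in> carrier (free_module R {..<n}). e x = \<zero>\<^bsub>N\<^esub>} \<subseteq> ideal_smult R m (free_module R {..<n})"
proof -
  interpret N: module R N using N by (simp add: fin_gen_module_def)
  let ?Q = "\<lambda>A. finite A \<and> A \<subseteq> carrier N \<and> module_span R N A = carrier N"
  obtain A0 where A0: "?Q A0" using N by (auto simp: fin_gen_module_def)
  have "\<exists>A. ?Q A \<and> (\<forall>A'. ?Q A' \<longrightarrow> card A \<le> card A')"
    by (rule ex_has_least_nat[of ?Q, OF A0])
  then obtain A where A: "?Q A" and min': "\<forall>A'. ?Q A' \<longrightarrow> card A \<le> card A'" by (elim exE conjE) simp
  have min: "card A \<le> card A'" if "?Q A'" for A' using min' that by (elim allE impE)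
  obtain g where g: "bij_betw g {..<card A} A"
    using ex_bij_betw_nat_finite[of A] A by (auto simp: atLeast0LessThan)
  let ?n = "card A"
  let ?L = "free_module R {..<?n}" and ?e = "lin_ext R N g"
  have g': "g \<in> {..<?n} \<rightarrow> carrier N" using g A by (auto simp: bij_betw_def)
  interpret e: mod_hom R ?L N ?e by (rule N.lin_ext_hom[OF g'])
  have "A \<subseteq> ?e ` carrier ?L"
  proof
    fix a assume "a \<in> A"
    then obtain i where i: "i \<in> {..<?n}" "a = g i" using g by (auto simp: bij_betw_def)
    then show "a \<in> ?e ` carrier ?L"
      using N.lin_ext_gen[OF g' i(1)] free_gen_closed[OF i(1)] by (metis imageI)
  qed
  then have "carrier N \<subseteq> ?e ` carrier ?L"
    using N.span_least[OF e.submodule_image[OF e.M.carrier_is_submodule]] A by blast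
  moreover have "?e ` carrier ?L \<subseteq> carrier N" using e.hom_closed by blast
  moreover have "x \<in> ideal_smult R m ?L" if x: "x \<in> carrier ?L" "?e x = \<zero>\<^bsub>N\<^esub>" for x
  proof (rule mem_ideal_smult_free[OF x(1) m_subset], rule ccontr)
    fix b assume b: "b \<in> {..<?n}" and xb: "x b \<notin> m"
    have xb': "x b \<in> carrier R" using x(1) by simp
    then have u: "x b \<in> Units R" using xb by (rule unitI)
    let ?A' = "A - {g b}"
    let ?T = "module_span R N ?A'"
    have T: "submodule ?T R N" using A by (intro N.submodule_span) blast
    have gb: "g b \<in> A" using b g by (auto simp: bij_betw_def)
    have gbc: "g b \<in> carrier N" using gb A by blast
    define x' where "x' = x(b := \<zero>)"
    have x': "x' \<in> carrier (free_module R ({..<?n} - {b}))"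
      using x(1) by (auto simp: x'_def intro: finite_subset[of _ "{b. x b \<noteq> \<zero>}"])
    have x'L: "x' \<in> carrier ?L" using x' by auto
    have "g \<in> {..<?n} - {b} \<rightarrow> ?A'" using g b by (auto simp: bij_betw_def inj_on_def)
    then have "g \<in> {..<?n} - {b} \<rightarrow> ?T" using N.span_superset[of ?A'] by blast
    then have ex': "?e x' \<in> ?T" using N.lin_ext_mem[OF T _ x'] by blast
    have "x = x' \<oplus>\<^bsub>?L\<^esub> x b \<odot>\<^bsub>?L\<^esub> free_gen R b"
      using x(1) by (auto simp: x'_def free_gen_apply fun_eq_iff)
    then have "\<zero>\<^bsub>N\<^esub> = ?e (x' \<oplus>\<^bsub>?L\<^esub> x b \<odot>\<^bsub>?L\<^esub> free_gen R b)" using x(2) by simp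
    also have "\<dots> = ?e x' \<oplus>\<^bsub>N\<^esub> x b \<odot>\<^bsub>N\<^esub> g b"
      using e.hom_add[OF x'L e.M.smult_closed[OF xb' free_gen_closed[OF b]]]
        e.hom_smult[OF xb' free_gen_closed[OF b]] N.lin_ext_gen[OF g' b] by simp
    finally have "x b \<odot>\<^bsub>N\<^esub> g b = \<ominus>\<^bsub>N\<^esub> ?e x'"
      using N.M.minus_equality[of "x b \<odot>\<^bsub>N\<^esub> g b" "?e x'"] e.hom_closed[OF x'L] xb' gbc
      by (simp add: N.M.a_comm)
    then have "x b \<odot>\<^bsub>N\<^esub> g b \<in> ?T" using N.submoduleE(3)[OF T ex'] by simp
    then have "inv (x b) \<odot>\<^bsub>N\<^esub> (x b \<odot>\<^bsub>N\<^esub> g b) \<in> ?T" by (rule N.submoduleE(4)[OF T Units_inv_closed[OF u]])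
    moreover have "inv (x b) \<odot>\<^bsub>N\<^esub> (x b \<odot>\<^bsub>N\<^esub> g b) = g b"
      using N.smult_assoc1[OF Units_inv_closed[OF u] xb' gbc] Units_l_inv[OF u] gbc by simp
    ultimately have "g b \<in> ?T" by simp
    then have "A \<subseteq> ?T" using N.span_superset[of ?A'] by blast
    then have "carrier N \<subseteq> ?T" using N.span_least[OF T] A by blast
    then have "?T = carrier N" using N.submoduleE(1)[OF T] by blast
    then have "card A \<le> card ?A'" using A by (intro min) auto
    then show False using gb A card_Diff1_less[of A "g b"] by auto
  qed
  ultimately show ?thesis
    using e.mod_hom_axioms by (intro exI[of _ ?n] exI[of _ ?e]) blast
qed

text \<open>Covers of successive syzygies are spliced. \<open>M\<close> is covered separately
  because its elements have another type; all syzygies after that have elements of type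
  \<open>nat \<Rightarrow> 'a\<close>, so the iteration is an ordinary recursion.\<close>

lemma minimal_free_resolution_exists:
  assumes M: "fin_gen_module R M"
  shows "\<exists>F :: ('a, nat \<Rightarrow> 'a) chain_complex. minimal_free_resolution R m M F"
proof -
  let ?F = "\<lambda>n::nat. free_module R {..<n}"
  let ?ker = "\<lambda>n N e. {x \<in> carrier (?F n). e x = \<zero>\<^bsub>N\<^esub>}"
  obtain n0 e0 where e0: "mod_hom R (?F n0) M e0" "e0 ` carrier (?F n0) = carrier M"
      "?ker n0 M e0 \<subseteq> ideal_smult R m (?F n0)"
    using minimal_cover_exists[OF M] by blast
  let ?C = "\<lambda>(N :: ('a, nat \<Rightarrow> 'a) module) n e. mod_hom R (?F n) N e \<and>
      e ` carrier (?F n) = carrier N \<and> ?ker n N e \<subseteq> ideal_smult R m (?F n)"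
  have "\<forall>N. \<exists>p. fin_gen_module R N \<longrightarrow> ?C N (fst p) (snd p)"
  proof
    fix N :: "('a, nat \<Rightarrow> 'a) module"
    show "\<exists>p. fin_gen_module R N \<longrightarrow> ?C N (fst p) (snd p)"
    proof (cases "fin_gen_module R N")
      case True
      then obtain n e where "?C N n e" using minimal_cover_exists[OF True] by (elim exE)
      then show ?thesis by (intro exI[of _ "(n, e)"]) simp
    qed simp
  qed
  then obtain p where p: "\<forall>N. fin_gen_module R N \<longrightarrow> ?C N (fst (p N)) (snd (p N))"
    by (rule choice[THEN exE])
  define n e where "n N = fst (p N)" and "e N = snd (p N)" for N
  have cover: "fin_gen_module R N \<Longrightarrow> mod_hom R (?F (n N)) N (e N)"
      "fin_gen_module R N \<Longrightarrow> e N ` carrier (?F (n N)) = carrier N"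
      "fin_gen_module R N \<Longrightarrow> ?ker (n N) N (e N) \<subseteq> ideal_smult R m (?F (n N))"
    for N :: "('a, nat \<Rightarrow> 'a) module"
    using spec[OF p, of N] unfolding n_def e_def by simp_all
  \<comment> \<open>\<open>K\<close> sends a module to the kernel of its chosen cover, so
    \<open>N k\<close> is the syzygy number k + 1 of \<open>M\<close>, sitting inside degree k of
    the resolution.\<close>
  define K where "K N = (?F (n N))\<lparr>carrier := ?ker (n N) N (e N)\<rparr>" for N :: "('a, nat \<Rightarrow> 'a) module"
  define N where "N = rec_nat ((?F n0)\<lparr>carrier := ?ker n0 M e0\<rparr>) (\<lambda>_. K)"
  have N0: "N 0 = (?F n0)\<lparr>carrier := ?ker n0 M e0\<rparr>" and NS: "N (Suc k) = K (N k)" for k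
    by (simp_all add: N_def)
  define F where "F = \<lparr>cmod = case_nat (?F n0) (\<lambda>k. ?F (n (N k))),
    cdiff = case_nat undefined (\<lambda>k. e (N k))\<rparr>"
  have F0: "cmod F 0 = ?F n0" and FS: "cmod F (Suc k) = ?F (n (N k))" and dS: "cdiff F (Suc k) = e (N k)" for k
    by (simp_all add: F_def)
  have free: "\<exists>n. cmod F k = ?F n" for k by (cases k) (auto simp: F0 FS)
  have mod: "module R (cmod F k)" for k using free[of k] module_free by metis
  have fgF: "fin_gen_module R (cmod F k)" for k using free[of k] fin_gen_free by (metis finite_lessThan)
  \<comment> \<open>Finite generation keeps the recursion going. That \<open>N k\<close> differs
    from \<open>cmod F k\<close> only in its carrier allows the cover of \<open>N k\<close> to serve
    as a differential into \<open>cmod F k\<close>, and the last conjunct is minimality.\<close>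
  have N: "fin_gen_module R (N k) \<and> N k = (cmod F k)\<lparr>carrier := carrier (N k)\<rparr> \<and>
      submodule (carrier (N k)) R (cmod F k) \<and> carrier (N k) \<subseteq> ideal_smult R m (cmod F k)" for k
  proof (induction k)
    case 0
    have sub: "submodule (?ker n0 M e0) R (?F n0)" by (rule mod_hom.submodule_kernel[OF e0(1)])
    have "fin_gen_module R (N 0)"
      unfolding N0 by (rule module.fin_gen_restrict[OF module_free noetherian fin_gen_free sub]) simp
    then show ?case using sub e0(3) by (simp add: N0 F0)
  next
    case (Suc k)
    then have fg: "fin_gen_module R (N k)" by blast
    have sub: "submodule (?ker (n (N k)) (N k) (e (N k))) R (?F (n (N k)))"
      by (rule mod_hom.submodule_kernel[OF cover(1)[OF fg]])
    have "fin_gen_module R (N (Suc k))"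
      unfolding NS K_def by (rule module.fin_gen_restrict[OF module_free noetherian fin_gen_free sub]) simp
    then show ?case using sub cover(3)[OF fg] by (simp add: NS FS K_def)
  qed
  have bd: "boundaries F k = carrier (N k)" for k
    using cover(2)[of "N k"] N[of k] by (simp add: boundaries_def FS dS)
  have zero: "\<zero>\<^bsub>N k\<^esub> = \<zero>\<^bsub>cmod F k\<^esub>" for k
  proof -
    have "N k = (cmod F k)\<lparr>carrier := carrier (N k)\<rparr>" using N[of k] by blast
    from arg_cong[OF this, of ring.zero] show ?thesis by simp
  qed
  have cyc: "cycles F (Suc k) = carrier (N (Suc k))" for k
    using zero[of k] by (simp add: cycles_def FS dS NS K_def)
  have hom: "mod_hom R (cmod F (Suc k)) (cmod F k) (cdiff F (Suc k))" for k
  proof -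
    have "mod_hom R (cmod F (Suc k)) ((cmod F k)\<lparr>carrier := carrier (N k)\<rparr>) (cdiff F (Suc k))"
      using cover(1)[of "N k"] N[of k] unfolding FS dS by (elim conjE) (erule subst, simp)
    moreover have "submodule (carrier (N k)) R (cmod F k)" using N[of k] by blast
    ultimately show ?thesis using module.mod_hom_extend[OF mod] by blast
  qed
  have "free_resolution R M F"
    unfolding free_resolution_def
  proof (intro conjI allI impI)
    show "is_free_module R (cmod F i)" for i using free[of i] is_free_free_module[OF one_not_zero] by metis
    fix i :: nat assume "i > 0"
    then obtain k where k: "i = Suc k" using gr0_implies_Suc by blast
    show "cdiff F i \<in> module_homs R (cmod F i) (cmod F (i - 1))"
      using mod_hom.hom[OF hom[of k]] k by simp
    show "cycles F i = boundaries F i" using cyc[of k] bd[of i] k by simp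
  next
    show "\<exists>e\<in>module_homs R (cmod F 0) M. e ` carrier (cmod F 0) = carrier M \<and>
        {x \<in> carrier (cmod F 0). e x = \<zero>\<^bsub>M\<^esub>} = boundaries F 0"
      using mod_hom.hom[OF e0(1)] e0(2) by (intro bexI[of _ e0]) (auto simp: F0 bd N0 simp del: free_module_simps)
  qed
  moreover have "cdiff F i ` carrier (cmod F i) \<subseteq> ideal_smult R m (cmod F (i - 1))" if i: "i > 0" for i
  proof -
    obtain k where k: "i = Suc k" using gr0_implies_Suc[OF i] by blast
    show ?thesis using bd[of k] N[of k] by (simp add: k boundaries_def)
  qed
  ultimately have "minimal_free_resolution R m M F"
    unfolding minimal_free_resolution_def using fgF by blast
  then show ?thesis by blast
qed

end

section \<open>Quotients and tensor products\<close>

lemma quot_module_simps: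
  "carrier (quot_module M K) = a_rcosets\<^bsub>M\<^esub> K" "\<zero>\<^bsub>quot_module M K\<^esub> = K"
  "X \<oplus>\<^bsub>quot_module M K\<^esub> Y = X <+>\<^bsub>M\<^esub> Y"
  "r \<odot>\<^bsub>quot_module M K\<^esub> X = (\<Union>x\<in>X. K +>\<^bsub>M\<^esub> (r \<odot>\<^bsub>M\<^esub> x))"
  by (simp_all add: quot_module_def)

lemma a_rcosets_iff: "X \<in> a_rcosets\<^bsub>M\<^esub> K \<longleftrightarrow> (\<exists>x\<in>carrier M. X = K +>\<^bsub>M\<^esub> x)"
  by (auto simp: A_RCOSETS_def')

context module
begin

lemma abelian_subgroup_submodule:
  assumes "submodule K R M"
  shows "abelian_subgroup K M"
  by (rule abelian_subgroupI3)
    (use submodule.axioms(1)[OF assms] in \<open>auto simp: additive_subgroup_def M.abelian_group_axioms\<close>)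

context
  fixes K
  assumes K: "submodule K R M"
begin

interpretation K: abelian_subgroup K M by (rule abelian_subgroup_submodule[OF K])

lemma coset_eq_iff:
  assumes "x \<in> carrier M" "y \<in> carrier M"
  shows "K +>\<^bsub>M\<^esub> x = K +>\<^bsub>M\<^esub> y \<longleftrightarrow> x \<ominus>\<^bsub>M\<^esub> y \<in> K"
  using assms K.a_repr_independence'[of x y] K.a_rcos_self[of x] K.a_rcos_module[of y x]
  by (auto simp: a_minus_def)

lemma coset_eq_iff_mem: "x \<in> carrier M \<Longrightarrow> K +>\<^bsub>M\<^esub> x = K \<longleftrightarrow> x \<in> K"
  using M.a_coset_join1[OF _ _ K.a_subgroup] M.a_coset_join2[OF _ K.a_subgroup] by blast

lemma mem_coset_iff: "x \<in> carrier M \<Longrightarrow> y \<in> K +>\<^bsub>M\<^esub> x \<longleftrightarrow> y \<in> carrier M \<and> y \<ominus>\<^bsub>M\<^esub> x \<in> K"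
  using K.a_elemrcos_carrier[of x y] K.a_rcos_module[of x y] by (auto simp: a_minus_def)

lemma coset_self: "x \<in> carrier M \<Longrightarrow> x \<in> K +>\<^bsub>M\<^esub> x"
  by (rule K.a_rcos_self)

lemma quot_add: "x \<in> carrier M \<Longrightarrow> y \<in> carrier M \<Longrightarrow>
    (K +>\<^bsub>M\<^esub> x) \<oplus>\<^bsub>quot_module M K\<^esub> (K +>\<^bsub>M\<^esub> y) = K +>\<^bsub>M\<^esub> (x \<oplus>\<^bsub>M\<^esub> y)"
  by (simp add: quot_module_simps K.a_rcos_sum)

text \<open>All cosets in the union coincide because \<open>f\<close> maps \<open>K\<close> into
  \<open>L\<close>. This evaluates both induced maps and the scalar multiplication of a quotient on
  representatives.\<close>

lemma UN_cosets_eq: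
  assumes x: "x \<in> carrier M" and f: "mod_hom R M N f" and L: "submodule L R N" and KL: "\<And>k. k \<in> K \<Longrightarrow> f k \<in> L"
  shows "(\<Union>y\<in>K +>\<^bsub>M\<^esub> x. L +>\<^bsub>N\<^esub> f y) = L +>\<^bsub>N\<^esub> f x"
proof -
  interpret f: mod_hom R M N f by fact
  have "L +>\<^bsub>N\<^esub> f y = L +>\<^bsub>N\<^esub> f x" if "y \<in> K +>\<^bsub>M\<^esub> x" for y
  proof -
    have y: "y \<in> carrier M" "y \<ominus>\<^bsub>M\<^esub> x \<in> K" using that mem_coset_iff[OF x] by auto
    then have "f y \<ominus>\<^bsub>N\<^esub> f x \<in> L" using KL[OF y(2)] x by simp
    then show ?thesis using f.N.coset_eq_iff[OF L] x y by simp
  qed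
  then show ?thesis using coset_self[OF x] by blast
qed

lemma quot_map_coset:
  assumes "x \<in> carrier M" "mod_hom R M N f" "submodule L R N" "\<And>k. k \<in> K \<Longrightarrow> f k \<in> L"
  shows "quot_map N L f (K +>\<^bsub>M\<^esub> x) = L +>\<^bsub>N\<^esub> f x"
  unfolding quot_map_def by (rule UN_cosets_eq[OF assms])

lemma quot_smult:
  assumes "r \<in> carrier R" "x \<in> carrier M"
  shows "r \<odot>\<^bsub>quot_module M K\<^esub> (K +>\<^bsub>M\<^esub> x) = K +>\<^bsub>M\<^esub> (r \<odot>\<^bsub>M\<^esub> x)"
  unfolding quot_module_simps
  by (rule UN_cosets_eq[OF assms(2) smult_hom[OF assms(1)] K submoduleE(4)[OF K assms(1)]])

lemma module_quot: "module R (quot_module M K)"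
proof (rule moduleI)
  have c: "\<exists>x\<in>carrier M. X = K +>\<^bsub>M\<^esub> x" if "X \<in> carrier (quot_module M K)" for X
    using that by (simp add: quot_module_simps a_rcosets_iff)
  have cI: "K +>\<^bsub>M\<^esub> x \<in> carrier (quot_module M K)" if "x \<in> carrier M" for x
    using that by (auto simp: quot_module_simps a_rcosets_iff)
  have z: "\<zero>\<^bsub>quot_module M K\<^esub> = K +>\<^bsub>M\<^esub> \<zero>\<^bsub>M\<^esub>"
    using coset_eq_iff_mem[of "\<zero>\<^bsub>M\<^esub>"] submodule_zero[OF K] by (simp add: quot_module_simps)
  show "abelian_group (quot_module M K)"
  proof (rule abelian_groupI)
    fix X assume "X \<in> carrier (quot_module M K)"
    then obtain x where x: "x \<in> carrier M" "X = K +>\<^bsub>M\<^esub> x" using c by blast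
    show "\<exists>Y\<in>carrier (quot_module M K). Y \<oplus>\<^bsub>quot_module M K\<^esub> X = \<zero>\<^bsub>quot_module M K\<^esub>"
      by (rule bexI[of _ "K +>\<^bsub>M\<^esub> (\<ominus>\<^bsub>M\<^esub> x)"]) (use x in \<open>simp_all add: cI quot_add z M.l_neg\<close>)
  next
    show "\<zero>\<^bsub>quot_module M K\<^esub> \<in> carrier (quot_module M K)" unfolding z by (simp add: cI)
  qed (auto dest!: c simp: cI quot_add z M.a_ac)
qed (auto simp: quot_module_simps(1) a_rcosets_iff quot_add quot_smult smult_l_distr smult_r_distr smult_assoc1
    R.cring_axioms)

lemma quot_proj_hom: "mod_hom R M (quot_module M K) (\<lambda>x. K +>\<^bsub>M\<^esub> x)"
  by (intro mod_hom.intro mod_hom_axioms.intro module_quot module_axioms)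
    (auto simp: module_homs_def quot_add quot_smult quot_module_simps(1) a_rcosets_iff)

lemma quot_map_hom:
  assumes f: "mod_hom R M N f" and L: "submodule L R N" and KL: "\<And>k. k \<in> K \<Longrightarrow> f k \<in> L"
  shows "mod_hom R (quot_module M K) (quot_module N L) (quot_map N L f)"
proof -
  interpret f: mod_hom R M N f by fact
  interpret p: mod_hom R M "quot_module M K" "\<lambda>x. K +>\<^bsub>M\<^esub> x" by (rule quot_proj_hom)
  interpret q: mod_hom R M "quot_module N L" "\<lambda>x. L +>\<^bsub>N\<^esub> f x"
    by (rule mod_hom_compose[OF f f.N.quot_proj_hom[OF L]])
  have tm: "quot_map N L f (K +>\<^bsub>M\<^esub> x) = L +>\<^bsub>N\<^esub> f x" if "x \<in> carrier M" for x
    by (rule quot_map_coset[OF that f L KL])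
  have ex: "\<exists>x\<in>carrier M. X = K +>\<^bsub>M\<^esub> x" if "X \<in> carrier (quot_module M K)" for X
    using that unfolding quot_module_simps(1) a_rcosets_iff .
  show ?thesis
  proof (unfold_locales, unfold module_homs_def, intro CollectI conjI ballI)
    show "quot_map N L f \<in> carrier (quot_module M K) \<rightarrow> carrier (quot_module N L)"
      using ex tm q.hom_closed by fastforce
    fix X Y assume "X \<in> carrier (quot_module M K)" "Y \<in> carrier (quot_module M K)"
    then obtain x y where *: "x \<in> carrier M" "y \<in> carrier M" "X = K +>\<^bsub>M\<^esub> x" "Y = K +>\<^bsub>M\<^esub> y"
      using ex by meson
    show "quot_map N L f (X \<oplus>\<^bsub>quot_module M K\<^esub> Y) = quot_map N L f X \<oplus>\<^bsub>quot_module N L\<^esub> quot_map N L f Y"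
      unfolding *(3,4) p.hom_add[OF *(1,2), symmetric] tm[OF *(1)] tm[OF *(2)] tm[OF M.a_closed[OF *(1,2)]]
      by (rule q.hom_add[OF *(1,2)])
  next
    fix r X assume r: "r \<in> carrier R" and "X \<in> carrier (quot_module M K)"
    then obtain x where *: "x \<in> carrier M" "X = K +>\<^bsub>M\<^esub> x" using ex by meson
    show "quot_map N L f (r \<odot>\<^bsub>quot_module M K\<^esub> X) = r \<odot>\<^bsub>quot_module N L\<^esub> quot_map N L f X"
      unfolding *(2) p.hom_smult[OF r *(1), symmetric] tm[OF *(1)] tm[OF smult_closed[OF r *(1)]]
      by (rule q.hom_smult[OF r *(1)])
  qed
qed

end

end

section \<open>Pure tensors and functoriality of the tensor product\<close>

definition tensor_elem ::
  "('a, 'r) ring_scheme \<Rightarrow> ('a, 'b, 's) module_scheme \<Rightarrow> ('a, 'c, 't) module_scheme \<Rightarrow> 'b \<Rightarrow> 'c \<Rightarrow>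
    ('b \<times> 'c \<Rightarrow> 'a) set" where
  "tensor_elem R M N x y =
    tensor_relations R M N +>\<^bsub>free_module R (carrier M \<times> carrier N)\<^esub> free_gen R (x, y)"

locale two_modules = M: module R M + N: module R N
  for R (structure) and M (structure) and N (structure)
begin

abbreviation "L \<equiv> free_module R (carrier M \<times> carrier N)"
abbreviation "K \<equiv> tensor_relations R M N"
abbreviation "T \<equiv> tensor R M N"

sublocale L: module R L by (rule M.module_free)

lemma gen_closed [simp]: "x \<in> carrier M \<Longrightarrow> y \<in> carrier N \<Longrightarrow> free_gen R (x, y) \<in> carrier L"
  by (rule M.free_gen_closed) simp

lemma relations_least:
  assumes H: "submodule H R L"
    and 1: "\<And>x x' y. x \<in> carrier M \<Longrightarrow> x' \<in> carrier M \<Longrightarrow> y \<in> carrier N \<Longrightarrow>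
      free_gen R (x \<oplus>\<^bsub>M\<^esub> x', y) \<ominus>\<^bsub>L\<^esub> (free_gen R (x, y) \<oplus>\<^bsub>L\<^esub> free_gen R (x', y)) \<in> H"
    and 2: "\<And>x y y'. x \<in> carrier M \<Longrightarrow> y \<in> carrier N \<Longrightarrow> y' \<in> carrier N \<Longrightarrow>
      free_gen R (x, y \<oplus>\<^bsub>N\<^esub> y') \<ominus>\<^bsub>L\<^esub> (free_gen R (x, y) \<oplus>\<^bsub>L\<^esub> free_gen R (x, y')) \<in> H"
    and 3: "\<And>r x y. r \<in> carrier R \<Longrightarrow> x \<in> carrier M \<Longrightarrow> y \<in> carrier N \<Longrightarrow>
      free_gen R (r \<odot>\<^bsub>M\<^esub> x, y) \<ominus>\<^bsub>L\<^esub> r \<odot>\<^bsub>L\<^esub> free_gen R (x, y) \<in> H"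
    and 4: "\<And>r x y. r \<in> carrier R \<Longrightarrow> x \<in> carrier M \<Longrightarrow> y \<in> carrier N \<Longrightarrow>
      free_gen R (x, r \<odot>\<^bsub>N\<^esub> y) \<ominus>\<^bsub>L\<^esub> r \<odot>\<^bsub>L\<^esub> free_gen R (x, y) \<in> H"
  shows "K \<subseteq> H"
  unfolding tensor_relations_def Let_def
  by (rule L.span_least[OF H], intro Un_least subsetI; elim CollectE exE conjE; hypsubst)
    (rule 1 2 3 4; assumption)+

lemma relations:
  shows "submodule K R L"
    and "\<And>x x' y. x \<in> carrier M \<Longrightarrow> x' \<in> carrier M \<Longrightarrow> y \<in> carrier N \<Longrightarrow>
      free_gen R (x \<oplus>\<^bsub>M\<^esub> x', y) \<ominus>\<^bsub>L\<^esub> (free_gen R (x, y) \<oplus>\<^bsub>L\<^esub> free_gen R (x', y)) \<in> K"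
    and "\<And>x y y'. x \<in> carrier M \<Longrightarrow> y \<in> carrier N \<Longrightarrow> y' \<in> carrier N \<Longrightarrow>
      free_gen R (x, y \<oplus>\<^bsub>N\<^esub> y') \<ominus>\<^bsub>L\<^esub> (free_gen R (x, y) \<oplus>\<^bsub>L\<^esub> free_gen R (x, y')) \<in> K"
    and "\<And>r x y. r \<in> carrier R \<Longrightarrow> x \<in> carrier M \<Longrightarrow> y \<in> carrier N \<Longrightarrow>
      free_gen R (r \<odot>\<^bsub>M\<^esub> x, y) \<ominus>\<^bsub>L\<^esub> r \<odot>\<^bsub>L\<^esub> free_gen R (x, y) \<in> K"
    and "\<And>r x y. r \<in> carrier R \<Longrightarrow> x \<in> carrier M \<Longrightarrow> y \<in> carrier N \<Longrightarrow>
      free_gen R (x, r \<odot>\<^bsub>N\<^esub> y) \<ominus>\<^bsub>L\<^esub> r \<odot>\<^bsub>L\<^esub> free_gen R (x, y) \<in> K"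
  unfolding tensor_relations_def Let_def
proof -
  note [simp del] = free_module_simps
  show "submodule (module_span R L
      ({free_gen R (x \<oplus>\<^bsub>M\<^esub> x', y) \<ominus>\<^bsub>L\<^esub> (free_gen R (x, y) \<oplus>\<^bsub>L\<^esub> free_gen R (x', y)) | x x' y.
          x \<in> carrier M \<and> x' \<in> carrier M \<and> y \<in> carrier N}
     \<union> {free_gen R (x, y \<oplus>\<^bsub>N\<^esub> y') \<ominus>\<^bsub>L\<^esub> (free_gen R (x, y) \<oplus>\<^bsub>L\<^esub> free_gen R (x, y')) | x y y'.
          x \<in> carrier M \<and> y \<in> carrier N \<and> y' \<in> carrier N}
     \<union> {free_gen R (r \<odot>\<^bsub>M\<^esub> x, y) \<ominus>\<^bsub>L\<^esub> r \<odot>\<^bsub>L\<^esub> free_gen R (x, y) | r x y.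
          r \<in> carrier R \<and> x \<in> carrier M \<and> y \<in> carrier N}
     \<union> {free_gen R (x, r \<odot>\<^bsub>N\<^esub> y) \<ominus>\<^bsub>L\<^esub> r \<odot>\<^bsub>L\<^esub> free_gen R (x, y) | r x y.
          r \<in> carrier R \<and> x \<in> carrier M \<and> y \<in> carrier N})) R L"
    by (rule L.submodule_span) auto
qed (rule L.span_superset[THEN subsetD], blast)+

sublocale T: module R T
  unfolding tensor_def by (rule L.module_quot[OF relations(1)])

lemma tensor_elem_closed: "x \<in> carrier M \<Longrightarrow> y \<in> carrier N \<Longrightarrow> tensor_elem R M N x y \<in> carrier T"
  unfolding tensor_elem_def tensor_def
  using mod_hom.hom_closed[OF L.quot_proj_hom[OF relations(1)] gen_closed] .

text \<open>The preimage of \<open>H\<close> in the free module on pairs contains all its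
  generators.\<close>

lemma tensor_generated:
  assumes H: "submodule H R T"
    and gen: "\<And>x y. x \<in> carrier M \<Longrightarrow> y \<in> carrier N \<Longrightarrow> tensor_elem R M N x y \<in> H"
  shows "H = carrier T"
proof
  show "carrier T \<subseteq> H"
  proof
    fix t assume "t \<in> carrier T"
    then obtain c where c: "c \<in> carrier L" "t = K +>\<^bsub>L\<^esub> c"
      unfolding tensor_def quot_module_simps(1) a_rcosets_iff by blast
    interpret p: mod_hom R L T "\<lambda>c. K +>\<^bsub>L\<^esub> c"
      unfolding tensor_def by (rule L.quot_proj_hom[OF relations(1)])
    have "c \<in> {c \<in> carrier L. K +>\<^bsub>L\<^esub> c \<in> H}"
    proof (rule M.free_module_generated[OF p.submodule_preimage[OF H] _ c(1)])
      fix b assume "b \<in> carrier M \<times> carrier N"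
      then show "free_gen R b \<in> {c \<in> carrier L. K +>\<^bsub>L\<^esub> c \<in> H}"
        using gen gen_closed by (cases b) (simp add: tensor_elem_def del: free_module_simps)
    qed
    then show "t \<in> H" using c by blast
  qed
qed (rule T.submoduleE(1)[OF H])

lemma tensor_elem_add_left:
  assumes "x \<in> carrier M" "x' \<in> carrier M" "y \<in> carrier N"
  shows "tensor_elem R M N (x \<oplus>\<^bsub>M\<^esub> x') y = tensor_elem R M N x y \<oplus>\<^bsub>T\<^esub> tensor_elem R M N x' y"
proof -
  have "K +>\<^bsub>L\<^esub> free_gen R (x \<oplus>\<^bsub>M\<^esub> x', y) = K +>\<^bsub>L\<^esub> (free_gen R (x, y) \<oplus>\<^bsub>L\<^esub> free_gen R (x', y))"
    using relations(2)[OF assms] assms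
    by (subst L.coset_eq_iff[OF relations(1)]) (simp_all del: free_module_simps)
  then show ?thesis
    unfolding tensor_elem_def tensor_def using assms by (simp add: L.quot_add[OF relations(1)] del: free_module_simps)
qed

lemma tensor_elem_smult_left:
  assumes "r \<in> carrier R" "x \<in> carrier M" "y \<in> carrier N"
  shows "tensor_elem R M N (r \<odot>\<^bsub>M\<^esub> x) y = r \<odot>\<^bsub>T\<^esub> tensor_elem R M N x y"
proof -
  have "K +>\<^bsub>L\<^esub> free_gen R (r \<odot>\<^bsub>M\<^esub> x, y) = K +>\<^bsub>L\<^esub> (r \<odot>\<^bsub>L\<^esub> free_gen R (x, y))"
    using relations(4)[OF assms] assms
    by (subst L.coset_eq_iff[OF relations(1)]) (simp_all del: free_module_simps)
  then show ?thesis
    unfolding tensor_elem_def tensor_def using assms by (simp add: L.quot_smult[OF relations(1)] del: free_module_simps)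
qed

lemma tensor_elem_smult_right:
  assumes "r \<in> carrier R" "x \<in> carrier M" "y \<in> carrier N"
  shows "tensor_elem R M N x (r \<odot>\<^bsub>N\<^esub> y) = r \<odot>\<^bsub>T\<^esub> tensor_elem R M N x y"
proof -
  have "K +>\<^bsub>L\<^esub> free_gen R (x, r \<odot>\<^bsub>N\<^esub> y) = K +>\<^bsub>L\<^esub> (r \<odot>\<^bsub>L\<^esub> free_gen R (x, y))"
    using relations(5)[OF assms] assms
    by (subst L.coset_eq_iff[OF relations(1)]) (simp_all del: free_module_simps)
  then show ?thesis
    unfolding tensor_elem_def tensor_def using assms by (simp add: L.quot_smult[OF relations(1)] del: free_module_simps)
qed

lemma tensor_elem_zero_right:
  assumes "x \<in> carrier M"
  shows "tensor_elem R M N x \<zero>\<^bsub>N\<^esub> = \<zero>\<^bsub>T\<^esub>"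
  using tensor_elem_smult_right[OF M.R.zero_closed assms N.M.zero_closed]
    tensor_elem_closed[OF assms N.M.zero_closed] by simp

end

text \<open>Since \<open>f\<close> and \<open>g\<close> are linear, the extension \<open>?h\<close>
  takes each defining relation of the source to a defining relation of the target, so it descends to
  the quotients.\<close>

lemma tensor_map_hom:
  assumes f: "mod_hom R M M' f" and g: "mod_hom R N N' g"
  shows "mod_hom R (tensor R M N) (tensor R M' N') (tensor_map R M' N' f g)"
    and "\<And>x y. x \<in> carrier M \<Longrightarrow> y \<in> carrier N \<Longrightarrow>
      tensor_map R M' N' f g (tensor_elem R M N x y) = tensor_elem R M' N' (f x) (g y)"
proof -
  interpret f: mod_hom R M M' f by fact
  interpret g: mod_hom R N N' g by fact
  interpret A: two_modules R M N by unfold_locales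
  interpret B: two_modules R M' N' by unfold_locales
  let ?h = "lin_ext R B.L (\<lambda>(x, y). free_gen R (f x, g y))"
  have h: "(\<lambda>(x, y). free_gen R (f x, g y)) \<in> carrier M \<times> carrier N \<rightarrow> carrier B.L"
    by (auto simp del: free_module_simps)
  interpret h: mod_hom R A.L B.L ?h by (rule B.L.lin_ext_hom[OF h])
  have hg: "?h (free_gen R (x, y)) = free_gen R (f x, g y)" if "x \<in> carrier M" "y \<in> carrier N" for x y
    using B.L.lin_ext_gen[OF h, of "(x, y)"] that by simp
  have "A.K \<subseteq> {c \<in> carrier A.L. ?h c \<in> B.K}"
    by (rule A.relations_least[OF h.submodule_preimage[OF B.relations(1)]])
      (simp_all add: hg B.relations del: free_module_simps)
  then have hK: "?h k \<in> B.K" if "k \<in> A.K" for k using that by blast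
  show "mod_hom R A.T B.T (tensor_map R M' N' f g)"
    unfolding tensor_def tensor_map_def Let_def
    by (rule A.L.quot_map_hom[OF A.relations(1) h.mod_hom_axioms B.relations(1) hK])
  show "tensor_map R M' N' f g (tensor_elem R M N x y) = tensor_elem R M' N' (f x) (g y)"
    if "x \<in> carrier M" "y \<in> carrier N" for x y
    unfolding tensor_elem_def tensor_map_def Let_def
    using A.L.quot_map_coset[OF A.relations(1) _ h.mod_hom_axioms B.relations(1) hK] that
    by (simp add: hg del: free_module_simps)
qed

section \<open>Tensoring with R/I as reduction modulo I\<close>

lemma self_module_minus: "x \<ominus>\<^bsub>self_module R\<^esub> y = x \<ominus>\<^bsub>R\<^esub> y"
  by (simp add: a_minus_def a_inv_def m_inv_def)

text \<open>\<open>power_quotient\<close> with an arbitrary ideal in place of the power, so that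
  both powers occurring in \<open>\<nu>\<close> are treated alike.\<close>

definition ring_quot :: "('a, 'r) ring_scheme \<Rightarrow> 'a set \<Rightarrow> ('a, 'a set) module" where
  "ring_quot R I = quot_module (self_module R) I"

definition ring_class :: "('a, 'r) ring_scheme \<Rightarrow> 'a set \<Rightarrow> 'a \<Rightarrow> 'a set" where
  "ring_class R I r = I +>\<^bsub>self_module R\<^esub> r"

context cring
begin

lemma module_ring_quot: "ideal I R \<Longrightarrow> module R (ring_quot R I)"
  unfolding ring_quot_def
  by (intro module.module_quot module_self) (simp add: submodule_self_iff_ideal)

lemma ring_class_hom: "ideal I R \<Longrightarrow> mod_hom R (self_module R) (ring_quot R I) (ring_class R I)"
  unfolding ring_quot_def ring_class_def
  by (intro module.quot_proj_hom module_self) (simp add: submodule_self_iff_ideal)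

lemma ring_quot_cases: "X \<in> carrier (ring_quot R I) \<Longrightarrow> \<exists>r\<in>carrier R. X = ring_class R I r"
  by (simp add: ring_quot_def ring_class_def quot_module_simps a_rcosets_iff)

lemma ring_class_eq_iff:
  "ideal I R \<Longrightarrow> r \<in> carrier R \<Longrightarrow> s \<in> carrier R \<Longrightarrow>
    ring_class R I r = ring_class R I s \<longleftrightarrow> r \<ominus>\<^bsub>self_module R\<^esub> s \<in> I"
  unfolding ring_class_def
  using module.coset_eq_iff[OF module_self, of I r s] by (simp add: submodule_self_iff_ideal)

end

text \<open>The map from M to the tensor product of M and R/I that sends x to x \<otimes> 1. It
  stands in for the isomorphism of M/IM with that tensor product, so that homology can be computed
  with elements of M.\<close>

definition reduction ::
  "('a, 'r) ring_scheme \<Rightarrow> 'a set \<Rightarrow> ('a, 'b, 's) module_scheme \<Rightarrow> 'b \<Rightarrow> ('b \<times> 'a set \<Rightarrow> 'a) set" where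
  "reduction R I M x = tensor_elem R M (ring_quot R I) x (ring_class R I \<one>\<^bsub>R\<^esub>)"

text \<open>Surjectivity holds because the pure tensor of x and the class of s equals s x \<otimes>
  1. An element of I has class zero, so I M is killed; that nothing else is killed needs a map out
  of the tensor product.\<close>

lemma (in module) reduction:
  assumes I: "ideal I R"
  shows "mod_hom R M (tensor R M (ring_quot R I)) (reduction R I M)"
    and "reduction R I M ` carrier M = carrier (tensor R M (ring_quot R I))"
    and "\<And>x. x \<in> carrier M \<Longrightarrow>
      reduction R I M x = \<zero>\<^bsub>tensor R M (ring_quot R I)\<^esub> \<longleftrightarrow> x \<in> ideal_smult R I M"
proof -
  let ?Q = "ring_quot R I" and ?c = "ring_class R I"
  interpret c: mod_hom R "self_module R" ?Q ?c by (rule ring_class_hom[OF I])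
  interpret A: two_modules R M ?Q by unfold_locales
  have c1: "?c \<one> \<in> carrier ?Q" by (rule c.hom_closed) simp
  have cr: "?c r = r \<odot>\<^bsub>?Q\<^esub> ?c \<one>" if "r \<in> carrier R" for r using c.hom_smult[of r \<one>] that by simp
  have Ic: "I \<subseteq> carrier R" using ideal.Icarr[OF I] by blast
  show hom: "mod_hom R M A.T (reduction R I M)"
    by (unfold_locales, unfold module_homs_def reduction_def)
      (use c1 in \<open>auto simp: A.tensor_elem_closed A.tensor_elem_add_left A.tensor_elem_smult_left\<close>)
  interpret r: mod_hom R M A.T "reduction R I M" by (rule hom)
  have elem: "tensor_elem R M ?Q x (?c s) = reduction R I M (s \<odot>\<^bsub>M\<^esub> x)"
    if "x \<in> carrier M" "s \<in> carrier R" for x s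
    unfolding cr[OF that(2)] reduction_def
    using that c1 by (simp add: A.tensor_elem_smult_right A.tensor_elem_smult_left)
  show "reduction R I M ` carrier M = carrier A.T"
  proof (rule A.tensor_generated[OF r.submodule_image[OF carrier_is_submodule]])
    fix x y assume x: "x \<in> carrier M" and "y \<in> carrier ?Q"
    then obtain s where "s \<in> carrier R" "y = ?c s" using ring_quot_cases by blast
    then show "tensor_elem R M ?Q x y \<in> reduction R I M ` carrier M" using elem[OF x] x by (simp del: r.hom_smult)
  qed
  show "reduction R I M x = \<zero>\<^bsub>A.T\<^esub> \<longleftrightarrow> x \<in> ideal_smult R I M" if x: "x \<in> carrier M" for x
  proof
    assume "x \<in> ideal_smult R I M"
    moreover have "ideal_smult R I M \<subseteq> {x \<in> carrier M. reduction R I M x = \<zero>\<^bsub>A.T\<^esub>}"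
    proof (rule ideal_smult_least[OF r.submodule_kernel])
      fix a y assume a: "a \<in> I" and y: "y \<in> carrier M"
      have a': "a \<in> carrier R" using a Ic by blast
      interpret S: module R "self_module R" by (rule module_self)
      have "?c a = ?c \<zero>"
        using ring_class_eq_iff[OF I a' R.zero_closed] a a' unfolding self_module_minus by (simp add: a_minus_def)
      then have "?c a = \<zero>\<^bsub>?Q\<^esub>" using c.hom_zero by simp
      then have "reduction R I M (a \<odot>\<^bsub>M\<^esub> y) = \<zero>\<^bsub>A.T\<^esub>"
        using elem[OF y a'] A.tensor_elem_zero_right[OF y] by simp
      then show "a \<odot>\<^bsub>M\<^esub> y \<in> {x \<in> carrier M. reduction R I M x = \<zero>\<^bsub>A.T\<^esub>}" using a' y by simp
    qed
    ultimately show "reduction R I M x = \<zero>\<^bsub>A.T\<^esub>" by blast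
  next
    assume x0: "reduction R I M x = \<zero>\<^bsub>A.T\<^esub>"
    note sub = submodule_ideal_smult[OF Ic]
    \<comment> \<open>Sending \<open>(x, X)\<close> to \<open>rep X\<close> times \<open>x\<close> is bilinear only modulo \<open>I M\<close>; so instead of descending to
      the tensor product one checks that its linear extension maps the relations into \<open>I M\<close>.\<close>
    define rep where "rep X = (SOME s. s \<in> carrier R \<and> X = ?c s)" for X
    have rep: "rep X \<in> carrier R" "X = ?c (rep X)" if "X \<in> carrier ?Q" for X
      using someI_ex[of "\<lambda>s. s \<in> carrier R \<and> X = ?c s"] ring_quot_cases[OF that] unfolding rep_def by auto
    have rep_eq: "r \<odot>\<^bsub>M\<^esub> y \<ominus>\<^bsub>M\<^esub> s \<odot>\<^bsub>M\<^esub> y \<in> ideal_smult R I M"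
      if "r \<in> carrier R" "s \<in> carrier R" "?c r = ?c s" "y \<in> carrier M" for r s y
    proof -
      interpret S: module R "self_module R" by (rule module_self)
      interpret h: mod_hom R "self_module R" M "\<lambda>r. r \<odot>\<^bsub>M\<^esub> y" by (rule mult_hom[OF that(4)])
      have "r \<ominus>\<^bsub>self_module R\<^esub> s \<in> I" using ring_class_eq_iff[OF I that(1,2)] that(3) by simp
      then have "(r \<ominus>\<^bsub>self_module R\<^esub> s) \<odot>\<^bsub>M\<^esub> y \<in> ideal_smult R I M" by (rule ideal_smultI[OF _ that(4)])
      then show ?thesis using h.hom_minus[of r s] that by simp
    qed
    let ?g = "\<lambda>(x, X). rep X \<odot>\<^bsub>M\<^esub> x"
    let ?h = "lin_ext R M ?g"
    have g: "?g \<in> carrier M \<times> carrier ?Q \<rightarrow> carrier M" using rep by auto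
    interpret h: mod_hom R A.L M ?h by (rule lin_ext_hom[OF g])
    have hg: "?h (free_gen R (x, X)) = rep X \<odot>\<^bsub>M\<^esub> x" if "x \<in> carrier M" "X \<in> carrier ?Q" for x X
      using lin_ext_gen[OF g, of "(x, X)"] that by simp
    have "A.K \<subseteq> {c \<in> carrier A.L. ?h c \<in> ideal_smult R I M}"
    proof (rule A.relations_least[OF h.submodule_preimage[OF sub]])
      fix x x' y assume *: "x \<in> carrier M" "x' \<in> carrier M" "y \<in> carrier ?Q"
      have "?h (free_gen R (x \<oplus>\<^bsub>M\<^esub> x', y) \<ominus>\<^bsub>A.L\<^esub> (free_gen R (x, y) \<oplus>\<^bsub>A.L\<^esub> free_gen R (x', y))) = \<zero>\<^bsub>M\<^esub>"
        using * rep(1)[OF *(3)] by (simp add: hg smult_r_distr M.minus_eq_zero_iff del: free_module_simps)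
      then show "free_gen R (x \<oplus>\<^bsub>M\<^esub> x', y) \<ominus>\<^bsub>A.L\<^esub> (free_gen R (x, y) \<oplus>\<^bsub>A.L\<^esub> free_gen R (x', y))
          \<in> {c \<in> carrier A.L. ?h c \<in> ideal_smult R I M}"
        using * submodule_zero[OF sub] by (simp del: free_module_simps)
    next
      fix x y y' assume *: "x \<in> carrier M" "y \<in> carrier ?Q" "y' \<in> carrier ?Q"
      note r = rep[OF *(2)] rep[OF *(3)] rep[OF c.N.M.a_closed[OF *(2,3)]]
      have "?c (rep (y \<oplus>\<^bsub>?Q\<^esub> y')) = ?c (rep y \<oplus> rep y')"
        using r c.hom_add[of "rep y" "rep y'"] by simp
      then have "?h (free_gen R (x, y \<oplus>\<^bsub>?Q\<^esub> y') \<ominus>\<^bsub>A.L\<^esub> (free_gen R (x, y) \<oplus>\<^bsub>A.L\<^esub> free_gen R (x, y')))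
          \<in> ideal_smult R I M"
        using rep_eq[of "rep (y \<oplus>\<^bsub>?Q\<^esub> y')" "rep y \<oplus> rep y'" x] * r(1,3,5)
        by (simp add: hg smult_l_distr del: free_module_simps)
      then show "free_gen R (x, y \<oplus>\<^bsub>?Q\<^esub> y') \<ominus>\<^bsub>A.L\<^esub> (free_gen R (x, y) \<oplus>\<^bsub>A.L\<^esub> free_gen R (x, y'))
          \<in> {c \<in> carrier A.L. ?h c \<in> ideal_smult R I M}"
        using * by (simp del: free_module_simps)
    next
      fix r x y assume *: "r \<in> carrier R" "x \<in> carrier M" "y \<in> carrier ?Q"
      have "?h (free_gen R (r \<odot>\<^bsub>M\<^esub> x, y) \<ominus>\<^bsub>A.L\<^esub> r \<odot>\<^bsub>A.L\<^esub> free_gen R (x, y)) = \<zero>\<^bsub>M\<^esub>"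
        using * rep(1)[OF *(3)]
        by (simp add: hg smult_assoc1[symmetric] R.m_comm M.minus_eq_zero_iff del: free_module_simps)
      then show "free_gen R (r \<odot>\<^bsub>M\<^esub> x, y) \<ominus>\<^bsub>A.L\<^esub> r \<odot>\<^bsub>A.L\<^esub> free_gen R (x, y)
          \<in> {c \<in> carrier A.L. ?h c \<in> ideal_smult R I M}"
        using * submodule_zero[OF sub] by (simp del: free_module_simps)
    next
      fix r x y assume *: "r \<in> carrier R" "x \<in> carrier M" "y \<in> carrier ?Q"
      note s = rep[OF *(3)] rep[OF c.N.smult_closed[OF *(1,3)]]
      have "?c (rep (r \<odot>\<^bsub>?Q\<^esub> y)) = ?c (r \<otimes> rep y)"
        using s c.hom_smult[of r "rep y"] * by simp
      then have "?h (free_gen R (x, r \<odot>\<^bsub>?Q\<^esub> y) \<ominus>\<^bsub>A.L\<^esub> r \<odot>\<^bsub>A.L\<^esub> free_gen R (x, y)) \<in> ideal_smult R I M"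
        using rep_eq[of "rep (r \<odot>\<^bsub>?Q\<^esub> y)" "r \<otimes> rep y" x] * s(1,3)
        by (simp add: hg smult_assoc1 del: free_module_simps)
      then show "free_gen R (x, r \<odot>\<^bsub>?Q\<^esub> y) \<ominus>\<^bsub>A.L\<^esub> r \<odot>\<^bsub>A.L\<^esub> free_gen R (x, y)
          \<in> {c \<in> carrier A.L. ?h c \<in> ideal_smult R I M}"
        using * by (simp del: free_module_simps)
    qed
    moreover have "free_gen R (x, ?c \<one>) \<in> A.K"
      using x0 A.L.coset_eq_iff_mem[OF A.relations(1) A.gen_closed[OF x c1]]
      unfolding reduction_def tensor_elem_def tensor_def quot_module_simps by simp
    ultimately have "rep (?c \<one>) \<odot>\<^bsub>M\<^esub> x \<in> ideal_smult R I M" using hg[OF x c1] by fastforce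
    \<comment> \<open>The chosen representative of the class of \<open>\<one>\<close> need not be
      \<open>\<one>\<close> itself; the two differ by an element of I.\<close>
    moreover have "\<one> \<odot>\<^bsub>M\<^esub> x \<ominus>\<^bsub>M\<^esub> rep (?c \<one>) \<odot>\<^bsub>M\<^esub> x \<in> ideal_smult R I M"
      using rep_eq[OF R.one_closed rep(1)[OF c1] rep(2)[OF c1] x] .
    ultimately have "(x \<ominus>\<^bsub>M\<^esub> rep (?c \<one>) \<odot>\<^bsub>M\<^esub> x) \<oplus>\<^bsub>M\<^esub> rep (?c \<one>) \<odot>\<^bsub>M\<^esub> x \<in> ideal_smult R I M"
      using submoduleE(5)[OF sub] x by simp
    then show "x \<in> ideal_smult R I M"
      using x rep(1)[OF c1] by (simp add: a_minus_def M.a_assoc M.l_neg)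
  qed
qed

section \<open>Comparison of free resolutions\<close>

definition nu_criterion ::
  "('a, 'r) ring_scheme \<Rightarrow> 'a set \<Rightarrow> ('a, 'f) chain_complex \<Rightarrow> nat \<Rightarrow> nat \<Rightarrow> bool" where
  "nu_criterion R m F n i \<longleftrightarrow> (\<forall>x\<in>carrier (cmod F i).
     cdiff F i x \<in> ideal_smult R (ideal_pow R m (n + 1)) (cmod F (i - 1)) \<longrightarrow>
     (\<exists>y\<in>carrier (cmod F (Suc i)).
        x \<ominus>\<^bsub>cmod F i\<^esub> cdiff F (Suc i) y \<in> ideal_smult R (ideal_pow R m n) (cmod F i)))"

context noetherian_local
begin

text \<open>By \<open>reduction\<close>, every element of the tensor complex comes from some x in F.
  Cycles modulo \<open>m\<^sup>n\<^sup>+\<^sup>1\<close> come from the x with d x in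
  \<open>m\<^sup>n\<^sup>+\<^sup>1F\<close>, boundaries come from boundaries of F, and the induced
  map takes the class of x to the class of the same x modulo \<open>m\<^sup>n\<close>.\<close>

lemma nu_vanishes_iff:
  fixes M :: "('a, 'c, 's) module_scheme"
  defines "F \<equiv> some_free_resolution R M"
  assumes hom: "\<And>j. j > 0 \<Longrightarrow> mod_hom R (cmod F j) (cmod F (j - 1)) (cdiff F j)" and i: "i > 0"
  shows "nu_vanishes R m n i M \<longleftrightarrow> nu_criterion R m F n i"
proof -
  let ?A = "ideal_pow R m (n + 1)" and ?B = "ideal_pow R m n"
  have A: "ideal ?A R" and B: "ideal ?B R" and AB: "?A \<subseteq> ?B"
    using ideal_pow_ideal[OF ideal_m] ideal_pow_antimono[OF ideal_m] by (simp_all del: ideal_pow.simps)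
  let ?Q = "ring_quot R ?A" and ?Q' = "ring_quot R ?B"
  let ?X = "cmod F i" and ?Y = "cmod F (Suc i)" and ?W = "cmod F (i - 1)"
  let ?d = "cdiff F i" and ?d' = "cdiff F (Suc i)"
  interpret d: mod_hom R ?X ?W ?d by (rule hom[OF i])
  interpret d': mod_hom R ?Y ?X ?d' using hom[of "Suc i"] by simp
  have Q: "module R ?Q" and Q': "module R ?Q'" using module_ring_quot A B by blast+
  interpret S: module R "self_module R" by (rule module_self)
  let ?\<pi> = "power_quotient_map R m n"
  have AS: "submodule ?A R (self_module R)" and BS: "submodule ?B R (self_module R)"
    using A B by (simp_all add: submodule_self_iff_ideal)
  have \<pi>: "mod_hom R ?Q ?Q' ?\<pi>"
    unfolding power_quotient_map_def ring_quot_def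
    by (rule S.quot_map_hom[OF AS mod_hom_id[OF module_self] BS]) (use AB in blast)
  have \<pi>1: "?\<pi> (ring_class R ?A \<one>) = ring_class R ?B \<one>"
    unfolding power_quotient_map_def ring_class_def
    by (rule S.quot_map_coset[OF AS _ mod_hom_id[OF module_self] BS]) (use AB in auto)
  have one: "ring_class R I \<one> \<in> carrier (ring_quot R I)" if "ideal I R" for I
    using mod_hom.hom_closed[OF ring_class_hom[OF that], of \<one>] by simp
  let ?a = "reduction R ?A ?X" and ?a' = "reduction R ?B ?X"
  let ?T = "tensor R ?X ?Q" and ?T' = "tensor R ?X ?Q'"
  interpret a: mod_hom R ?X ?T ?a by (rule d.M.reduction(1)[OF A])
  interpret a': mod_hom R ?X ?T' ?a' by (rule d.M.reduction(1)[OF B])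
  have tm_red: "tensor_map R N (ring_quot R I) f (\<lambda>y. y) (reduction R I P x) = reduction R I N (f x)"
    if "mod_hom R P N f" "ideal I R" "x \<in> carrier P" for P N :: "('a, nat \<Rightarrow> 'a) module" and f I x
    unfolding reduction_def using tensor_map_hom(2)[OF that(1) mod_hom_id[OF module_ring_quot[OF that(2)]] that(3) one[OF that(2)]] .
  let ?P = "tensor_map R ?X ?Q' (\<lambda>x. x) ?\<pi>"
  interpret P: mod_hom R ?T ?T' ?P by (rule tensor_map_hom(1)[OF mod_hom_id[OF d.M.module_axioms] \<pi>])
  have Pa: "?P (?a x) = ?a' x" if "x \<in> carrier ?X" for x
    unfolding reduction_def
    using tensor_map_hom(2)[OF mod_hom_id[OF d.M.module_axioms] \<pi> that one[OF A]] \<pi>1 by simp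
  have tm: "mod_hom R (tensor R N (ring_quot R I)) (tensor R N' (ring_quot R I)) (tensor_map R N' (ring_quot R I) f (\<lambda>y. y))"
    if "mod_hom R N N' f" "ideal I R" for N N' :: "('a, nat \<Rightarrow> 'a) module" and f I
    by (rule tensor_map_hom(1)[OF that(1) mod_hom_id[OF module_ring_quot[OF that(2)]]])
  let ?C = "tensor_complex R F ?Q" and ?C' = "tensor_complex R F ?Q'"
  have bd: "boundaries (tensor_complex R F (ring_quot R I)) i = (\<lambda>y. reduction R I ?X (?d' y)) ` carrier ?Y"
    and sbd: "submodule (boundaries (tensor_complex R F (ring_quot R I)) i) R (tensor R ?X (ring_quot R I))"
    if I: "ideal I R" for I
  proof -
    have *: "boundaries (tensor_complex R F (ring_quot R I)) i =
        tensor_map R ?X (ring_quot R I) ?d' (\<lambda>y. y) ` carrier (tensor R ?Y (ring_quot R I))"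
      by (simp add: boundaries_def tensor_complex_def)
    also have "\<dots> = tensor_map R ?X (ring_quot R I) ?d' (\<lambda>y. y) ` reduction R I ?Y ` carrier ?Y"
      using d'.M.reduction(2)[OF I] by simp
    also have "\<dots> = (\<lambda>y. reduction R I ?X (?d' y)) ` carrier ?Y"
      unfolding image_image by (rule image_cong[OF refl]) (rule tm_red[OF d'.mod_hom_axioms I])
    finally show "boundaries (tensor_complex R F (ring_quot R I)) i = (\<lambda>y. reduction R I ?X (?d' y)) ` carrier ?Y" .
    interpret t: mod_hom R "tensor R ?Y (ring_quot R I)" "tensor R ?X (ring_quot R I)"
        "tensor_map R ?X (ring_quot R I) ?d' (\<lambda>y. y)"
      by (rule tm[OF d'.mod_hom_axioms I])
    show "submodule (boundaries (tensor_complex R F (ring_quot R I)) i) R (tensor R ?X (ring_quot R I))"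
      unfolding * by (rule t.submodule_image[OF t.M.carrier_is_submodule])
  qed
  let ?Bd = "boundaries ?C i" and ?Bd' = "boundaries ?C' i"
  have cyc: "cycles ?C i = ?a ` {x \<in> carrier ?X. ?d x \<in> ideal_smult R ?A ?W}"
  proof -
    have "cycles ?C i = {t \<in> ?a ` carrier ?X. tensor_map R ?W ?Q ?d (\<lambda>y. y) t = \<zero>\<^bsub>tensor R ?W ?Q\<^esub>}"
      using i d.M.reduction(2)[OF A] by (simp add: cycles_def tensor_complex_def)
    also have "\<dots> = ?a ` {x \<in> carrier ?X. tensor_map R ?W ?Q ?d (\<lambda>y. y) (?a x) = \<zero>\<^bsub>tensor R ?W ?Q\<^esub>}"
      by blast
    also have "{x \<in> carrier ?X. tensor_map R ?W ?Q ?d (\<lambda>y. y) (?a x) = \<zero>\<^bsub>tensor R ?W ?Q\<^esub>} =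
        {x \<in> carrier ?X. ?d x \<in> ideal_smult R ?A ?W}"
      by (intro Collect_cong conj_cong refl)
        (simp only: tm_red[OF d.mod_hom_axioms A] d.N.reduction(3)[OF A d.hom_closed])
    finally show ?thesis .
  qed
  \<comment> \<open>Boundaries go to boundaries; this is what allows \<open>quot_map\<close> to be
    evaluated on a single representative in the definition of \<open>nu\<close>.\<close>
  have PBd: "?P t \<in> ?Bd'" if t: "t \<in> ?Bd" for t
  proof -
    obtain y where y: "y \<in> carrier ?Y" "t = ?a (?d' y)" using t unfolding bd[OF A] by (elim imageE)
    show ?thesis unfolding bd[OF B] y(2) Pa[OF d'.hom_closed[OF y(1)]] using y(1) by (rule imageI)
  qed
  have nu: "nu R m n i M (?Bd +>\<^bsub>?T\<^esub> ?a x) = ?Bd' +>\<^bsub>?T'\<^esub> ?a' x" if x: "x \<in> carrier ?X" for x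
  proof -
    have "nu R m n i M = quot_map ?T' ?Bd' ?P"
      unfolding nu_def Tor_map_def Let_def F_def[symmetric] by (simp add: tensor_complex_def power_quotient_def ring_quot_def)
    then show ?thesis
      using a.N.quot_map_coset[OF sbd[OF A] a.hom_closed[OF x] P.mod_hom_axioms sbd[OF B] PBd] Pa[OF x] by simp
  qed
  have tor: "carrier (Tor R i M (power_quotient R m (n + 1))) =
      (\<lambda>x. ?Bd +>\<^bsub>?T\<^esub> ?a x) ` {x \<in> carrier ?X. ?d x \<in> ideal_smult R ?A ?W}"
  proof -
    have "carrier (Tor R i M (power_quotient R m (n + 1))) = (\<lambda>t. ?Bd +>\<^bsub>?T\<^esub> t) ` cycles ?C i"
      unfolding Tor_def homology_def F_def[symmetric] power_quotient_def ring_quot_def[symmetric] quot_module_simps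
      by (auto simp: A_RCOSETS_def' a_r_coset_def r_coset_def tensor_complex_def)
    then show ?thesis unfolding cyc image_image .
  qed
  have tor0: "\<zero>\<^bsub>Tor R i M (power_quotient R m n)\<^esub> = ?Bd'"
    unfolding Tor_def homology_def F_def[symmetric] power_quotient_def ring_quot_def[symmetric] quot_module_simps ..
  have mem: "?Bd' +>\<^bsub>?T'\<^esub> ?a' x = ?Bd' \<longleftrightarrow> (\<exists>y\<in>carrier ?Y. x \<ominus>\<^bsub>?X\<^esub> ?d' y \<in> ideal_smult R ?B ?X)"
    if x: "x \<in> carrier ?X" for x
  proof -
    have "?Bd' +>\<^bsub>?T'\<^esub> ?a' x = ?Bd' \<longleftrightarrow> ?a' x \<in> ?Bd'"
      by (rule a'.N.coset_eq_iff_mem[OF sbd[OF B] a'.hom_closed[OF x]])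
    also have "\<dots> \<longleftrightarrow> (\<exists>y\<in>carrier ?Y. ?a' x = ?a' (?d' y))" unfolding bd[OF B] by blast
    also have "\<dots> \<longleftrightarrow> (\<exists>y\<in>carrier ?Y. ?a' (x \<ominus>\<^bsub>?X\<^esub> ?d' y) = \<zero>\<^bsub>?T'\<^esub>)"
      using x by (simp add: a'.N.M.minus_eq_zero_iff)
    also have "\<dots> \<longleftrightarrow> (\<exists>y\<in>carrier ?Y. x \<ominus>\<^bsub>?X\<^esub> ?d' y \<in> ideal_smult R ?B ?X)"
      by (intro bex_cong refl d.M.reduction(3)[OF B] d.M.M.minus_closed x d'.hom_closed)
    finally show ?thesis .
  qed
  show ?thesis
    unfolding nu_vanishes_def nu_criterion_def tor tor0 ball_simps(9) using nu mem by auto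
qed

end

section \<open>Comparison theorem: chain maps and homotopies\<close>

lemma free_resolution_hom:
  assumes "free_resolution R M F" "i > 0"
  shows "mod_hom R (cmod F i) (cmod F (i - 1)) (cdiff F i)"
  using assms unfolding free_resolution_def is_free_module_def mod_hom_def mod_hom_axioms_def by blast

lemma free_resolution_hom_Suc:
  assumes "free_resolution R M F"
  shows "mod_hom R (cmod F (Suc i)) (cmod F i) (cdiff F (Suc i))"
  using free_resolution_hom[OF assms, of "Suc i"] by simp

lemma free_resolution_free: "free_resolution R M F \<Longrightarrow> is_free_module R (cmod F i)"
  by (simp add: free_resolution_def)

lemma free_resolution_module: "free_resolution R M F \<Longrightarrow> module R (cmod F i)"
  by (simp add: free_resolution_def is_free_module_def)

lemma free_resolution_exact:
  assumes "free_resolution R M F"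
  shows "x \<in> boundaries F (Suc i) \<longleftrightarrow> x \<in> carrier (cmod F (Suc i)) \<and> cdiff F (Suc i) x = \<zero>\<^bsub>cmod F i\<^esub>"
proof -
  have "boundaries F (Suc i) = cycles F (Suc i)" using assms by (simp add: free_resolution_def)
  then show ?thesis by (simp add: cycles_def)
qed

text \<open>\<open>free_resolution\<close> only asserts that such a map exists. Chain maps lift the
  identity of \<open>M\<close> relative to two particular augmentations, so these have to be
  named.\<close>

definition augmentation ::
  "('a, 'r) ring_scheme \<Rightarrow> ('a, 'b, 's) module_scheme \<Rightarrow> ('a, 'f) chain_complex \<Rightarrow> ('f \<Rightarrow> 'b) \<Rightarrow> bool" where
  "augmentation R M F e \<longleftrightarrow> mod_hom R (cmod F 0) M e \<and> e ` carrier (cmod F 0) = carrier M \<and>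
     {x \<in> carrier (cmod F 0). e x = \<zero>\<^bsub>M\<^esub>} = boundaries F 0"

lemma augmentation_exists:
  assumes "free_resolution R M F" "module R M"
  shows "\<exists>e. augmentation R M F e"
proof -
  have "module R (cmod F 0)" by (rule free_resolution_module[OF assms(1)])
  moreover obtain e where "e \<in> module_homs R (cmod F 0) M" "e ` carrier (cmod F 0) = carrier M"
      "{x \<in> carrier (cmod F 0). e x = \<zero>\<^bsub>M\<^esub>} = boundaries F 0"
    using assms(1) unfolding free_resolution_def by (elim conjE bexE)
  ultimately have "augmentation R M F e"
    using assms(2) by (simp add: augmentation_def mod_hom_def mod_hom_axioms_def)
  then show ?thesis by blast
qed

definition chain_map ::
  "('a, 'r) ring_scheme \<Rightarrow> ('a, 'f) chain_complex \<Rightarrow> ('a, 'g) chain_complex \<Rightarrow> (nat \<Rightarrow> 'f \<Rightarrow> 'g) \<Rightarrow> bool" where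
  "chain_map R F G \<phi> \<longleftrightarrow> (\<forall>i. mod_hom R (cmod F i) (cmod G i) (\<phi> i)) \<and>
     (\<forall>i. \<forall>x\<in>carrier (cmod F (Suc i)). cdiff G (Suc i) (\<phi> (Suc i) x) = \<phi> i (cdiff F (Suc i) x))"

text \<open>Each component lifts the previous one along the differential of \<open>G\<close>, since
  the source is free and the image of the map to be lifted consists of boundaries.\<close>

lemma chain_map_exists:
  assumes F: "free_resolution R M F" "augmentation R M F e" and G: "free_resolution R M G" "augmentation R M G e'"
  shows "\<exists>\<phi>. chain_map R F G \<phi> \<and> (\<forall>x\<in>carrier (cmod F 0). e' (\<phi> 0 x) = e x)"
proof -
  \<comment> \<open>The invariant of the recursion is that boundaries go to boundaries. In degree 0
    it follows from the augmentations and afterwards from exactness, and the step needs nothing else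
    about \<open>\<phi>\<close>.\<close>
  let ?P = "\<lambda>i \<phi>. mod_hom R (cmod F i) (cmod G i) \<phi> \<and> (\<forall>x\<in>boundaries F i. \<phi> x \<in> boundaries G i) \<and>
    (i = 0 \<longrightarrow> (\<forall>x\<in>carrier (cmod F 0). e' (\<phi> x) = e x))"
  let ?Q = "\<lambda>i \<phi> \<psi>. \<forall>x\<in>carrier (cmod F (Suc i)). cdiff G (Suc i) (\<psi> x) = \<phi> (cdiff F (Suc i) x)"
  have "\<exists>\<phi>. ?P 0 \<phi>"
  proof -
    have "\<exists>\<phi>. mod_hom R (cmod F 0) (cmod G 0) \<phi> \<and> (\<forall>x\<in>carrier (cmod F 0). e' (\<phi> x) = e x)"
      using F G by (intro free_module_lift[where N = M] free_resolution_free) (auto simp: augmentation_def)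
    then obtain \<phi> where \<phi>: "mod_hom R (cmod F 0) (cmod G 0) \<phi>" "\<forall>x\<in>carrier (cmod F 0). e' (\<phi> x) = e x" by blast
    have "\<phi> x \<in> boundaries G 0" if "x \<in> boundaries F 0" for x
    proof -
      have x: "x \<in> carrier (cmod F 0)" "e x = \<zero>\<^bsub>M\<^esub>" using that F(2) by (auto simp: augmentation_def)
      then have "\<phi> x \<in> {x \<in> carrier (cmod G 0). e' x = \<zero>\<^bsub>M\<^esub>}" using \<phi> mod_hom.hom_closed[OF \<phi>(1)] by simp
      then show ?thesis using G(2) unfolding augmentation_def by blast
    qed
    then show ?thesis using \<phi> by blast
  qed
  moreover have "\<exists>\<psi>. ?P (Suc i) \<psi> \<and> ?Q i \<phi> \<psi>" if P: "?P i \<phi>" for i \<phi>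
  proof -
    interpret dF: mod_hom R "cmod F (Suc i)" "cmod F i" "cdiff F (Suc i)" by (rule free_resolution_hom_Suc[OF F(1)])
    interpret dG: mod_hom R "cmod G (Suc i)" "cmod G i" "cdiff G (Suc i)" by (rule free_resolution_hom_Suc[OF G(1)])
    interpret \<phi>: mod_hom R "cmod F i" "cmod G i" \<phi> using P by blast
    have "\<exists>\<psi>. mod_hom R (cmod F (Suc i)) (cmod G (Suc i)) \<psi> \<and> ?Q i \<phi> \<psi>"
    proof (rule free_module_lift[OF free_resolution_free[OF F(1)] _ dG.mod_hom_axioms])
      show "mod_hom R (cmod F (Suc i)) (cmod G i) (\<lambda>x. \<phi> (cdiff F (Suc i) x))"
        by (rule mod_hom_compose[OF dF.mod_hom_axioms \<phi>.mod_hom_axioms])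
      show "(\<lambda>x. \<phi> (cdiff F (Suc i) x)) ` carrier (cmod F (Suc i)) \<subseteq> cdiff G (Suc i) ` carrier (cmod G (Suc i))"
        using P by (auto simp: boundaries_def)
    qed
    then obtain \<psi> where \<psi>: "mod_hom R (cmod F (Suc i)) (cmod G (Suc i)) \<psi>" "?Q i \<phi> \<psi>" by blast
    have "\<psi> x \<in> boundaries G (Suc i)" if "x \<in> boundaries F (Suc i)" for x
      using that \<psi> mod_hom.hom_closed[OF \<psi>(1)] \<phi>.hom_zero
      unfolding free_resolution_exact[OF F(1)] free_resolution_exact[OF G(1)] by simp
    then show ?thesis using \<psi> by blast
  qed
  ultimately have "\<exists>\<phi>. \<forall>i. ?P i (\<phi> i) \<and> ?Q i (\<phi> i) (\<phi> (Suc i))"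
    by (rule dependent_nat_choice[of ?P ?Q])
  then obtain \<phi> where "\<forall>i. ?P i (\<phi> i) \<and> ?Q i (\<phi> i) (\<phi> (Suc i))" by (elim exE)
  then have "\<And>i. ?P i (\<phi> i)" "\<And>i. ?Q i (\<phi> i) (\<phi> (Suc i))" by simp_all
  then show ?thesis unfolding chain_map_def by blast
qed

text \<open>In degree 0, \<open>\<theta>\<close> takes values in the kernel of the augmentation, so
  it lifts through the differential. Afterwards \<open>\<theta>\<close> minus h d takes values in
  cycles, which are boundaries, and lifts again.\<close>

lemma null_homotopy:
  assumes G: "free_resolution R M G" "augmentation R M G e" and \<theta>: "chain_map R G G \<theta>"
    and e\<theta>: "\<And>x. x \<in> carrier (cmod G 0) \<Longrightarrow> e (\<theta> 0 x) = \<zero>\<^bsub>M\<^esub>"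
  shows "\<exists>h. (\<forall>i. mod_hom R (cmod G i) (cmod G (Suc i)) (h i)) \<and>
    (\<forall>i. \<forall>x\<in>carrier (cmod G (Suc i)).
       \<theta> (Suc i) x = cdiff G (Suc (Suc i)) (h (Suc i) x) \<oplus>\<^bsub>cmod G (Suc i)\<^esub> h i (cdiff G (Suc i) x))"
proof -
  \<comment> \<open>On boundaries the homotopy identity loses its second summand because d d = 0;
    what remains makes sense in degree 0 as well and is what the next step requires.\<close>
  let ?P = "\<lambda>i h. mod_hom R (cmod G i) (cmod G (Suc i)) h \<and>
    (\<forall>x\<in>boundaries G i. cdiff G (Suc i) (h x) = \<theta> i x)"
  let ?Q = "\<lambda>i h h'. \<forall>x\<in>carrier (cmod G (Suc i)).
    cdiff G (Suc (Suc i)) (h' x) = \<theta> (Suc i) x \<ominus>\<^bsub>cmod G (Suc i)\<^esub> h (cdiff G (Suc i) x)"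
  have \<theta>h: "mod_hom R (cmod G i) (cmod G i) (\<theta> i)"
    and \<theta>d: "\<And>x. x \<in> carrier (cmod G (Suc i)) \<Longrightarrow> cdiff G (Suc i) (\<theta> (Suc i) x) = \<theta> i (cdiff G (Suc i) x)" for i
    using \<theta> by (auto simp: chain_map_def)
  note dh = free_resolution_hom_Suc[OF G(1)]
  have "\<exists>h. ?P 0 h"
  proof -
    have "\<theta> 0 x \<in> boundaries G 0" if "x \<in> carrier (cmod G 0)" for x
      using G(2) e\<theta>[OF that] mod_hom.hom_closed[OF \<theta>h that] unfolding augmentation_def by blast
    then have "\<exists>h. mod_hom R (cmod G 0) (cmod G (Suc 0)) h \<and> (\<forall>x\<in>carrier (cmod G 0). cdiff G (Suc 0) (h x) = \<theta> 0 x)"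
      by (intro free_module_lift[OF free_resolution_free[OF G(1)] \<theta>h dh]) (auto simp: boundaries_def)
    moreover have "boundaries G 0 \<subseteq> carrier (cmod G 0)" using G(2) by (auto simp: augmentation_def)
    ultimately show ?thesis by blast
  qed
  moreover have "\<exists>h'. ?P (Suc i) h' \<and> ?Q i h h'" if P: "?P i h" for i h
  proof -
    interpret d: mod_hom R "cmod G (Suc i)" "cmod G i" "cdiff G (Suc i)" by (rule dh)
    interpret h: mod_hom R "cmod G i" "cmod G (Suc i)" h using P by blast
    interpret t: mod_hom R "cmod G (Suc i)" "cmod G (Suc i)" "\<theta> (Suc i)" by (rule \<theta>h)
    interpret t0: mod_hom R "cmod G i" "cmod G i" "\<theta> i" by (rule \<theta>h)
    have "\<exists>h'. mod_hom R (cmod G (Suc i)) (cmod G (Suc (Suc i))) h' \<and> ?Q i h h'"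
    proof (rule free_module_lift[OF free_resolution_free[OF G(1)] _ dh])
      show "mod_hom R (cmod G (Suc i)) (cmod G (Suc i))
          (\<lambda>x. \<theta> (Suc i) x \<ominus>\<^bsub>cmod G (Suc i)\<^esub> h (cdiff G (Suc i) x))"
        by (rule mod_hom_diff[OF \<theta>h mod_hom_compose[OF dh h.mod_hom_axioms]])
      have "\<theta> (Suc i) x \<ominus>\<^bsub>cmod G (Suc i)\<^esub> h (cdiff G (Suc i) x) \<in> boundaries G (Suc i)"
        if x: "x \<in> carrier (cmod G (Suc i))" for x
      proof -
        have "cdiff G (Suc i) x \<in> boundaries G i" using x by (simp add: boundaries_def)
        then have "cdiff G (Suc i) (h (cdiff G (Suc i) x)) = \<theta> i (cdiff G (Suc i) x)" using P by blast
        then show ?thesis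
          unfolding free_resolution_exact[OF G(1)]
          using x \<theta>d[OF x] by (simp add: d.N.M.minus_eq_zero_iff)
      qed
      then show "(\<lambda>x. \<theta> (Suc i) x \<ominus>\<^bsub>cmod G (Suc i)\<^esub> h (cdiff G (Suc i) x)) ` carrier (cmod G (Suc i))
          \<subseteq> cdiff G (Suc (Suc i)) ` carrier (cmod G (Suc (Suc i)))"
        by (auto simp: boundaries_def)
    qed
    then obtain h' where h': "mod_hom R (cmod G (Suc i)) (cmod G (Suc (Suc i))) h'" "?Q i h h'" by blast
    have "cdiff G (Suc (Suc i)) (h' x) = \<theta> (Suc i) x" if "x \<in> boundaries G (Suc i)" for x
      using that h'(2) unfolding free_resolution_exact[OF G(1)] by (auto simp: a_minus_def)
    then show ?thesis using h' by blast
  qed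
  ultimately have "\<exists>h. \<forall>i. ?P i (h i) \<and> ?Q i (h i) (h (Suc i))"
    by (rule dependent_nat_choice[of ?P ?Q])
  then obtain h where "\<forall>i. ?P i (h i) \<and> ?Q i (h i) (h (Suc i))" by (elim exE)
  then have h: "\<And>i. ?P i (h i)" "\<And>i. ?Q i (h i) (h (Suc i))" by simp_all
  have "\<theta> (Suc i) x = cdiff G (Suc (Suc i)) (h (Suc i) x) \<oplus>\<^bsub>cmod G (Suc i)\<^esub> h i (cdiff G (Suc i) x)"
    if x: "x \<in> carrier (cmod G (Suc i))" for i x
  proof -
    interpret d: mod_hom R "cmod G (Suc i)" "cmod G i" "cdiff G (Suc i)" by (rule dh)
    interpret h: mod_hom R "cmod G i" "cmod G (Suc i)" "h i" using h(1)[of i] by blast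
    interpret t: mod_hom R "cmod G (Suc i)" "cmod G (Suc i)" "\<theta> (Suc i)" by (rule \<theta>h)
    have "cdiff G (Suc (Suc i)) (h (Suc i) x) = \<theta> (Suc i) x \<ominus>\<^bsub>cmod G (Suc i)\<^esub> h i (cdiff G (Suc i) x)"
      using h(2)[of i] x by blast
    then show ?thesis using x by (simp add: a_minus_def d.M.M.a_assoc d.M.M.l_neg)
  qed
  then show ?thesis using h(1) by blast
qed

context noetherian_local
begin

text \<open>With a homotopy h from \<open>\<phi>\<close> \<open>\<psi>\<close> to the identity of
  \<open>G\<close>, let the criterion in \<open>F\<close> provide y for \<open>\<psi>\<close> x.
  Then x - d(\<open>\<phi>\<close> y + h x) = \<open>\<phi>\<close>(\<open>\<psi>\<close> x - d y) +
  h(d x). All maps preserve the filtration, so the first summand lies in \<open>m\<^sup>nG\<close>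
  and the second even in \<open>m\<^sup>n\<^sup>+\<^sup>1G\<close>.\<close>

lemma nu_criterion_transfer:
  assumes M: "module R M" and F: "free_resolution R M F" and G: "free_resolution R M G"
    and crit: "nu_criterion R m F n (Suc k)"
  shows "nu_criterion R m G n (Suc k)"
proof -
  obtain e e' where e: "augmentation R M F e" and e': "augmentation R M G e'"
    using augmentation_exists[OF F M] augmentation_exists[OF G M] by blast
  obtain \<phi> where \<phi>: "chain_map R F G \<phi>" "\<forall>x\<in>carrier (cmod F 0). e' (\<phi> 0 x) = e x"
    using chain_map_exists[OF F e G e'] by blast
  obtain \<psi> where \<psi>: "chain_map R G F \<psi>" "\<forall>x\<in>carrier (cmod G 0). e (\<psi> 0 x) = e' x"
    using chain_map_exists[OF G e' F e] by blast
  have \<phi>h: "mod_hom R (cmod F i) (cmod G i) (\<phi> i)" and \<psi>h: "mod_hom R (cmod G i) (cmod F i) (\<psi> i)" for i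
    using \<phi>(1) \<psi>(1) by (simp_all add: chain_map_def)
  have \<phi>d: "cdiff G (Suc i) (\<phi> (Suc i) x) = \<phi> i (cdiff F (Suc i) x)" if "x \<in> carrier (cmod F (Suc i))" for i x
    using \<phi>(1) that by (simp add: chain_map_def)
  have \<psi>d: "cdiff F (Suc i) (\<psi> (Suc i) x) = \<psi> i (cdiff G (Suc i) x)" if "x \<in> carrier (cmod G (Suc i))" for i x
    using \<psi>(1) that by (simp add: chain_map_def)
  note dG = free_resolution_hom_Suc[OF G] and dF = free_resolution_hom_Suc[OF F]
  note idG = mod_hom_id[OF free_resolution_module[OF G]]
  define \<theta> where "\<theta> i x = x \<ominus>\<^bsub>cmod G i\<^esub> \<phi> i (\<psi> i x)" for i x
  have \<theta>h: "mod_hom R (cmod G i) (cmod G i) (\<theta> i)" for i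
    unfolding \<theta>_def by (rule mod_hom_diff[OF idG mod_hom_compose[OF \<psi>h \<phi>h]])
  have "chain_map R G G \<theta>"
    unfolding chain_map_def
  proof (intro conjI allI ballI \<theta>h)
    fix i x assume x: "x \<in> carrier (cmod G (Suc i))"
    note \<psi>x = mod_hom.hom_closed[OF \<psi>h x]
    show "cdiff G (Suc i) (\<theta> (Suc i) x) = \<theta> i (cdiff G (Suc i) x)"
      unfolding \<theta>_def mod_hom.hom_minus[OF dG x mod_hom.hom_closed[OF \<phi>h \<psi>x]] \<phi>d[OF \<psi>x] \<psi>d[OF x] ..
  qed
  moreover have "e' (\<theta> 0 x) = \<zero>\<^bsub>M\<^esub>" if x: "x \<in> carrier (cmod G 0)" for x
  proof -
    interpret e': mod_hom R "cmod G 0" M e' using e' by (simp add: augmentation_def)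
    note \<psi>x = mod_hom.hom_closed[OF \<psi>h x]
    have "e' (\<phi> 0 (\<psi> 0 x)) = e' x" using \<phi>(2) \<psi>(2) x \<psi>x by simp
    then show ?thesis
      unfolding \<theta>_def e'.hom_minus[OF x mod_hom.hom_closed[OF \<phi>h \<psi>x]]
      using x by (simp add: e'.N.M.minus_eq_zero_iff)
  qed
  ultimately obtain h where hh: "\<And>i. mod_hom R (cmod G i) (cmod G (Suc i)) (h i)"
    and h: "\<And>i x. x \<in> carrier (cmod G (Suc i)) \<Longrightarrow>
       \<theta> (Suc i) x = cdiff G (Suc (Suc i)) (h (Suc i) x) \<oplus>\<^bsub>cmod G (Suc i)\<^esub> h i (cdiff G (Suc i) x)"
    using null_homotopy[OF G e'] by blast
  show ?thesis
    unfolding nu_criterion_def diff_Suc_1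
  proof (intro ballI impI)
    let ?X = "cmod G (Suc k)" and ?I = "\<lambda>n N. ideal_smult R (ideal_pow R m n) N"
    fix x assume x: "x \<in> carrier ?X" and dx: "cdiff G (Suc k) x \<in> ?I (n + 1) (cmod G k)"
    interpret X: module R ?X by (rule free_resolution_module[OF G])
    interpret d: mod_hom R "cmod G (Suc (Suc k))" ?X "cdiff G (Suc (Suc k))" by (rule dG)
    interpret \<phi>: mod_hom R "cmod F (Suc k)" ?X "\<phi> (Suc k)" by (rule \<phi>h)
    note sub = pow_subset[of n] pow_subset[of "n + 1"]
    have sX: "submodule (?I n ?X) R ?X" by (rule X.submodule_ideal_smult[OF sub(1)])
    have "\<psi> k (cdiff G (Suc k) x) \<in> ?I (n + 1) (cmod F k)"
      by (rule mod_hom.hom_ideal_smult[OF \<psi>h sub(2) dx])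
    then have "cdiff F (Suc k) (\<psi> (Suc k) x) \<in> ?I (n + 1) (cmod F k)" using \<psi>d[OF x] by simp
    then obtain y where y: "y \<in> carrier (cmod F (Suc (Suc k)))"
      "\<psi> (Suc k) x \<ominus>\<^bsub>cmod F (Suc k)\<^esub> cdiff F (Suc (Suc k)) y \<in> ?I n (cmod F (Suc k))"
      using crit mod_hom.hom_closed[OF \<psi>h x] unfolding nu_criterion_def diff_Suc_1 by blast
    note \<psi>x = mod_hom.hom_closed[OF \<psi>h x] and dy = mod_hom.hom_closed[OF dF y(1)]
    let ?p = "\<phi> (Suc k) (\<psi> (Suc k) x)" and ?q = "cdiff G (Suc (Suc k)) (\<phi> (Suc (Suc k)) y)"
    let ?u = "cdiff G (Suc (Suc k)) (h (Suc k) x)" and ?v = "h k (cdiff G (Suc k) x)"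
    have pq: "?p \<ominus>\<^bsub>?X\<^esub> ?q \<in> ?I n ?X"
      using \<phi>.hom_ideal_smult[OF sub(1) y(2)] unfolding \<phi>.hom_minus[OF \<psi>x dy] \<phi>d[OF y(1)] .
    have "?v \<in> ?I (n + 1) ?X" by (rule mod_hom.hom_ideal_smult[OF hh sub(2) dx])
    then have v: "?v \<in> ?I n ?X" using X.ideal_smult_mono[OF ideal_pow_antimono[OF ideal_m]] by (metis le_add1 subsetD)
    have c: "?p \<in> carrier ?X" "?q \<in> carrier ?X" "?u \<in> carrier ?X" "?v \<in> carrier ?X"
      using \<phi>.hom_closed[OF \<psi>x] d.hom_closed mod_hom.hom_closed[OF \<phi>h y(1)] mod_hom.hom_closed[OF hh x]
        X.submodule_carrierD[OF sX v] by blast+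
    have "x = ?p \<oplus>\<^bsub>?X\<^esub> (x \<ominus>\<^bsub>?X\<^esub> ?p)" using x c by (simp add: a_minus_def X.M.a_ac X.M.r_neg X.M.r_neg2 X.M.r_neg1)
    also have "x \<ominus>\<^bsub>?X\<^esub> ?p = ?u \<oplus>\<^bsub>?X\<^esub> ?v" using h[OF x] by (simp add: \<theta>_def)
    finally have xe: "x = ?p \<oplus>\<^bsub>?X\<^esub> (?u \<oplus>\<^bsub>?X\<^esub> ?v)" .
    let ?z = "\<phi> (Suc (Suc k)) y \<oplus>\<^bsub>cmod G (Suc (Suc k))\<^esub> h (Suc k) x"
    have cz: "\<phi> (Suc (Suc k)) y \<in> carrier (cmod G (Suc (Suc k)))" "h (Suc k) x \<in> carrier (cmod G (Suc (Suc k)))"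
      by (rule mod_hom.hom_closed[OF \<phi>h y(1)], rule mod_hom.hom_closed[OF hh x])
    have "x \<ominus>\<^bsub>?X\<^esub> cdiff G (Suc (Suc k)) ?z = x \<ominus>\<^bsub>?X\<^esub> (?q \<oplus>\<^bsub>?X\<^esub> ?u)" using cz by simp
    also have "\<dots> = (?p \<oplus>\<^bsub>?X\<^esub> (?u \<oplus>\<^bsub>?X\<^esub> ?v)) \<ominus>\<^bsub>?X\<^esub> (?q \<oplus>\<^bsub>?X\<^esub> ?u)" using xe by simp
    also have "\<dots> = (?p \<ominus>\<^bsub>?X\<^esub> ?q) \<oplus>\<^bsub>?X\<^esub> ?v"
      using c by (simp add: a_minus_def X.M.minus_add X.M.a_ac X.M.r_neg1 X.M.r_neg2)
    finally have "x \<ominus>\<^bsub>?X\<^esub> cdiff G (Suc (Suc k)) ?z \<in> ?I n ?X" using X.submoduleE(5)[OF sX pq v] by simp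
    then show "\<exists>y\<in>carrier (cmod G (Suc (Suc k))). x \<ominus>\<^bsub>?X\<^esub> cdiff G (Suc (Suc k)) y \<in> ?I n ?X"
      using d.M.M.a_closed[OF cz] by blast
  qed
qed

text \<open>Over M = 0 the identity of \<open>G\<close> lifts the zero map, so it is null-homotopic,
  and x - d(h x) = h(d x) inherits the filtration degree of d x.\<close>

lemma nu_criterion_zero_module:
  assumes M: "module R M" "zero_module M" and G: "free_resolution R M G"
  shows "nu_criterion R m G n (Suc k)"
proof -
  obtain e where e: "augmentation R M G e" using augmentation_exists[OF G M(1)] by blast
  interpret e: mod_hom R "cmod G 0" M e using e by (simp add: augmentation_def)
  note dG = free_resolution_hom_Suc[OF G]
  have "chain_map R G G (\<lambda>_ x. x)"
    using mod_hom_id[OF free_resolution_module[OF G]] by (simp add: chain_map_def)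
  moreover have "e x = \<zero>\<^bsub>M\<^esub>" if "x \<in> carrier (cmod G 0)" for x
    using e.hom_closed[OF that] M(2) by (simp add: zero_module_def)
  ultimately obtain h where hh: "\<And>i. mod_hom R (cmod G i) (cmod G (Suc i)) (h i)"
    and h: "\<And>i x. x \<in> carrier (cmod G (Suc i)) \<Longrightarrow>
       x = cdiff G (Suc (Suc i)) (h (Suc i) x) \<oplus>\<^bsub>cmod G (Suc i)\<^esub> h i (cdiff G (Suc i) x)"
    using null_homotopy[OF G e, of "\<lambda>_ x. x"] by blast
  show ?thesis
    unfolding nu_criterion_def diff_Suc_1
  proof (intro ballI impI)
    let ?X = "cmod G (Suc k)" and ?I = "\<lambda>n N. ideal_smult R (ideal_pow R m n) N"
    fix x assume x: "x \<in> carrier ?X" and dx: "cdiff G (Suc k) x \<in> ?I (n + 1) (cmod G k)"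
    interpret X: module R ?X by (rule free_resolution_module[OF G])
    let ?u = "cdiff G (Suc (Suc k)) (h (Suc k) x)" and ?v = "h k (cdiff G (Suc k) x)"
    have hx: "h (Suc k) x \<in> carrier (cmod G (Suc (Suc k)))" by (rule mod_hom.hom_closed[OF hh x])
    have "?v \<in> ?I (n + 1) ?X" by (rule mod_hom.hom_ideal_smult[OF hh pow_subset dx])
    then have v: "?v \<in> ?I n ?X" using X.ideal_smult_mono[OF ideal_pow_antimono[OF ideal_m]] by (metis le_add1 subsetD)
    have c: "?u \<in> carrier ?X" "?v \<in> carrier ?X"
      by (rule mod_hom.hom_closed[OF dG hx]) (rule X.submodule_carrierD[OF X.submodule_ideal_smult[OF pow_subset] v])
    have "?u \<oplus>\<^bsub>?X\<^esub> ?v \<ominus>\<^bsub>?X\<^esub> ?u = ?v" using c by (simp add: a_minus_def X.M.a_ac X.M.r_neg1 X.M.r_neg X.M.r_neg2)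
    then have "x \<ominus>\<^bsub>?X\<^esub> ?u = ?v" using h[OF x] by simp
    then show "\<exists>y\<in>carrier (cmod G (Suc (Suc k))). x \<ominus>\<^bsub>?X\<^esub> cdiff G (Suc (Suc k)) y \<in> ?I n ?X"
      using hx v by force
  qed
qed

end

section \<open>Exactness of the linear part in one degree\<close>

lemma (in abelian_group) add_minus_cancel:
  assumes "x \<in> carrier G" "y \<in> carrier G"
  shows "y \<oplus> (x \<ominus> y) = x"
  using assms a_comm[of y "x \<oplus> \<ominus> y"] by (simp add: a_minus_def a_assoc l_neg)

lemma (in abelian_group) minus_minus_cancel:
  assumes "x \<in> carrier G" "y \<in> carrier G"
  shows "x \<ominus> (x \<ominus> y) = y"
  using assms by (simp add: a_minus_def minus_add r_neg2)

text \<open>A name that keeps \<open>ideal_pow\<close> folded under simplification.\<close>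

definition power_smult ::
  "('a, 'r) ring_scheme \<Rightarrow> 'a set \<Rightarrow> nat \<Rightarrow> ('a, 'b, 's) module_scheme \<Rightarrow> 'b set" where
  "power_smult R m n N = ideal_smult R (ideal_pow R m n) N"

text \<open>For \<open>n = 0\<close> the truncated difference allows any \<open>y\<close>. This is harmless when boundaries lie in
  \<open>m F\<close>, as in a minimal resolution.\<close>

definition lin_exact ::
  "('a, 'r) ring_scheme \<Rightarrow> 'a set \<Rightarrow> ('a, 'f) chain_complex \<Rightarrow> nat \<Rightarrow> bool" where
  "lin_exact R m F i \<longleftrightarrow> (\<forall>n. \<forall>x\<in>power_smult R m n (cmod F i).
     cdiff F i x \<in> power_smult R m (n + 2) (cmod F (i - 1)) \<longrightarrow>
     (\<exists>y\<in>power_smult R m (n - 1) (cmod F (Suc i)).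
        x \<ominus>\<^bsub>cmod F i\<^esub> cdiff F (Suc i) y \<in> power_smult R m (n + 1) (cmod F i)))"

lemma nu_criterion_power_smult:
  "nu_criterion R m F n i \<longleftrightarrow> (\<forall>x\<in>carrier (cmod F i).
     cdiff F i x \<in> power_smult R m (n + 1) (cmod F (i - 1)) \<longrightarrow>
     (\<exists>y\<in>carrier (cmod F (Suc i)).
        x \<ominus>\<^bsub>cmod F i\<^esub> cdiff F (Suc i) y \<in> power_smult R m n (cmod F i)))"
  unfolding nu_criterion_def power_smult_def ..

context noetherian_local
begin

abbreviation "P \<equiv> power_smult R m"

lemma submodule_P: "module R N \<Longrightarrow> submodule (P n N) R N"
  unfolding power_smult_def by (rule module.submodule_ideal_smult[OF _ pow_subset])

lemma P_0: "module R N \<Longrightarrow> P 0 N = carrier N"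
  by (simp add: power_smult_def module.ideal_smult_carrier)

lemma P_antimono: "module R N \<Longrightarrow> n \<le> k \<Longrightarrow> P k N \<subseteq> P n N"
  unfolding power_smult_def by (intro module.ideal_smult_mono ideal_pow_antimono ideal_m)

lemma P_1: "module R N \<Longrightarrow> P 1 N \<subseteq> ideal_smult R m N"
  unfolding power_smult_def
  using ideal_prod_inter[OF ideal_m oneideal] by (intro module.ideal_smult_mono) auto

text \<open>The free exponent k absorbs the truncated differences that arise from the shifts in
  \<open>gr_piece\<close>.\<close>

lemma P_hom_minimal:
  "mod_hom R N N' f \<Longrightarrow> f ` carrier N \<subseteq> ideal_smult R m N' \<Longrightarrow> x \<in> P n N \<Longrightarrow> k \<le> Suc n \<Longrightarrow> f x \<in> P k N'"
  using mod_hom.hom_ideal_pow[OF _ ideal_m, of N N' f x n] P_antimono[of N' k "Suc n"]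
  by (auto simp: power_smult_def mod_hom_def simp del: ideal_pow.simps)

lemma lin_exact_iff_nu_criterion:
  assumes F: "minimal_free_resolution R m M F"
  shows "lin_exact R m F (Suc k) \<longleftrightarrow>
    (\<forall>n>0. nu_criterion R m F n (Suc (Suc k)) \<and> nu_criterion R m F n (Suc k))"
proof -
  have F': "free_resolution R M F" using F by (simp add: minimal_free_resolution_def)
  let ?W = "cmod F k" and ?X = "cmod F (Suc k)" and ?Y = "cmod F (Suc (Suc k))" and ?V = "cmod F (Suc (Suc (Suc k)))"
  let ?d = "cdiff F (Suc k)" and ?d' = "cdiff F (Suc (Suc k))" and ?d'' = "cdiff F (Suc (Suc (Suc k)))"
  interpret d: mod_hom R ?X ?W ?d by (rule free_resolution_hom_Suc[OF F'])
  interpret d': mod_hom R ?Y ?X ?d' by (rule free_resolution_hom_Suc[OF F'])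
  interpret d'': mod_hom R ?V ?Y ?d'' by (rule free_resolution_hom_Suc[OF F'])
  note ac = a_minus_def d.M.M.a_ac d.M.M.r_neg d.M.M.r_neg1 d.M.M.r_neg2 d.M.M.minus_add
  have dd': "?d (?d' y) = \<zero>\<^bsub>?W\<^esub>" if "y \<in> carrier ?Y" for y
    using free_resolution_exact[OF F', of "?d' y" k] that by (simp add: boundaries_def)
  have d'd'': "?d' (?d'' y) = \<zero>\<^bsub>?X\<^esub>" if "y \<in> carrier ?V" for y
    using free_resolution_exact[OF F', of "?d'' y" "Suc k"] that by (simp add: boundaries_def)
  have crit: "nu_criterion R m F n (Suc k) \<longleftrightarrow> (\<forall>x\<in>carrier ?X. ?d x \<in> P (n + 1) ?W \<longrightarrow>
      (\<exists>y\<in>carrier ?Y. x \<ominus>\<^bsub>?X\<^esub> ?d' y \<in> P n ?X))"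
    and crit': "nu_criterion R m F n (Suc (Suc k)) \<longleftrightarrow> (\<forall>x\<in>carrier ?Y. ?d' x \<in> P (n + 1) ?X \<longrightarrow>
      (\<exists>y\<in>carrier ?V. x \<ominus>\<^bsub>?Y\<^esub> ?d'' y \<in> P n ?Y))" for n
    unfolding nu_criterion_power_smult by simp_all
  have le: "lin_exact R m F (Suc k) \<longleftrightarrow> (\<forall>n. \<forall>x\<in>P n ?X. ?d x \<in> P (n + 2) ?W \<longrightarrow>
      (\<exists>y\<in>P (n - 1) ?Y. x \<ominus>\<^bsub>?X\<^esub> ?d' y \<in> P (n + 1) ?X))"
    unfolding lin_exact_def by simp
  have PX: "submodule (P n ?X) R ?X" and PY: "submodule (P n ?Y) R ?Y" and PW: "submodule (P n ?W) R ?W" for n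
    by (rule submodule_P d.M.module_axioms d'.M.module_axioms d.N.module_axioms)+
  note cX = d.M.submodule_carrierD[OF PX] and cY = d'.M.submodule_carrierD[OF PY]
  note P0X = P_0[OF d.M.module_axioms] and P0Y = P_0[OF d'.M.module_axioms]
  have d'0: "x \<ominus>\<^bsub>?X\<^esub> ?d' \<zero>\<^bsub>?Y\<^esub> = x" if "x \<in> carrier ?X" for x using that by (simp add: a_minus_def)
  show ?thesis
  proof
    assume "lin_exact R m F (Suc k)"
    then have lin: "\<exists>y\<in>P (n - 1) ?Y. x \<ominus>\<^bsub>?X\<^esub> ?d' y \<in> P (n + 1) ?X"
      if "x \<in> P n ?X" "?d x \<in> P (n + 2) ?W" for n x
      using that unfolding le by blast
    have "nu_criterion R m F n (Suc k)" for n
      unfolding crit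
    proof (intro ballI impI)
      fix x assume x: "x \<in> carrier ?X" and dx: "?d x \<in> P (n + 1) ?W"
      \<comment> \<open>Subtracting a boundary does not change d x, so \<open>lin\<close> applies
        again at each stage. The bound p \<le> n is needed because d x is known to lie in
        \<open>m\<^sup>n\<^sup>+\<^sup>1\<close> only.\<close>
      have "\<exists>y\<in>carrier ?Y. x \<ominus>\<^bsub>?X\<^esub> ?d' y \<in> P p ?X" if "p \<le> n" for p
        using that
      proof (induction p)
        case 0
        then show ?case using x d'0[OF x] P0X d'.M.M.zero_closed by metis
      next
        case (Suc p)
        then obtain y where y: "y \<in> carrier ?Y" "x \<ominus>\<^bsub>?X\<^esub> ?d' y \<in> P p ?X" by auto
        have "?d (x \<ominus>\<^bsub>?X\<^esub> ?d' y) = ?d x" using x y dd'[OF y(1)] by (simp add: a_minus_def)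
        moreover have "P (n + 1) ?W \<subseteq> P (p + 2) ?W" using Suc.prems by (intro P_antimono d.N.module_axioms) simp
        ultimately obtain y' where y': "y' \<in> P (p - 1) ?Y" "x \<ominus>\<^bsub>?X\<^esub> ?d' y \<ominus>\<^bsub>?X\<^esub> ?d' y' \<in> P (p + 1) ?X"
          using lin[OF y(2)] dx by auto
        have "x \<ominus>\<^bsub>?X\<^esub> ?d' (y \<oplus>\<^bsub>?Y\<^esub> y') = x \<ominus>\<^bsub>?X\<^esub> ?d' y \<ominus>\<^bsub>?X\<^esub> ?d' y'"
          using x y cY[OF y'(1)] by (simp add: ac)
        then show ?case using y y' cY[OF y'(1)] by (intro bexI[of _ "y \<oplus>\<^bsub>?Y\<^esub> y'"]) auto
      qed
      then show "\<exists>y\<in>carrier ?Y. x \<ominus>\<^bsub>?X\<^esub> ?d' y \<in> P n ?X" by blast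
    qed
    moreover have "nu_criterion R m F n (Suc (Suc k))" for n
      unfolding crit'
    proof (intro ballI impI)
      fix y assume y: "y \<in> carrier ?Y" and dy: "?d' y \<in> P (n + 1) ?X"
      \<comment> \<open>Here the residue is a cycle, so \<open>lin\<close> applies without bound. A
        residue in \<open>m\<^sup>n\<^sup>+\<^sup>1\<^sup>+\<^sup>p\<close> is corrected by an
        element of \<open>m\<^sup>n\<^sup>+\<^sup>pF\<close>, which keeps the sum of all corrections
        in \<open>m\<^sup>nF\<close>.\<close>
      have appr: "\<exists>l\<in>P n ?Y. ?d' y \<ominus>\<^bsub>?X\<^esub> ?d' l \<in> P (n + 1 + p) ?X" for p
      proof (induction p)
        case 0
        then show ?case using dy d'0[of "?d' y"] y d'.M.submodule_zero[OF PY, of n]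
          by (intro bexI[of _ "\<zero>\<^bsub>?Y\<^esub>"]) auto
      next
        case (Suc p)
        then obtain l where l: "l \<in> P n ?Y" "?d' y \<ominus>\<^bsub>?X\<^esub> ?d' l \<in> P (n + 1 + p) ?X" by blast
        have "?d (?d' y \<ominus>\<^bsub>?X\<^esub> ?d' l) = \<zero>\<^bsub>?W\<^esub>"
          using y cY[OF l(1)] dd' by (simp add: a_minus_def)
        then have "?d (?d' y \<ominus>\<^bsub>?X\<^esub> ?d' l) \<in> P (n + 1 + p + 2) ?W" using d.N.submodule_zero[OF PW] by metis
        from lin[OF l(2) this] obtain y' where y': "y' \<in> P (n + p) ?Y"
            "?d' y \<ominus>\<^bsub>?X\<^esub> ?d' l \<ominus>\<^bsub>?X\<^esub> ?d' y' \<in> P (n + 1 + Suc p) ?X" by auto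
        have "y' \<in> P n ?Y" using y'(1) P_antimono[OF d'.M.module_axioms, of n "n + p"] by auto
        then have "l \<oplus>\<^bsub>?Y\<^esub> y' \<in> P n ?Y" using l d'.M.submoduleE(5)[OF PY] by blast
        moreover have "?d' y \<ominus>\<^bsub>?X\<^esub> ?d' (l \<oplus>\<^bsub>?Y\<^esub> y') = ?d' y \<ominus>\<^bsub>?X\<^esub> ?d' l \<ominus>\<^bsub>?X\<^esub> ?d' y'"
          using y cY[OF l(1)] cY[OF y'(1)] by (simp add: ac)
        ultimately show ?case using y'(2) by (intro bexI[of _ "l \<oplus>\<^bsub>?Y\<^esub> y'"]) simp_all
      qed
      have fg: "fin_gen_module R ?X" using F by (simp add: minimal_free_resolution_def)
      have "?d' y \<in> ?d' ` P n ?Y"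
      proof (rule krull_intersection[OF d.M.module_axioms fg d'.submodule_image[OF PY]])
        fix p
        obtain l where l: "l \<in> P n ?Y" "?d' y \<ominus>\<^bsub>?X\<^esub> ?d' l \<in> P (n + 1 + p) ?X" using appr by blast
        then have "?d' y \<ominus>\<^bsub>?X\<^esub> ?d' l \<in> P p ?X" using P_antimono[OF d.M.module_axioms, of p "n + 1 + p"] by auto
        moreover have "?d' y = ?d' l \<oplus>\<^bsub>?X\<^esub> (?d' y \<ominus>\<^bsub>?X\<^esub> ?d' l)" using y cY[OF l(1)] by (simp add: d.M.M.add_minus_cancel)
        ultimately show "?d' y \<in> ?d' ` P n ?Y <+>\<^bsub>?X\<^esub> ideal_smult R (ideal_pow R m p) ?X"
          unfolding d.M.mem_set_add power_smult_def[symmetric] using l(1) by blast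
      qed
      then obtain l where l: "l \<in> P n ?Y" "?d' y = ?d' l" by blast
      \<comment> \<open>The difference of y and l is a cycle, hence a boundary, and this boundary is
        the correction the criterion asks for.\<close>
      have "?d' (y \<ominus>\<^bsub>?Y\<^esub> l) = \<zero>\<^bsub>?X\<^esub>" using y l cY[OF l(1)] by (simp add: ac)
      then have "y \<ominus>\<^bsub>?Y\<^esub> l \<in> boundaries F (Suc (Suc k))"
        using free_resolution_exact[OF F', of "y \<ominus>\<^bsub>?Y\<^esub> l" "Suc k"] y cY[OF l(1)] by simp
      then obtain w where w: "w \<in> carrier ?V" "?d'' w = y \<ominus>\<^bsub>?Y\<^esub> l" by (auto simp: boundaries_def)
      have "y \<ominus>\<^bsub>?Y\<^esub> ?d'' w = l" unfolding w(2) using y cY[OF l(1)] by (simp add: d'.M.M.minus_minus_cancel)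
      then show "\<exists>w\<in>carrier ?V. y \<ominus>\<^bsub>?Y\<^esub> ?d'' w \<in> P n ?Y" using w l by metis
    qed
    ultimately show "\<forall>n>0. nu_criterion R m F n (Suc (Suc k)) \<and> nu_criterion R m F n (Suc k)" by blast
  next
    assume *: "\<forall>n>0. nu_criterion R m F n (Suc (Suc k)) \<and> nu_criterion R m F n (Suc k)"
    have c: "\<exists>y\<in>carrier ?Y. x \<ominus>\<^bsub>?X\<^esub> ?d' y \<in> P (n + 1) ?X" if "x \<in> carrier ?X" "?d x \<in> P (n + 2) ?W" for x n
      using * that unfolding crit by auto
    \<comment> \<open>The exponent n - 1 used below can be 0, which the assumption does not cover;
      there the zero correction works since \<open>P 0\<close> is the whole module. In
      \<open>c\<close> the exponent n + 1 is always positive.\<close>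
    have c': "\<exists>w\<in>carrier ?V. y \<ominus>\<^bsub>?Y\<^esub> ?d'' w \<in> P n ?Y" if y: "y \<in> carrier ?Y" "?d' y \<in> P (n + 1) ?X" for y n
    proof (cases n)
      case 0
      then show ?thesis using y P0Y d''.M.M.zero_closed by (intro bexI[of _ "\<zero>\<^bsub>?V\<^esub>"]) auto
    next
      case (Suc n')
      then show ?thesis using * y unfolding crit' by blast
    qed
    show "lin_exact R m F (Suc k)"
      unfolding le
    proof (intro allI ballI impI)
      fix n x assume x: "x \<in> P n ?X" and dx: "?d x \<in> P (n + 2) ?W"
      obtain y where y: "y \<in> carrier ?Y" "x \<ominus>\<^bsub>?X\<^esub> ?d' y \<in> P (n + 1) ?X" using c[OF cX[OF x] dx] by blast
      show "\<exists>y\<in>P (n - 1) ?Y. x \<ominus>\<^bsub>?X\<^esub> ?d' y \<in> P (n + 1) ?X"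
      proof (cases n)
        case 0
        then show ?thesis using y P0Y by auto
      next
        case (Suc n')
        \<comment> \<open>Both x and its residue lie in \<open>m\<^sup>nF\<close>, hence so does the
          image of y, and the criterion one degree higher moves y into
          \<open>m\<^sup>n\<^sup>-\<^sup>1F\<close> without changing its image.\<close>
        have "x \<ominus>\<^bsub>?X\<^esub> ?d' y \<in> P n ?X" using y(2) P_antimono[OF d.M.module_axioms, of n "n + 1"] by auto
        then have "x \<ominus>\<^bsub>?X\<^esub> (x \<ominus>\<^bsub>?X\<^esub> ?d' y) \<in> P n ?X" by (rule d.M.submodule_minus[OF PX x])
        moreover have "x \<ominus>\<^bsub>?X\<^esub> (x \<ominus>\<^bsub>?X\<^esub> ?d' y) = ?d' y" using cX[OF x] y(1) by (simp add: d.M.M.minus_minus_cancel)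
        ultimately have "?d' y \<in> P (n' + 1) ?X" using Suc by simp
        then obtain w where w: "w \<in> carrier ?V" "y \<ominus>\<^bsub>?Y\<^esub> ?d'' w \<in> P n' ?Y" using c'[OF y(1)] by blast
        have "?d' (y \<ominus>\<^bsub>?Y\<^esub> ?d'' w) = ?d' y" using y(1) w(1) d'd'' by (simp add: a_minus_def)
        then show ?thesis using w(2) y(2) Suc by (intro bexI[of _ "y \<ominus>\<^bsub>?Y\<^esub> ?d'' w"]) auto
      qed
    qed
  qed
qed

end

section \<open>Homology of the linear part\<close>

lemma a_r_coset_restrict [simp]: "K +>\<^bsub>M\<lparr>carrier := H\<rparr>\<^esub> x = K +>\<^bsub>M\<^esub> x"
  by (simp add: a_r_coset_def r_coset_def)

lemma (in module) submodule_restrict: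
  assumes "submodule H R M" "submodule K R M" "K \<subseteq> H"
  shows "submodule K R (M\<lparr>carrier := H\<rparr>)"
proof -
  interpret H: module R "M\<lparr>carrier := H\<rparr>" by (rule submodule.submodule_is_module[OF assms(1) module_axioms])
  show ?thesis
    by (rule H.submoduleI') (use assms(3) submodule_zero[OF assms(2)] submoduleE(4,5)[OF assms(2)] in auto)
qed

lemma (in mod_hom) mod_hom_restrict_both:
  assumes H: "submodule H R M" and H': "submodule H' R N" and f: "\<And>x. x \<in> H \<Longrightarrow> f x \<in> H'"
  shows "mod_hom R (M\<lparr>carrier := H\<rparr>) (N\<lparr>carrier := H'\<rparr>) f"
  by (intro mod_hom.intro mod_hom_axioms.intro submodule.submodule_is_module[OF H M.module_axioms]
      submodule.submodule_is_module[OF H' N.module_axioms])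
    (use f M.submodule_carrierD[OF H] in \<open>auto simp: module_homs_def\<close>)

text \<open>Vanishing of homology depends on addition alone. The scalars of the linear part are
  families of classes from \<open>R\<^sup>g\<close>, and only the additive group of
  \<open>gr_module\<close> is established, so the statement is made for groups.\<close>

lemma zero_module_homology_iff:
  assumes C: "abelian_group (cmod C i)" and B: "subgroup (boundaries C i) (add_monoid (cmod C i))"
    and Z: "\<zero>\<^bsub>cmod C i\<^esub> \<in> cycles C i" "cycles C i \<subseteq> carrier (cmod C i)"
  shows "zero_module (homology C i) \<longleftrightarrow> cycles C i \<subseteq> boundaries C i"
proof -
  interpret C: abelian_group "cmod C i" by fact
  let ?B = "boundaries C i"
  have *: "carrier (homology C i) = (\<lambda>x. ?B +>\<^bsub>cmod C i\<^esub> x) ` cycles C i" "\<zero>\<^bsub>homology C i\<^esub> = ?B"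
    by (auto simp: homology_def quot_module_simps A_RCOSETS_def')
  have "?B +>\<^bsub>cmod C i\<^esub> x = ?B \<longleftrightarrow> x \<in> ?B" if "x \<in> cycles C i" for x
    using C.a_coset_join1[OF _ _ B] C.a_coset_join2[OF _ B] that Z(2) by blast
  then show ?thesis unfolding zero_module_def * using Z(1) by auto
qed

section \<open>Graded pieces and the differential of the linear part\<close>

lemma gr_module_simps [simp]:
  "carrier (gr_module R m N s) = {X. (\<forall>j. X j \<in> carrier (gr_piece R m N s j)) \<and>
     finite {j. X j \<noteq> \<zero>\<^bsub>gr_piece R m N s j\<^esub>}}"
  "\<zero>\<^bsub>gr_module R m N s\<^esub> = (\<lambda>j. \<zero>\<^bsub>gr_piece R m N s j\<^esub>)"
  "X \<oplus>\<^bsub>gr_module R m N s\<^esub> Y = (\<lambda>j. X j \<oplus>\<^bsub>gr_piece R m N s j\<^esub> Y j)"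
  by (simp_all add: gr_module_def)

context noetherian_local
begin

lemma gr_piece_alt:
  "gr_piece R m N s j = quot_module (N\<lparr>carrier := P (j - s) N\<rparr>) (P (j + 1 - s) N)"
  by (simp add: gr_piece_def power_smult_def)

lemma gr_piece_zero: "\<zero>\<^bsub>gr_piece R m N s j\<^esub> = P (j + 1 - s) N"
  by (simp add: gr_piece_alt quot_module_simps)

lemma gr_piece_iff:
  "X \<in> carrier (gr_piece R m N s j) \<longleftrightarrow> (\<exists>x\<in>P (j - s) N. X = P (j + 1 - s) N +>\<^bsub>N\<^esub> x)"
  by (simp add: gr_piece_alt quot_module_simps a_rcosets_iff)

lemma module_P: "module R N \<Longrightarrow> module R (N\<lparr>carrier := P n N\<rparr>)"
  by (rule submodule.submodule_is_module[OF submodule_P])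

lemma submodule_P_restrict:
  assumes "module R N" "n \<le> k"
  shows "submodule (P k N) R (N\<lparr>carrier := P n N\<rparr>)"
  by (rule module.submodule_restrict[OF assms(1) submodule_P submodule_P P_antimono]) (use assms in auto)

lemma module_gr_piece: "module R N \<Longrightarrow> module R (gr_piece R m N s j)"
  unfolding gr_piece_alt by (rule module.module_quot[OF module_P submodule_P_restrict]) auto

lemma coset_P_eq_iff:
  assumes "module R N" "x \<in> P n N"
  shows "P k N +>\<^bsub>N\<^esub> x = P k N \<longleftrightarrow> x \<in> P k N"
  by (rule module.coset_eq_iff_mem[OF assms(1) submodule_P[OF assms(1)]
        module.submodule_carrierD[OF assms(1) submodule_P[OF assms(1)] assms(2)]])

text \<open>The shift s of the target is one less than that of the source, which matches the rise of
  the filtration by one under \<open>f\<close>; truncation for small j only weakens what is required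
  of \<open>f\<close>.\<close>

lemma gr_diff_coset:
  assumes f: "mod_hom R N N' f" "f ` carrier N \<subseteq> ideal_smult R m N'" and x: "x \<in> P (j - Suc s) N"
  shows "quot_map N' (P (j + 1 - s) N') f (P (j + 1 - Suc s) N +>\<^bsub>N\<^esub> x) = P (j + 1 - s) N' +>\<^bsub>N'\<^esub> f x"
proof -
  interpret f: mod_hom R N N' f by fact
  show ?thesis
  proof (rule f.M.quot_map_coset[OF submodule_P[OF f.M.module_axioms] _ f(1) submodule_P[OF f.N.module_axioms]])
    show "x \<in> carrier N" using f.M.submodule_carrierD[OF submodule_P[OF f.M.module_axioms] x] .
    show "f k \<in> P (j + 1 - s) N'" if "k \<in> P (j + 1 - Suc s) N" for k
      by (rule P_hom_minimal[OF f that]) simp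
  qed
qed

lemma gr_diff_hom:
  assumes f: "mod_hom R N N' f" "f ` carrier N \<subseteq> ideal_smult R m N'"
  shows "mod_hom R (gr_piece R m N (Suc s) j) (gr_piece R m N' s j) (quot_map N' (P (j + 1 - s) N') f)"
proof -
  interpret f: mod_hom R N N' f by fact
  let ?N = "N\<lparr>carrier := P (j - Suc s) N\<rparr>" and ?N' = "N'\<lparr>carrier := P (j - s) N'\<rparr>"
  have r: "mod_hom R ?N ?N' f"
    by (rule f.mod_hom_restrict_both[OF submodule_P[OF f.M.module_axioms] submodule_P[OF f.N.module_axioms]])
      (rule P_hom_minimal[OF f], auto)
  have "mod_hom R (gr_piece R m N (Suc s) j) (gr_piece R m N' s j) (quot_map ?N' (P (j + 1 - s) N') f)"
    unfolding gr_piece_alt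
  proof (rule module.quot_map_hom[OF module_P submodule_P_restrict r submodule_P_restrict])
    show "f k \<in> P (j + 1 - s) N'" if "k \<in> P (j + 1 - Suc s) N" for k
      by (rule P_hom_minimal[OF f that]) simp
  qed (auto simp: f.M.module_axioms f.N.module_axioms)
  moreover have "quot_map ?N' (P (j + 1 - s) N') f = quot_map N' (P (j + 1 - s) N') f"
    by (simp add: quot_map_def fun_eq_iff)
  ultimately show ?thesis by simp
qed

lemma abelian_group_gr_module:
  assumes N: "module R N"
  shows "abelian_group (gr_module R m N s)"
proof -
  let ?A = "gr_piece R m N s"
  have A: "module R (?A j)" for j by (rule module_gr_piece[OF N])
  then have ag: "abelian_group (?A j)" for j by (rule module.axioms(2))
  note agE = abelian_groupE[OF ag]
  have fin: "finite {j. X j \<oplus>\<^bsub>?A j\<^esub> Y j \<noteq> \<zero>\<^bsub>?A j\<^esub>}"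
    if "finite {j. X j \<noteq> \<zero>\<^bsub>?A j\<^esub>}" "finite {j. Y j \<noteq> \<zero>\<^bsub>?A j\<^esub>}" for X Y
    by (rule finite_subset[OF _ finite_UnI[OF that]]) (use agE(2,5) in auto)
  show ?thesis
  proof (rule abelian_groupI)
    fix X assume X: "X \<in> carrier (gr_module R m N s)"
    have z: "\<ominus>\<^bsub>?A j\<^esub> \<zero>\<^bsub>?A j\<^esub> = \<zero>\<^bsub>?A j\<^esub>" for j
      by (rule abelian_group.minus_equality[OF ag]) (simp_all add: agE)
    have "{j. \<ominus>\<^bsub>?A j\<^esub> X j \<noteq> \<zero>\<^bsub>?A j\<^esub>} \<subseteq> {j. X j \<noteq> \<zero>\<^bsub>?A j\<^esub>}" using z by auto
    then have "finite {j. \<ominus>\<^bsub>?A j\<^esub> X j \<noteq> \<zero>\<^bsub>?A j\<^esub>}" using X by (auto dest: finite_subset)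
    then show "\<exists>Y\<in>carrier (gr_module R m N s). Y \<oplus>\<^bsub>gr_module R m N s\<^esub> X = \<zero>\<^bsub>gr_module R m N s\<^esub>"
      using X by (intro bexI[of _ "\<lambda>j. \<ominus>\<^bsub>?A j\<^esub> X j"])
        (auto simp: abelian_group.l_neg[OF ag] abelian_group.a_inv_closed[OF ag])
  qed (use agE fin in auto)
qed

lemma lin_complex_simps:
  "cmod (lin_complex R m F) i = gr_module R m (cmod F i) i"
  "cdiff (lin_complex R m F) (Suc i) X j = quot_map (cmod F i) (P (j + 1 - i) (cmod F i)) (cdiff F (Suc i)) (X j)"
  by (simp_all add: lin_complex_def power_smult_def)

context
  fixes M :: "('a, 'c, 's) module_scheme" and F :: "('a, 'f) chain_complex"
  assumes F: "minimal_free_resolution R m M F"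
begin

lemma minimal_free_resolution_diff:
  "mod_hom R (cmod F (Suc i)) (cmod F i) (cdiff F (Suc i))"
  "cdiff F (Suc i) ` carrier (cmod F (Suc i)) \<subseteq> ideal_smult R m (cmod F i)"
proof -
  show "mod_hom R (cmod F (Suc i)) (cmod F i) (cdiff F (Suc i))"
    using F by (intro free_resolution_hom_Suc[where M = M]) (simp add: minimal_free_resolution_def)
  have "cdiff F (Suc i) ` carrier (cmod F (Suc i)) \<subseteq> ideal_smult R m (cmod F (Suc i - 1))"
    using F unfolding minimal_free_resolution_def by blast
  then show "cdiff F (Suc i) ` carrier (cmod F (Suc i)) \<subseteq> ideal_smult R m (cmod F i)" by simp
qed

abbreviation "piece i j \<equiv> gr_piece R m (cmod F i) i j"
abbreviation "gr_diff i j \<equiv> quot_map (cmod F i) (P (j + 1 - i) (cmod F i)) (cdiff F (Suc i))"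

lemma piece_hom: "mod_hom R (piece (Suc i) j) (piece i j) (gr_diff i j)"
  by (rule gr_diff_hom[OF minimal_free_resolution_diff])

lemma minimal_free_resolution_module: "module R (cmod F i)"
  using F by (intro free_resolution_module[where M = M]) (simp add: minimal_free_resolution_def)

lemma lin_diff_hom:
  "group_hom (add_monoid (gr_module R m (cmod F (Suc i)) (Suc i))) (add_monoid (gr_module R m (cmod F i) i))
     (cdiff (lin_complex R m F) (Suc i))"
proof -
  let ?G = "gr_module R m (cmod F (Suc i)) (Suc i)" and ?H = "gr_module R m (cmod F i) i"
  let ?D = "cdiff (lin_complex R m F) (Suc i)"
  note D = lin_complex_simps(2)
  have "?D \<in> hom (add_monoid ?G) (add_monoid ?H)"
  proof (rule homI)
    fix X assume X: "X \<in> carrier (add_monoid ?G)"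
    have "finite {j. ?D X j \<noteq> \<zero>\<^bsub>piece i j\<^esub>}"
      by (rule finite_subset[of _ "{j. X j \<noteq> \<zero>\<^bsub>piece (Suc i) j\<^esub>}"])
        (use X mod_hom.hom_zero[OF piece_hom] in \<open>auto simp: D\<close>)
    moreover have "?D X j \<in> carrier (piece i j)" for j
      unfolding D using X by (intro mod_hom.hom_closed[OF piece_hom]) simp
    ultimately show "?D X \<in> carrier (add_monoid ?H)" by simp
    fix Y assume Y: "Y \<in> carrier (add_monoid ?G)"
    have "?D (X \<oplus>\<^bsub>?G\<^esub> Y) j = (?D X \<oplus>\<^bsub>?H\<^esub> ?D Y) j" for j
      unfolding D gr_module_simps using X Y by (intro mod_hom.hom_add[OF piece_hom]) simp_all
    then show "?D (X \<otimes>\<^bsub>add_monoid ?G\<^esub> Y) = ?D X \<otimes>\<^bsub>add_monoid ?H\<^esub> ?D Y" by (simp add: fun_eq_iff)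
  qed
  then show ?thesis
    by (intro group_hom.intro group_hom_axioms.intro abelian_group.a_group abelian_group_gr_module
        minimal_free_resolution_module)
qed

lemma zero_module_lin_homology_iff:
  "zero_module (homology (lin_complex R m F) i) \<longleftrightarrow> cycles (lin_complex R m F) i \<subseteq> boundaries (lin_complex R m F) i"
proof (rule zero_module_homology_iff)
  let ?L = "lin_complex R m F"
  show ag: "abelian_group (cmod ?L i)"
    unfolding lin_complex_simps by (rule abelian_group_gr_module[OF minimal_free_resolution_module])
  show "subgroup (boundaries ?L i) (add_monoid (cmod ?L i))"
    using group_hom.img_is_subgroup[OF lin_diff_hom[of i]] by (simp add: boundaries_def lin_complex_simps(1))
  show "cycles ?L i \<subseteq> carrier (cmod ?L i)" by (auto simp: cycles_def)
  show "\<zero>\<^bsub>cmod ?L i\<^esub> \<in> cycles ?L i"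
  proof (cases i)
    case 0
    then show ?thesis using abelian_groupE(2)[OF ag] by (simp add: cycles_def)
  next
    case (Suc k)
    then show ?thesis
      using abelian_groupE(2)[OF ag] group_hom.hom_one[OF lin_diff_hom[of k]]
      by (simp add: cycles_def lin_complex_simps(1))
  qed
qed

text \<open>The differential preserves internal degree, so exactness may be tested piece by piece,
  and cosets may then be replaced by representatives. Internal degree j corresponds to the exponent
  n = j - Suc k in \<open>lin_exact\<close>.\<close>

lemma zero_module_lin_homology_iff_lin_exact:
  "zero_module (homology (lin_complex R m F) (Suc k)) \<longleftrightarrow> lin_exact R m F (Suc k)"
proof -
  let ?L = "lin_complex R m F"
  let ?X = "cmod F (Suc k)" and ?Y = "cmod F (Suc (Suc k))" and ?W = "cmod F k"
  let ?d = "cdiff F (Suc k)" and ?d' = "cdiff F (Suc (Suc k))"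
  note fd = minimal_free_resolution_diff and mod = minimal_free_resolution_module
  interpret d: mod_hom R ?X ?W ?d by (rule fd(1))
  interpret d': mod_hom R ?Y ?X ?d' by (rule fd(1))
  note cX = d.M.submodule_carrierD[OF submodule_P[OF mod]] and cY = d'.M.submodule_carrierD[OF submodule_P[OF mod]]
  let ?pw = "\<forall>j. \<forall>\<xi>\<in>carrier (piece (Suc k) j). gr_diff k j \<xi> = \<zero>\<^bsub>piece k j\<^esub> \<longrightarrow>
    (\<exists>\<eta>\<in>carrier (piece (Suc (Suc k)) j). gr_diff (Suc k) j \<eta> = \<xi>)"
  have mp: "module R (piece i j)" for i j by (rule module_gr_piece[OF mod])
  have zp: "\<zero>\<^bsub>piece i j\<^esub> \<in> carrier (piece i j)" for i j
    by (rule abelian_groupE(2)[OF module.axioms(2)[OF mp]])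
  have cyc: "X \<in> cycles ?L (Suc k) \<longleftrightarrow> X \<in> carrier (gr_module R m ?X (Suc k)) \<and>
      (\<forall>j. gr_diff k j (X j) = \<zero>\<^bsub>piece k j\<^esub>)" for X
    by (auto simp: cycles_def lin_complex_simps fun_eq_iff)
  have "cycles ?L (Suc k) \<subseteq> boundaries ?L (Suc k) \<longleftrightarrow> ?pw"
  proof
    assume sub: "cycles ?L (Suc k) \<subseteq> boundaries ?L (Suc k)"
    show ?pw
    proof (intro allI ballI impI)
      fix j \<xi> assume \<xi>: "\<xi> \<in> carrier (piece (Suc k) j)" "gr_diff k j \<xi> = \<zero>\<^bsub>piece k j\<^esub>"
      \<comment> \<open>A class in one piece, extended by zero to a family.\<close>
      define X where "X = (\<lambda>l. if l = j then \<xi> else \<zero>\<^bsub>piece (Suc k) l\<^esub>)"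
      have "finite {l. X l \<noteq> \<zero>\<^bsub>piece (Suc k) l\<^esub>}" by (rule finite_subset[of _ "{j}"]) (auto simp: X_def)
      then have "X \<in> cycles ?L (Suc k)"
        unfolding cyc using \<xi> zp mod_hom.hom_zero[OF piece_hom] by (auto simp: X_def)
      then obtain Y where Y: "Y \<in> carrier (gr_module R m ?Y (Suc (Suc k)))" "X = cdiff ?L (Suc (Suc k)) Y"
        using sub by (auto simp: boundaries_def lin_complex_simps(1) simp del: gr_module_simps)
      have "gr_diff (Suc k) j (Y j) = X j" unfolding Y(2) lin_complex_simps ..
      then show "\<exists>\<eta>\<in>carrier (piece (Suc (Suc k)) j). gr_diff (Suc k) j \<eta> = \<xi>"
        using Y(1) by (auto simp: X_def)
    qed
  next
    assume pw: ?pw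
    show "cycles ?L (Suc k) \<subseteq> boundaries ?L (Suc k)"
    proof
      fix X assume X: "X \<in> cycles ?L (Suc k)"
      \<comment> \<open>Preimages of zero components are chosen to be zero; otherwise the family of
        preimages might have infinite support and leave the direct sum.\<close>
      have "\<forall>j. \<exists>\<eta>. \<eta> \<in> carrier (piece (Suc (Suc k)) j) \<and> gr_diff (Suc k) j \<eta> = X j \<and>
          (X j = \<zero>\<^bsub>piece (Suc k) j\<^esub> \<longrightarrow> \<eta> = \<zero>\<^bsub>piece (Suc (Suc k)) j\<^esub>)"
      proof
        fix j
        show "\<exists>\<eta>. \<eta> \<in> carrier (piece (Suc (Suc k)) j) \<and> gr_diff (Suc k) j \<eta> = X j \<and>
          (X j = \<zero>\<^bsub>piece (Suc k) j\<^esub> \<longrightarrow> \<eta> = \<zero>\<^bsub>piece (Suc (Suc k)) j\<^esub>)"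
        proof (cases "X j = \<zero>\<^bsub>piece (Suc k) j\<^esub>")
          case True
          then show ?thesis using zp mod_hom.hom_zero[OF piece_hom] by metis
        next
          case False
          have "X j \<in> carrier (piece (Suc k) j)" "gr_diff k j (X j) = \<zero>\<^bsub>piece k j\<^esub>" using X unfolding cyc by auto
          then show ?thesis using pw False by blast
        qed
      qed
      then obtain Y where Y: "\<forall>j. Y j \<in> carrier (piece (Suc (Suc k)) j) \<and> gr_diff (Suc k) j (Y j) = X j \<and>
          (X j = \<zero>\<^bsub>piece (Suc k) j\<^esub> \<longrightarrow> Y j = \<zero>\<^bsub>piece (Suc (Suc k)) j\<^esub>)"
        by (rule choice[THEN exE])
      have "finite {j. Y j \<noteq> \<zero>\<^bsub>piece (Suc (Suc k)) j\<^esub>}"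
        by (rule finite_subset[of _ "{j. X j \<noteq> \<zero>\<^bsub>piece (Suc k) j\<^esub>}"]) (use X Y in \<open>auto simp: cyc\<close>)
      then have "Y \<in> carrier (gr_module R m ?Y (Suc (Suc k)))" using Y by simp
      moreover have "X = cdiff ?L (Suc (Suc k)) Y" using Y by (simp add: fun_eq_iff lin_complex_simps(2))
      ultimately show "X \<in> boundaries ?L (Suc k)"
        by (auto simp: boundaries_def lin_complex_simps(1) simp del: gr_module_simps)
    qed
  qed
  also have "?pw \<longleftrightarrow> (\<forall>j. \<forall>x\<in>P (j - Suc k) ?X. ?d x \<in> P (j + 1 - k) ?W \<longrightarrow>
      (\<exists>y\<in>P (j - Suc (Suc k)) ?Y. x \<ominus>\<^bsub>?X\<^esub> ?d' y \<in> P (j + 1 - Suc k) ?X))"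
  proof -
    have 1: "gr_diff k j (P (j + 1 - Suc k) ?X +>\<^bsub>?X\<^esub> x) = \<zero>\<^bsub>piece k j\<^esub> \<longleftrightarrow> ?d x \<in> P (j + 1 - k) ?W"
      if x: "x \<in> P (j - Suc k) ?X" for j x
    proof -
      have "?d x \<in> P 0 ?W" using d.hom_closed[OF cX[OF x]] P_0[OF mod] by simp
      then show ?thesis unfolding gr_diff_coset[OF fd x] gr_piece_zero by (rule coset_P_eq_iff[OF mod])
    qed
    have 2: "gr_diff (Suc k) j (P (j + 1 - Suc (Suc k)) ?Y +>\<^bsub>?Y\<^esub> y) = P (j + 1 - Suc k) ?X +>\<^bsub>?X\<^esub> x \<longleftrightarrow>
        x \<ominus>\<^bsub>?X\<^esub> ?d' y \<in> P (j + 1 - Suc k) ?X"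
      if x: "x \<in> P (j - Suc k) ?X" and y: "y \<in> P (j - Suc (Suc k)) ?Y" for j x y
      unfolding gr_diff_coset[OF fd y]
      using d.M.coset_eq_iff[OF submodule_P[OF mod] cX[OF x] d'.hom_closed[OF cY[OF y]]] by metis
    have ex: "(\<exists>\<eta>\<in>carrier (piece (Suc (Suc k)) j). gr_diff (Suc k) j \<eta> = P (j + 1 - Suc k) ?X +>\<^bsub>?X\<^esub> x) \<longleftrightarrow>
        (\<exists>y\<in>P (j - Suc (Suc k)) ?Y. x \<ominus>\<^bsub>?X\<^esub> ?d' y \<in> P (j + 1 - Suc k) ?X)"
      if x: "x \<in> P (j - Suc k) ?X" for j x
      using 2[OF x] unfolding Bex_def gr_piece_iff by blast
    have all: "(\<forall>\<xi>\<in>carrier (piece (Suc k) j). Q \<xi>) \<longleftrightarrow> (\<forall>x\<in>P (j - Suc k) ?X. Q (P (j + 1 - Suc k) ?X +>\<^bsub>?X\<^esub> x))"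
      for j Q unfolding Ball_def gr_piece_iff by blast
    show ?thesis unfolding all by (intro all_cong1 ball_cong refl imp_cong 1 ex)
  qed
  also have "\<dots> \<longleftrightarrow> lin_exact R m F (Suc k)"
  proof
    assume *: "\<forall>j. \<forall>x\<in>P (j - Suc k) ?X. ?d x \<in> P (j + 1 - k) ?W \<longrightarrow>
      (\<exists>y\<in>P (j - Suc (Suc k)) ?Y. x \<ominus>\<^bsub>?X\<^esub> ?d' y \<in> P (j + 1 - Suc k) ?X)"
    show "lin_exact R m F (Suc k)"
      unfolding lin_exact_def
    proof
      fix n
      have j: "n + Suc k - Suc k = n" "n + Suc k + 1 - k = n + 2" "n + Suc k - Suc (Suc k) = n - 1"
        "n + Suc k + 1 - Suc k = n + 1" by auto
      show "\<forall>x\<in>P n ?X. ?d x \<in> P (n + 2) (cmod F (Suc k - 1)) \<longrightarrow>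
          (\<exists>y\<in>P (n - 1) ?Y. x \<ominus>\<^bsub>?X\<^esub> ?d' y \<in> P (n + 1) ?X)"
        using spec[OF *, of "n + Suc k"] unfolding j diff_Suc_1 .
    qed
  next
    assume le: "lin_exact R m F (Suc k)"
    show "\<forall>j. \<forall>x\<in>P (j - Suc k) ?X. ?d x \<in> P (j + 1 - k) ?W \<longrightarrow>
      (\<exists>y\<in>P (j - Suc (Suc k)) ?Y. x \<ominus>\<^bsub>?X\<^esub> ?d' y \<in> P (j + 1 - Suc k) ?X)"
    proof (intro allI ballI impI)
      fix j x assume x: "x \<in> P (j - Suc k) ?X" and dx: "?d x \<in> P (j + 1 - k) ?W"
      show "\<exists>y\<in>P (j - Suc (Suc k)) ?Y. x \<ominus>\<^bsub>?X\<^esub> ?d' y \<in> P (j + 1 - Suc k) ?X"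
      proof (cases "j \<ge> Suc k")
        case True
        define n where "n = j - Suc k"
        have j: "j + 1 - k = n + 2" "j - Suc (Suc k) = n - 1" "j + 1 - Suc k = n + 1" "j - Suc k = n"
          using True by (auto simp: n_def)
        show ?thesis using le x dx unfolding lin_exact_def j diff_Suc_1 by blast
      next
        case False
        \<comment> \<open>Below the shift the graded piece is the zero module, so any y will
          do.\<close>
        then have "P (j + 1 - Suc k) ?X = carrier ?X" using P_0[OF mod] by simp
        then show ?thesis
          using cX[OF x] d'.M.submodule_zero[OF submodule_P[OF mod]] by (intro bexI[of _ "\<zero>\<^bsub>?Y\<^esub>"]) auto
      qed
    qed
  qed
  finally show ?thesis unfolding zero_module_lin_homology_iff .
qed

text \<open>In internal degree 0 the module \<open>F\<^sub>0/mF\<^sub>0\<close> is hit only by zero,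
  because the differential lands in \<open>mF\<^sub>0\<close>. If the homology vanished, then
  \<open>F\<^sub>0 = mF\<^sub>0\<close>, so \<open>F\<^sub>0\<close> = 0 by Nakayama, and its image
  M would be 0.\<close>

lemma lin_homology_0_nonzero:
  assumes M: "module R M" "\<not> zero_module M"
  shows "\<not> zero_module (homology (lin_complex R m F) 0)"
proof
  let ?L = "lin_complex R m F"
  note fd = minimal_free_resolution_diff and mod = minimal_free_resolution_module
  let ?X = "cmod F 0" and ?Y = "cmod F (Suc 0)"
  interpret M: module R M by fact
  interpret X: module R ?X by (rule mod)
  assume "zero_module (homology ?L 0)"
  then have sub: "carrier (gr_module R m ?X 0) \<subseteq> boundaries ?L 0"
    unfolding zero_module_lin_homology_iff by (simp add: cycles_def lin_complex_simps(1))
  have in_P1: "x \<in> P 1 ?X" if x: "x \<in> carrier ?X" for x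
  proof -
    define A where "A = (\<lambda>j. if j = 0 then P 1 ?X +>\<^bsub>?X\<^esub> x else \<zero>\<^bsub>piece 0 j\<^esub>)"
    have zp: "\<zero>\<^bsub>piece 0 j\<^esub> \<in> carrier (piece 0 j)" for j
      by (rule abelian_groupE(2)[OF module.axioms(2)[OF module_gr_piece[OF mod]]])
    have "P 1 ?X +>\<^bsub>?X\<^esub> x \<in> carrier (piece 0 0)"
      unfolding gr_piece_iff using x P_0[OF mod, of 0] by auto
    moreover have "finite {l. A l \<noteq> \<zero>\<^bsub>piece 0 l\<^esub>}" by (rule finite_subset[of _ "{0}"]) (auto simp: A_def)
    ultimately have "A \<in> carrier (gr_module R m ?X 0)" using zp by (simp add: A_def)
    then obtain B where B: "B \<in> carrier (gr_module R m ?Y (Suc 0))" "A = cdiff ?L (Suc 0) B"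
      using sub by (auto simp: boundaries_def lin_complex_simps(1) simp del: gr_module_simps)
    have "B 0 \<in> carrier (piece (Suc 0) 0)" using B(1) by simp
    then obtain y where y: "y \<in> P (0 - Suc 0) ?Y" "B 0 = P (0 + 1 - Suc 0) ?Y +>\<^bsub>?Y\<^esub> y"
      unfolding gr_piece_iff by blast
    have "P 1 ?X +>\<^bsub>?X\<^esub> x = A 0" by (simp add: A_def)
    also have "\<dots> = gr_diff 0 0 (B 0)" unfolding B(2) lin_complex_simps ..
    also have "\<dots> = P (0 + 1 - 0) ?X +>\<^bsub>?X\<^esub> cdiff F (Suc 0) y" unfolding y(2) by (rule gr_diff_coset[OF fd y(1)])
    also have "\<dots> = P (0 + 1 - 0) ?X"
    proof -
      have "cdiff F (Suc 0) y \<in> P (0 + 1 - 0) ?X" by (rule P_hom_minimal[OF fd y(1)]) simp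
      then show ?thesis using coset_P_eq_iff[OF mod] by blast
    qed
    finally have "P 1 ?X +>\<^bsub>?X\<^esub> x = P 1 ?X" by simp
    then show ?thesis using coset_P_eq_iff[OF mod, of x 0 0 1] x P_0[OF mod, of 0] by simp
  qed
  have "carrier ?X = {\<zero>\<^bsub>?X\<^esub>}"
  proof (rule ccontr)
    assume "carrier ?X \<noteq> {\<zero>\<^bsub>?X\<^esub>}"
    then have "{\<zero>\<^bsub>?X\<^esub>} \<subset> carrier ?X" by auto
    moreover have "fin_gen_module R ?X" using F by (simp add: minimal_free_resolution_def)
    ultimately obtain L where L: "submodule L R ?X" "L \<subset> carrier ?X" "\<forall>a\<in>m. \<forall>x\<in>carrier ?X. a \<odot>\<^bsub>?X\<^esub> x \<in> L"
      using nakayama[OF mod _ X.submodule_zero_module X.carrier_is_submodule] by blast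
    have "ideal_smult R m ?X \<subseteq> L" by (rule X.ideal_smult_least[OF L(1)]) (use L(3) in blast)
    then show False using in_P1 P_1[OF mod, of 0] L(2) by blast
  qed
  moreover obtain e where "mod_hom R ?X M e" "e ` carrier ?X = carrier M"
    using augmentation_exists[of R M F] F M(1) unfolding minimal_free_resolution_def augmentation_def by blast
  ultimately have "carrier M = {\<zero>\<^bsub>M\<^esub>}" using mod_hom.hom_zero[of R ?X M e] by auto
  then show False using M(2) by (simp add: zero_module_def)
qed

end

section \<open>From the chosen resolutions to the three statements\<close>

lemma nu_vanishes_iff_nu_criterion:
  assumes M: "fin_gen_module R M" and F: "free_resolution R M F"
  shows "nu_vanishes R m n (Suc k) M \<longleftrightarrow> nu_criterion R m F n (Suc k)"
proof -
  have mM: "module R M" using M by (simp add: fin_gen_module_def)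
  let ?G = "some_free_resolution R M"
  \<comment> \<open>The chosen resolution is known to be one only after some resolution has been
    found in this very type. \<open>F\<close> itself may live in any type, and
    \<open>nu_criterion_transfer\<close> connects the two.\<close>
  obtain G :: "('a, nat \<Rightarrow> 'a) chain_complex" where "free_resolution R M G"
    using minimal_free_resolution_exists[OF M] unfolding minimal_free_resolution_def by blast
  then have G: "free_resolution R M ?G" unfolding some_free_resolution_def by (rule someI)
  have "nu_vanishes R m n (Suc k) M \<longleftrightarrow> nu_criterion R m ?G n (Suc k)"
    by (rule nu_vanishes_iff[OF free_resolution_hom[OF G]]) simp_all
  then show ?thesis using nu_criterion_transfer[OF mM F G] nu_criterion_transfer[OF mM G F] by blast
qed

lemma lin_homology_iff_nu_vanishes:
  assumes M: "fin_gen_module R M" and F: "minimal_free_resolution R m M F" and i: "i > 0"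
  shows "zero_module (homology (lin_complex R m F) i) \<longleftrightarrow>
    (\<forall>n>0. nu_vanishes R m n (i + 1) M \<and> nu_vanishes R m n i M)"
proof -
  obtain k where k: "i = Suc k" using gr0_implies_Suc[OF i] by blast
  have F': "free_resolution R M F" using F by (simp add: minimal_free_resolution_def)
  show ?thesis
    unfolding k zero_module_lin_homology_iff_lin_exact[OF F] lin_exact_iff_nu_criterion[OF F]
    by (simp add: nu_vanishes_iff_nu_criterion[OF M F'])
qed

text \<open>As \<open>m\<^sup>0\<close> = R, the criterion for n = 0 asks only for membership in the
  whole module, and y = 0 serves. This extends the range n > 0 from the linear part to n \<ge>
  0.\<close>

lemma nu_vanishes_0:
  assumes M: "fin_gen_module R M"
  shows "nu_vanishes R m 0 (Suc k) M"
proof -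
  obtain F :: "('a, nat \<Rightarrow> 'a) chain_complex" where F: "free_resolution R M F"
    using minimal_free_resolution_exists[OF M] unfolding minimal_free_resolution_def by blast
  interpret d: mod_hom R "cmod F (Suc (Suc k))" "cmod F (Suc k)" "cdiff F (Suc (Suc k))"
    by (rule free_resolution_hom_Suc[OF F])
  show ?thesis
    unfolding nu_vanishes_iff_nu_criterion[OF M F] nu_criterion_power_smult P_0[OF d.N.module_axioms]
    by (intro ballI impI bexI[of _ "\<zero>\<^bsub>cmod F (Suc (Suc k))\<^esub>"]) simp_all
qed

text \<open>For M \<noteq> 0 the supremum is at most d exactly when the linear part has no homology
  beyond d. The defect of M = 0 is 0 by convention, so there the right-hand side must be shown to
  hold always.\<close>

lemma linearity_defect_le_iff:
  assumes M: "fin_gen_module R M"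
  shows "linearity_defect R m M \<le> ereal (real d) \<longleftrightarrow> (\<forall>i>d. \<forall>n\<ge>0. nu_vanishes R m n i M)"
proof (cases "zero_module M")
  case True
  have mM: "module R M" using M by (simp add: fin_gen_module_def)
  obtain F :: "('a, nat \<Rightarrow> 'a) chain_complex" where F: "free_resolution R M F"
    using minimal_free_resolution_exists[OF M] unfolding minimal_free_resolution_def by blast
  have "nu_vanishes R m n i M" if "i > d" for n i
  proof -
    obtain k where "i = Suc k" using gr0_implies_Suc[of i] \<open>i > d\<close> by auto
    then show ?thesis
      using nu_criterion_zero_module[OF mM True F] nu_vanishes_iff_nu_criterion[OF M F] by simp
  qed
  then show ?thesis using True by (simp add: linearity_defect_def)
next
  case False
  let ?F = "some_minimal_free_resolution R m M"
  have F: "minimal_free_resolution R m M ?F"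
    unfolding some_minimal_free_resolution_def by (rule someI_ex[OF minimal_free_resolution_exists[OF M]])
  let ?H = "\<lambda>i. zero_module (homology (lin_complex R m ?F) i)"
  have "linearity_defect R m M \<le> ereal (real d) \<longleftrightarrow> (\<forall>i. \<not> ?H i \<longrightarrow> i \<le> d)"
    using False by (auto simp: linearity_defect_def Sup_le_iff)
  also have "\<dots> \<longleftrightarrow> (\<forall>i>d. ?H i)" by (meson not_le)
  also have "\<dots> \<longleftrightarrow> (\<forall>i>d. \<forall>n>0. nu_vanishes R m n (i + 1) M \<and> nu_vanishes R m n i M)"
    using lin_homology_iff_nu_vanishes[OF M F] by simp
  \<comment> \<open>The condition in degree i + 1 is absorbed, since i + 1 is also beyond d.\<close>
  also have "\<dots> \<longleftrightarrow> (\<forall>i>d. \<forall>n>0. nu_vanishes R m n i M)" by (meson less_add_one less_trans)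
  also have "\<dots> \<longleftrightarrow> (\<forall>i>d. \<forall>n\<ge>0. nu_vanishes R m n i M)"
  proof -
    have "nu_vanishes R m 0 i M" if "i > d" for i
      using nu_vanishes_0[OF M, of "i - 1"] that by simp
    then show ?thesis by (metis neq0_conv zero_le)
  qed
  finally show ?thesis .
qed

text \<open>A supremum in the extended reals is negative infinity on the empty set, so that a defect
  \<le> 0 yields defect = 0 only once degree 0 is known to occur.\<close>

lemma linearity_defect_nonneg:
  assumes M: "fin_gen_module R M"
  shows "linearity_defect R m M \<ge> 0"
proof (cases "zero_module M")
  case False
  let ?F = "some_minimal_free_resolution R m M"
  have F: "minimal_free_resolution R m M ?F"
    unfolding some_minimal_free_resolution_def by (rule someI_ex[OF minimal_free_resolution_exists[OF M]])
  have "\<not> zero_module (homology (lin_complex R m ?F) 0)"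
    by (rule lin_homology_0_nonzero[OF F _ False]) (use M in \<open>simp add: fin_gen_module_def\<close>)
  then have "ereal (real 0) \<in> {ereal (real i) | i. \<not> zero_module (homology (lin_complex R m ?F) i)}" by blast
  from Sup_upper[OF this] show ?thesis using False by (simp add: linearity_defect_def zero_ereal_def)
qed (simp add: linearity_defect_def)

end

theorem theorem2p2:
  fixes R :: "('a, 'r) ring_scheme" and m :: "'a set" and M :: "('a, 'b, 's) module_scheme"
  assumes "local_ring R m" and "noetherian_ring R" and "m \<noteq> {\<zero>\<^bsub>R\<^esub>}"
    and "fin_gen_module R M"
  shows
    "(\<forall>(i::nat) (F :: ('a, 'f) chain_complex). i > 0 \<and> minimal_free_resolution R m M F \<longrightarrow>
        (zero_module (homology (lin_complex R m F) i) \<longleftrightarrow>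
         (\<forall>n>0. nu_vanishes R m n (i + 1) M \<and> nu_vanishes R m n i M))) \<and>
     (\<forall>d::nat. linearity_defect R m M \<le> ereal (real d) \<longleftrightarrow>
         (\<forall>i>d. \<forall>n\<ge>0. nu_vanishes R m n i M)) \<and>
     (linearity_defect R m M = 0 \<longleftrightarrow> (\<forall>i>0. \<forall>n\<ge>0. nu_vanishes R m n i M))"
proof -
  interpret noetherian_local R m
    using assms(1,2) by (simp add: noetherian_local_def noetherian_local_axioms_def local_ring_def)
  have "linearity_defect R m M = 0 \<longleftrightarrow> linearity_defect R m M \<le> ereal (real 0)"
    using linearity_defect_nonneg[OF assms(4)] by (auto simp: zero_ereal_def)
  then show ?thesis
    using lin_homology_iff_nu_vanishes[OF assms(4)] linearity_defect_le_iff[OF assms(4)] by blast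
qed

end
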